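(* Let $1\le p\le2$, let $(c_j,v_j)_{j=1}^m\subseteq(0,1]\times S^{n-1}$ provide a decomposition of the identity in $\mathbb{R}^n$, let $(\alpha_j)_{j=1}^m\subseteq(0,\infty)$, and let $K_p$ be the unit ball of the norm $\|x\|_{K_p}=\big(\sum_{j=1}^m\alpha_j|\langle x,v_j\rangle|^p\big)^{1/p}$ on $\mathbb{R}^n$. Then, for any $k$-dimensional linear subspace $H$ of $\mathbb{R}^n$, we have $$\mathrm{vol}_k(K_p\cap H)\ge\frac{\mathrm{vol}_k(B_p^k)\,(\pi(m_0-k))^{\frac{m_0-k}{2}}}{\alpha_p^k(2\pi)^{m_0-k}}\prod_{j\in J}\left(\frac{\sqrt{c_j}}{\alpha_j^{1/p}}\right)\frac{1}{\Gamma(\beta)}\int_0^\infty t^{\beta-1}\prod_{j\in\tilde J}\gamma_p\left(\sqrt{t\,\tfrac{c_j}{\alpha_j^{2/p}}(1-\tilde c_j)}\right)dt,$$ where $\beta=(m_0-k)/2$. On the other hand, $$\mathrm{vol}_k(K_p\cap H)\le\frac{\mathrm{vol}_k(B_p^k)\prod_{j\in J}\left(\frac{c_j^{p/2}}{\alpha_j}\right)^{\frac{c_j\|P_Hv_j\|_2^2}{p}}}{\alpha_p^k(2\pi)^{m_0-k}}\prod_{j\in\tilde J}\left(\int_{\mathbb{R}}\gamma_p^{\frac{1}{1-\tilde c_j}}\big(\sqrt{1-\tilde c_j}\,t\big)\,dt\right)^{1-\tilde c_j}\le\mathrm{vol}_k(B_p^k)\prod_{j\in J}\left(\frac{c_j^{p/2}}{\alpha_j}\right)^{\frac{c_j\|P_Hv_j\|_2^2}{p}}.$$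 Here $J=\{1\le j\le m:P_Hv_j\neq0\}$, $m_0$ is the cardinality of $J$, $\tilde c_j=c_j\|P_Hv_j\|_2^2$ for every $j\in J$, and $\tilde J=\{j\in J:\tilde c_j\neq1\}$.
   Context: $(c_j,v_j)_{j=1}^m$ provides a decomposition of the identity in $\mathbb{R}^n$ if $\mathrm{Id}_n=\sum_{j=1}^mc_j\,v_j\otimes v_j$. $P_H$ is the orthogonal projection onto $H$. $B_p^k$ is the closed unit ball of $\ell_p^k$. $\gamma_p(s)=\int_{\mathbb{R}}e^{-|x|^p}e^{ixs}\,dx$ for $s\in\mathbb{R}$, $\gamma_p^{r}(s)$ denotes $(\gamma_p(s))^{r}$, and $\alpha_p=2\Gamma\left(1+\frac1p\right)$ (a constant depending only on $p$, not to be confused with the scalars $\alpha_j$).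
   Formalization: The middle term of the upper bound is multiplied by α_p^{|J∖J̃|}, since as printed the first upper inequality fails when some c̃_j=1 (e.g. n=m=k=p=1, H=ℝ); if m_0=k, the expression (1/Γ(β))∫… in the lower bound is read as its limit 1. *)

theory Defs
  imports "HOL-Analysis.Analysis"
begin

definition tensor :: "'a::real_inner \<Rightarrow> 'a \<Rightarrow> 'a \<Rightarrow> 'a" where
  "tensor u w = (\<lambda>x. (u \<bullet> x) *\<^sub>R w)"

definition decomposition_of_identity ::
    "nat \<Rightarrow> (nat \<Rightarrow> real) \<Rightarrow> (nat \<Rightarrow> 'a::real_inner) \<Rightarrow> bool" where
  "decomposition_of_identity m c v \<longleftrightarrow>
     id = (\<lambda>x. \<Sum>j=1..m. c j *\<^sub>R tensor (v j) (v j) x)"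

definition orth_proj :: "'a::euclidean_space set \<Rightarrow> 'a \<Rightarrow> 'a" where
  "orth_proj H x = (THE y. y \<in> H \<and> (\<forall>z\<in>H. orthogonal (x - y) z))"

lemma orth_proj_ex1:
  fixes H :: "'a::euclidean_space set"
  assumes "subspace H"
  shows "\<exists>!y. y \<in> H \<and> (\<forall>z\<in>H. orthogonal (x - y) z)"
proof -
  obtain y z where yz: "y \<in> span H" "\<And>w. w \<in> span H \<Longrightarrow> orthogonal z w" "x = y + z"
    using orthogonal_subspace_decomp_exists[of H x] by metis
  have span: "span H = H"
    using assms by (simp add: span_eq_iff)
  show ?thesis
  proof (rule ex1I[of _ y])
    show "y \<in> H \<and> (\<forall>w\<in>H. orthogonal (x - y) w)"
      using yz span by simp
  next
    fix y'
    assume y': "y' \<in> H \<and> (\<forall>w\<in>H. orthogonal (x - y') w)"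
    have mem: "y' - y \<in> H"
      using y' yz(1) span assms by (simp add: subspace_diff)
    have "(x - y') \<bullet> (y' - y) = 0" "(x - y) \<bullet> (y' - y) = 0"
      using y' yz(2,3) mem span by (simp_all add: orthogonal_def)
    then have "(y' - y) \<bullet> (y' - y) = 0"
      by (simp add: inner_diff_left)
    then show "y' = y"
      by simp
  qed
qed

lemma orth_proj:
  fixes H :: "'a::euclidean_space set"
  assumes "subspace H"
  shows "orth_proj H x \<in> H" and "z \<in> H \<Longrightarrow> orthogonal (x - orth_proj H x) z"
  using theI'[OF orth_proj_ex1[OF assms, of x]] unfolding orth_proj_def by blast+

definition orthonormal_basis_of :: "'a::euclidean_space set \<Rightarrow> 'a set \<Rightarrow> bool" where
  "orthonormal_basis_of H B \<longleftrightarrow>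
     pairwise orthogonal B \<and> (\<forall>b\<in>B. norm b = 1) \<and> span B = H"

lemma orthonormal_basis_of_ex:
  fixes H :: "'a::euclidean_space set"
  assumes "subspace H"
  shows "\<exists>B. orthonormal_basis_of H B"
  using orthonormal_basis_subspace[OF assms] unfolding orthonormal_basis_of_def by metis

(* Lebesgue measure of dimension (dim H) carried by the subspace H, regarded as a Borel measure
   on the ambient space.  It is the definition of lborel, with Basis replaced by an orthonormal
   basis of H; the result does not depend on that basis. *)
definition subspace_lborel :: "'a::euclidean_space set \<Rightarrow> 'a measure" where
  "subspace_lborel H =
     (let B = (SOME B. orthonormal_basis_of H B)
      in distr (\<Pi>\<^sub>M b\<in>B. lborel) borel (\<lambda>f. \<Sum>b\<in>B. f b *\<^sub>R b))"

definition vol_on :: "'a::euclidean_space set \<Rightarrow> 'a set \<Rightarrow> real" where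
  "vol_on H S = measure (subspace_lborel H) S"

definition norm_Kp ::
    "real \<Rightarrow> nat \<Rightarrow> (nat \<Rightarrow> real) \<Rightarrow> (nat \<Rightarrow> 'a::real_inner) \<Rightarrow> 'a \<Rightarrow> real" where
  "norm_Kp p m \<alpha> v x = (\<Sum>j=1..m. \<alpha> j * \<bar>x \<bullet> v j\<bar> powr p) powr (1 / p)"

definition Kp ::
    "real \<Rightarrow> nat \<Rightarrow> (nat \<Rightarrow> real) \<Rightarrow> (nat \<Rightarrow> 'a::real_inner) \<Rightarrow> 'a set" where
  "Kp p m \<alpha> v = {x. norm_Kp p m \<alpha> v x \<le> 1}"

(* The coordinate space of dimension k is the set of extensional functions on {..<k}, so that the
   dimension can be a natural number (including 0, where the ball has volume 1). *)
definition ball_lp :: "real \<Rightarrow> nat \<Rightarrow> (nat \<Rightarrow> real) set" where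
  "ball_lp p k = {x \<in> extensional {..<k}. (\<Sum>i<k. \<bar>x i\<bar> powr p) powr (1 / p) \<le> 1}"

definition vol_ball_lp :: "real \<Rightarrow> nat \<Rightarrow> real" where
  "vol_ball_lp p k = measure (\<Pi>\<^sub>M i\<in>{..<k}. lborel) (ball_lp p k)"

(* alpha_p p = gamma_p p 0.  It is also the limit, as c increases to 1, of the Brascamp-Lieb factor
   (integral of gamma_p p (sqrt (1 - c) * t) powr (1 / (1 - c)) over t) powr (1 - c).  An index j
   with c_j * |P_H v_j|^2 = 1 therefore contributes alpha_p p to the upper bound for the volume. *)
definition alpha_p :: "real \<Rightarrow> real" where
  "alpha_p p = 2 * Gamma (1 + 1 / p)"

(* Taking the real part loses nothing, by gamma_p_complex; it makes real powers available. *)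
definition gamma_p :: "real \<Rightarrow> real \<Rightarrow> real" where
  "gamma_p p s =
     Re (LINT x|lborel. complex_of_real (exp (- (\<bar>x\<bar> powr p))) * exp (\<i> * complex_of_real (x * s)))"

lemma gamma_p_complex:
  "complex_of_real (gamma_p p s) =
     (LINT x|lborel. complex_of_real (exp (- (\<bar>x\<bar> powr p))) * exp (\<i> * complex_of_real (x * s)))"
    (is "_ = integral\<^sup>L lborel ?f")
proof -
  have "integral\<^sup>L lborel ?f = (LINT x|lborel. ?f (- x))"
    using lborel_integral_real_affine[of "-1" ?f 0] by simp
  also have "\<dots> = (LINT x|lborel. cnj (?f x))"
    by (intro Bochner_Integration.integral_cong) (simp_all add: exp_cnj)
  also have "\<dots> = cnj (integral\<^sup>L lborel ?f)"
    by (rule Bochner_Integration.integral_cnj)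
  finally have "Im (integral\<^sup>L lborel ?f) = 0"
    by (metis Reals_cnj_iff complex_is_Real_iff)
  then show ?thesis
    unfolding gamma_p_def by (simp add: complex_eq_iff)
qed

(* The expression 1/Gamma(beta) * (integral of t^(beta-1) f(t) over (0,oo)).  At beta = 0 it has
   the indeterminate form 0 * oo and denotes its limit f(0) as beta decreases to 0, because the
   measures t^(beta-1) exp(-t) dt / Gamma(beta) converge to the unit mass at 0.  Without this case
   the library value Gamma 0 = 0 would turn the expression into 0. *)
definition gamma_mean :: "real \<Rightarrow> (real \<Rightarrow> real) \<Rightarrow> real" where
  "gamma_mean \<beta> f =
     (if \<beta> = 0 then f 0
      else 1 / Gamma \<beta> * (LINT t:{0<..}|lborel. t powr (\<beta> - 1) * f t))"

end

theory Submission
  imports Defs "HOL-Probability.Probability" "HOL-Real_Asymp.Real_Asymp"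
begin

text \<open>Choose an orthonormal basis of \<open>H\<close>. Since the identity decomposes, the map
\<open>x \<mapsto> (sqrt c\<^sub>j <x, v\<^sub>j>)\<^sub>j\<close> embeds \<open>H\<close> isometrically into \<open>\<real>\<^sup>J\<close>; let \<open>E\<close> be its image and \<open>d = m0 - k\<close> the
dimension of \<open>E\<^sup>\<bottom>\<close>. The norm of \<open>K\<^sub>p\<close> is homogeneous, so integrating \<open>exp (- \<parallel>x\<parallel>\<^sup>p)\<close> over \<open>H\<close> gives the
volume of the section up to the factor that turns the same integral for \<open>l\<^sub>p\<^sup>k\<close> into the volume of its ball
(\<open>vol_on_section_Kp\<close>). What has to be estimated is therefore the integral over \<open>E\<close> of the product of
the functions \<open>f\<^sub>j y\<^sub>j = exp (- |y\<^sub>j / A\<^sub>j|\<^sup>p)\<close>, where \<open>A\<^sub>j = sqrt c\<^sub>j / \<alpha>\<^sub>j\<^sup>1\<^sup>/\<^sup>p\<close>.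

Fourier duality moves this integral to \<open>E\<^sup>\<bottom>\<close>: it equals \<open>(2 pi)\<^sup>-\<^sup>d\<close> times the integral over \<open>E\<^sup>\<bottom>\<close> of the
product of the transforms \<open>g\<^sub>j z\<^sub>j = A\<^sub>j \<gamma>\<^sub>p (A\<^sub>j z\<^sub>j)\<close>. The proof replaces Lebesgue measure on \<open>E\<^sup>\<bottom>\<close> by
a Gaussian measure of variance \<open>T\<close>, because for each \<open>T\<close> there is an exact identity in which the \<open>f\<^sub>j\<close> are
smoothed by a Gaussian of variance \<open>1/T\<close> (\<open>gaussian_duality\<close>), and lets \<open>T\<close> tend to infinity
(\<open>gauss_average_tendsto\<close>). Under the Gaussian measure the coordinate \<open>z\<^sub>j\<close> is normal with variance \<open>T w\<^sub>j\<close>,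
where \<open>w\<^sub>j = 1 - ct\<^sub>j\<close> is the squared length of the projection of the \<open>j\<close>-th unit vector to \<open>E\<^sup>\<bottom>\<close>, and the
\<open>w\<^sub>j\<close> add up to \<open>d\<close>.

The upper bound is the rank-one Brascamp-Lieb inequality in Gaussian form,
\<open>E (\<Prod>\<^sub>j h\<^sub>j z\<^sub>j) \<le> \<Prod>\<^sub>j (E h\<^sub>j z\<^sub>j\<^sup>1\<^sup>/\<^sup>w)\<^sup>w\<close> with \<open>w = w\<^sub>j\<close> (\<open>gaussian_brascamp_lieb\<close>). It is proved by the heat
flow in discrete time: run \<open>n\<close> independent Gaussian steps of variance \<open>1/n\<close>; by a second-order expansion one step
loses at most a factor \<open>1 + O (n\<^sup>-\<^sup>3\<^sup>/\<^sup>2)\<close>, because the quadratic term is nonpositive, so that all steps together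
lose nothing in the limit.

The other two estimates use that \<open>\<gamma>\<^sub>p\<close> is a mixture of centred Gaussians for \<open>1 \<le> p \<le> 2\<close>
(\<open>gaussian_mixture_gamma_p\<close>). As a function of \<open>t\<^sup>2\<close> such a mixture is log-convex, so
\<open>\<gamma>\<^sub>p (sqrt w t)\<^sup>1\<^sup>/\<^sup>w \<le> \<alpha>\<^sub>p\<^sup>1\<^sup>/\<^sup>w\<^sup>-\<^sup>1 \<gamma>\<^sub>p t\<close>; together with \<open>\<integral> \<gamma>\<^sub>p \<le> 2 pi\<close> this compares the two upper bounds. For
the lower bound, both sides are linear in each \<open>g\<^sub>j\<close>, so it suffices to treat Gaussians. Then it says that
the mean of \<open>exp (- \<Sum>\<^sub>j \<omega>\<^sub>j z\<^sub>j\<^sup>2)\<close> is at least \<open>(1 + 2 W / d)\<^sup>-\<^sup>d\<^sup>/\<^sup>2\<close> with \<open>W = \<Sum>\<^sub>j \<omega>\<^sub>j w\<^sub>j\<close>, which is the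
arithmetic-geometric mean inequality for the eigenvalues of a quadratic form and follows from \<open>e\<^sup>u \<ge> 1 + u\<close>
(\<open>gaussian_quadratic_exponential_lower\<close>). The right-hand side is the mean of \<open>exp (- 2 t W / d)\<close> for a
Gamma-distributed \<open>t\<close>, which is where the integral in the lower bound comes from.\<close>

section \<open>Linear forms in independent standard normal variables\<close>

abbreviation std_normals :: "'i set \<Rightarrow> ('i \<Rightarrow> real) measure" where
  "std_normals I \<equiv> Pi\<^sub>M I (\<lambda>_. std_normal_distribution)"

lemma prob_space_std_normal [simp, intro]: "prob_space std_normal_distribution"
  using real_dist_normal_dist by (simp add: real_distribution_def)

interpretation std_normals: product_sigma_finite "\<lambda>_. std_normal_distribution"
  by (simp add: product_sigma_finite_def prob_space_imp_sigma_finite)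

lemma prob_space_std_normals [simp, intro]: "prob_space (std_normals I)"
  by (intro prob_space_PiM) simp

lemma linear_form_measurable [measurable]:
  "(\<lambda>x. \<Sum>i\<in>I. b i * x i) \<in> borel_measurable (std_normals I)"
  "(\<lambda>x. \<Sum>i\<in>I. b i * x i) \<in> borel_measurable (Pi\<^sub>M I (\<lambda>_. lborel))"
  by (auto intro!: borel_measurable_sum borel_measurable_times measurable_compose[OF measurable_component_singleton])

lemma char_linear_form:
  assumes "finite I"
  shows "(CLINT x|std_normals I. iexp (\<Sum>i\<in>I. b i * x i)) = exp (- (\<Sum>i\<in>I. (b i)\<^sup>2) / 2)"
proof -
  have int: "integrable std_normal_distribution (\<lambda>x. iexp (t * x))" for t
    by (rule prob_space.integrable_iexp) auto
  have "(CLINT x|std_normals I. iexp (\<Sum>i\<in>I. b i * x i)) = (CLINT x|std_normals I. \<Prod>i\<in>I. iexp (b i * x i))"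
    using assms by (simp add: sum_distrib_left exp_sum)
  also have "\<dots> = (\<Prod>i\<in>I. CLINT x|std_normal_distribution. iexp (b i * x))"
    by (rule std_normals.product_integral_prod[OF assms int])
  also have "\<dots> = (\<Prod>i\<in>I. char std_normal_distribution (b i))"
    by (simp add: char_def)
  also have "\<dots> = exp (- (\<Sum>i\<in>I. (b i)\<^sup>2) / 2)"
    using assms by (simp add: char_std_normal_distribution exp_sum sum_negf[symmetric] sum_divide_distrib
        flip: of_real_prod)
  finally show ?thesis .
qed

text \<open>Both laws have the characteristic function of a centred normal variable with variance \<open>\<Sum>\<^sub>i b\<^sub>i\<^sup>2\<close>.\<close>

lemma distr_linear_form:
  assumes "finite I"
  shows "distr (std_normals I) borel (\<lambda>x. \<Sum>i\<in>I. b i * x i) =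
         distr std_normal_distribution borel (\<lambda>x. sqrt (\<Sum>i\<in>I. (b i)\<^sup>2) * x)"
proof (rule Levy_uniqueness)
  show "real_distribution (distr (std_normals I) borel (\<lambda>x. \<Sum>i\<in>I. b i * x i))"
    by (auto simp: real_distribution_def real_distribution_axioms_def intro!: prob_space.prob_space_distr)
  show "real_distribution (distr std_normal_distribution borel (\<lambda>x. sqrt (\<Sum>i\<in>I. (b i)\<^sup>2) * x))"
    by (auto simp: real_distribution_def real_distribution_axioms_def intro!: prob_space.prob_space_distr)
  show "char (distr (std_normals I) borel (\<lambda>x. \<Sum>i\<in>I. b i * x i)) =
        char (distr std_normal_distribution borel (\<lambda>x. sqrt (\<Sum>i\<in>I. (b i)\<^sup>2) * x))"
  proof
    fix t
    have "char (distr (std_normals I) borel (\<lambda>x. \<Sum>i\<in>I. b i * x i)) t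
        = (CLINT x|std_normals I. iexp (\<Sum>i\<in>I. (t * b i) * x i))"
      by (simp add: char_def integral_distr sum_distrib_left mult.assoc)
    also have "\<dots> = exp (- (t * sqrt (\<Sum>i\<in>I. (b i)\<^sup>2))\<^sup>2 / 2)"
      by (subst char_linear_form[OF assms])
         (simp add: power_mult_distrib sum_nonneg flip: sum_distrib_left exp_of_real of_real_sum of_real_power of_real_mult)
    also have "\<dots> = char std_normal_distribution (t * sqrt (\<Sum>i\<in>I. (b i)\<^sup>2))"
      by (simp add: char_std_normal_distribution flip: exp_of_real)
    also have "\<dots> = char (distr std_normal_distribution borel (\<lambda>x. sqrt (\<Sum>i\<in>I. (b i)\<^sup>2) * x)) t"
      by (simp add: char_def integral_distr mult.assoc)
    finally show "char (distr (std_normals I) borel (\<lambda>x. \<Sum>i\<in>I. b i * x i)) t = \<dots>" .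
  qed
qed

lemma nn_integral_linear_form:
  assumes "finite I" and [measurable]: "g \<in> borel_measurable borel"
  shows "(\<integral>\<^sup>+x. g (\<Sum>i\<in>I. b i * x i) \<partial>std_normals I) =
         (\<integral>\<^sup>+x. g (sqrt (\<Sum>i\<in>I. (b i)\<^sup>2) * x) \<partial>std_normal_distribution)"
proof -
  have "(\<integral>\<^sup>+x. g (\<Sum>i\<in>I. b i * x i) \<partial>std_normals I) =
        (\<integral>\<^sup>+x. g x \<partial>distr (std_normals I) borel (\<lambda>x. \<Sum>i\<in>I. b i * x i))"
    by (simp add: nn_integral_distr)
  also have "\<dots> = (\<integral>\<^sup>+x. g (sqrt (\<Sum>i\<in>I. (b i)\<^sup>2) * x) \<partial>std_normal_distribution)"
    unfolding distr_linear_form[OF assms(1)] by (subst nn_integral_distr) simp_all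
  finally show ?thesis .
qed

lemma integrable_linear_form:
  fixes g :: "real \<Rightarrow> 'b::{banach, second_countable_topology}"
  assumes "finite I" and [measurable]: "g \<in> borel_measurable borel"
  shows "integrable (std_normals I) (\<lambda>x. g (\<Sum>i\<in>I. b i * x i)) \<longleftrightarrow>
         integrable std_normal_distribution (\<lambda>x. g (sqrt (\<Sum>i\<in>I. (b i)\<^sup>2) * x))"
proof -
  have "integrable (std_normals I) (\<lambda>x. g (\<Sum>i\<in>I. b i * x i)) \<longleftrightarrow>
    integrable (distr (std_normals I) borel (\<lambda>x. \<Sum>i\<in>I. b i * x i)) g"
    by (simp add: integrable_distr_eq)
  also have "\<dots> \<longleftrightarrow> integrable std_normal_distribution (\<lambda>x. g (sqrt (\<Sum>i\<in>I. (b i)\<^sup>2) * x))"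
    unfolding distr_linear_form[OF assms(1)] by (subst integrable_distr_eq) simp_all
  finally show ?thesis .
qed

lemma integral_linear_form:
  fixes g :: "real \<Rightarrow> 'b::{banach, second_countable_topology}"
  assumes "finite I" and [measurable]: "g \<in> borel_measurable borel"
  shows "(\<integral>x. g (\<Sum>i\<in>I. b i * x i) \<partial>std_normals I) =
         (\<integral>x. g (sqrt (\<Sum>i\<in>I. (b i)\<^sup>2) * x) \<partial>std_normal_distribution)"
proof -
  have "(\<integral>x. g (\<Sum>i\<in>I. b i * x i) \<partial>std_normals I) =
        (\<integral>x. g x \<partial>distr (std_normals I) borel (\<lambda>x. \<Sum>i\<in>I. b i * x i))"
    by (simp add: integral_distr)
  also have "\<dots> = (\<integral>x. g (sqrt (\<Sum>i\<in>I. (b i)\<^sup>2) * x) \<partial>std_normal_distribution)"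
    unfolding distr_linear_form[OF assms(1)] by (subst integral_distr) simp_all
  finally show ?thesis .
qed

lemma linear_form_moment:
  assumes "finite I"
  shows "integrable (std_normals I) (\<lambda>x. (\<Sum>i\<in>I. b i * x i) ^ n)"
    and "(\<integral>x. (\<Sum>i\<in>I. b i * x i) \<partial>std_normals I) = 0"
    and "(\<integral>x. (\<Sum>i\<in>I. b i * x i)\<^sup>2 \<partial>std_normals I) = (\<Sum>i\<in>I. (b i)\<^sup>2)"
proof -
  show "integrable (std_normals I) (\<lambda>x. (\<Sum>i\<in>I. b i * x i) ^ n)"
    using integrable_linear_form[OF assms, of "\<lambda>t. t ^ n" b]
    by (simp add: power_mult_distrib integrable_std_normal_distribution_moment)
  show "(\<integral>x. (\<Sum>i\<in>I. b i * x i) \<partial>std_normals I) = 0"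
    using integral_linear_form[OF assms, of "\<lambda>t. t" b] integral_std_normal_distribution_moment_odd[of 1]
    by simp
  show "(\<integral>x. (\<Sum>i\<in>I. b i * x i)\<^sup>2 \<partial>std_normals I) = (\<Sum>i\<in>I. (b i)\<^sup>2)"
    using integral_linear_form[OF assms, of "\<lambda>t. t\<^sup>2" b] std_normal_distribution_even_moments(1)[of 1]
    by (simp add: power_mult_distrib sum_nonneg fact_2)
qed

text \<open>A substitution rule for one variable, with weight \<open>w\<close>, carries over to all coordinates of a finite
product by integrating one coordinate at a time. It serves to rescale both Lebesgue and Gaussian product measures.\<close>

lemma nn_integral_PiM_substitute:
  fixes M :: "real measure"
  assumes M: "sigma_finite_measure M" and sets [measurable_cong]: "sets M = sets borel"
    and [measurable]: "\<phi> \<in> borel_measurable borel" "w \<in> borel_measurable borel"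
    and subst: "\<And>g. g \<in> borel_measurable borel \<Longrightarrow> (\<integral>\<^sup>+t. g t \<partial>M) = (\<integral>\<^sup>+t. w t * g (\<phi> t) \<partial>M)"
    and "finite I" "G \<in> borel_measurable (Pi\<^sub>M I (\<lambda>_. M))"
  shows "(\<integral>\<^sup>+x. G x \<partial>Pi\<^sub>M I (\<lambda>_. M)) = (\<integral>\<^sup>+x. (\<Prod>i\<in>I. w (x i)) * G (\<lambda>i\<in>I. \<phi> (x i)) \<partial>Pi\<^sub>M I (\<lambda>_. M))"
  using assms(6,7)
proof (induction I arbitrary: G rule: finite_induct)
  case empty
  show ?case by (simp add: PiM_empty nn_integral_count_space_finite)
next
  case (insert i I)
  interpret sigma_finite_measure M by fact
  interpret product_sigma_finite "\<lambda>_. M"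
    by (simp add: product_sigma_finite_def M)
  note [measurable] = insert.prems
  note [simp] = insert.hyps
  have [measurable]: "(\<lambda>x. \<lambda>i\<in>I. \<phi> (x i)) \<in> Pi\<^sub>M I (\<lambda>_. M) \<rightarrow>\<^sub>M Pi\<^sub>M I (\<lambda>_. M)"
    by (rule measurable_restrict) measurable
  have [measurable]: "(\<lambda>x. \<lambda>i\<in>insert i I. \<phi> (x i)) \<in> Pi\<^sub>M (insert i I) (\<lambda>_. M) \<rightarrow>\<^sub>M Pi\<^sub>M (insert i I) (\<lambda>_. M)"
    by (rule measurable_restrict) measurable
  have upd [measurable]: "(\<lambda>y. G (x(i := y))) \<in> borel_measurable M" if "x \<in> space (Pi\<^sub>M I (\<lambda>_. M))" for x
    using measurable_comp[OF measurable_component_update insert.prems, OF that] by (simp add: comp_def fun_upd_def)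
  have "(\<integral>\<^sup>+x. G x \<partial>Pi\<^sub>M (insert i I) (\<lambda>_. M)) = (\<integral>\<^sup>+x. (\<integral>\<^sup>+y. G (x(i := y)) \<partial>M) \<partial>Pi\<^sub>M I (\<lambda>_. M))"
    by (simp add: product_nn_integral_insert)
  also have "\<dots> = (\<integral>\<^sup>+x. (\<integral>\<^sup>+y. w y * G (x(i := \<phi> y)) \<partial>M) \<partial>Pi\<^sub>M I (\<lambda>_. M))"
    by (intro nn_integral_cong subst) (use upd in \<open>simp add: measurable_cong_sets[OF sets refl]\<close>)
  also have "\<dots> = (\<integral>\<^sup>+x. (\<Prod>i\<in>I. w (x i)) * (\<integral>\<^sup>+y. w y * G ((\<lambda>i\<in>I. \<phi> (x i))(i := \<phi> y)) \<partial>M) \<partial>Pi\<^sub>M I (\<lambda>_. M))"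
    by (rule insert.IH) measurable
  also have "\<dots> = (\<integral>\<^sup>+x. (\<integral>\<^sup>+y. (\<Prod>j\<in>insert i I. w ((x(i := y)) j)) * G (\<lambda>j\<in>insert i I. \<phi> ((x(i := y)) j)) \<partial>M) \<partial>Pi\<^sub>M I (\<lambda>_. M))"
  proof (rule nn_integral_cong)
    fix x assume x: "x \<in> space (Pi\<^sub>M I (\<lambda>_. M))"
    have m: "(\<lambda>i\<in>I. \<phi> (x i)) \<in> space (Pi\<^sub>M I (\<lambda>_. M))"
      using sets_eq_imp_space_eq[OF sets] by (auto simp: space_PiM)
    have [measurable]: "(\<lambda>y. G ((\<lambda>i\<in>I. \<phi> (x i))(i := \<phi> y))) \<in> borel_measurable M"
      by (rule measurable_compose[OF _ upd[OF m]]) measurable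
    have "(\<Prod>i\<in>I. w (x i)) * (\<integral>\<^sup>+y. w y * G ((\<lambda>i\<in>I. \<phi> (x i))(i := \<phi> y)) \<partial>M)
      = (\<integral>\<^sup>+y. (\<Prod>i\<in>I. w (x i)) * (w y * G ((\<lambda>i\<in>I. \<phi> (x i))(i := \<phi> y))) \<partial>M)"
      by (rule nn_integral_cmult[symmetric]) measurable
    also have "\<dots> = (\<integral>\<^sup>+y. (\<Prod>j\<in>insert i I. w ((x(i := y)) j)) * G (\<lambda>j\<in>insert i I. \<phi> ((x(i := y)) j)) \<partial>M)"
    proof (rule nn_integral_cong)
      fix y
      have "(\<Prod>j\<in>insert i I. w ((x(i := y)) j)) = w y * (\<Prod>j\<in>I. w (x j))"
        using insert.hyps by (auto intro!: prod.cong arg_cong[where f="(*) (w y)"])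
      moreover have "(\<lambda>j\<in>insert i I. \<phi> ((x(i := y)) j)) = (\<lambda>i\<in>I. \<phi> (x i))(i := \<phi> y)"
        using insert.hyps by (auto simp: fun_eq_iff)
      ultimately show "(\<Prod>i\<in>I. w (x i)) * (w y * G ((\<lambda>i\<in>I. \<phi> (x i))(i := \<phi> y))) =
         (\<Prod>j\<in>insert i I. w ((x(i := y)) j)) * G (\<lambda>j\<in>insert i I. \<phi> ((x(i := y)) j))"
        by (simp add: mult_ac)
    qed
    finally show "(\<Prod>i\<in>I. w (x i)) * (\<integral>\<^sup>+y. w y * G ((\<lambda>i\<in>I. \<phi> (x i))(i := \<phi> y)) \<partial>M) = \<dots>" .
  qed
  also have "\<dots> = (\<integral>\<^sup>+x. (\<Prod>j\<in>insert i I. w (x j)) * G (\<lambda>j\<in>insert i I. \<phi> (x j)) \<partial>Pi\<^sub>M (insert i I) (\<lambda>_. M))"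
    by (rule product_nn_integral_insert[symmetric]) (simp_all, measurable)
  finally show ?case .
qed

lemma nn_integral_std_normal_add:
  assumes [measurable]: "g \<in> borel_measurable borel"
  shows "(\<integral>\<^sup>+s. \<integral>\<^sup>+t. g (a * s + b * t) \<partial>std_normal_distribution \<partial>std_normal_distribution) =
         (\<integral>\<^sup>+r. g (sqrt (a\<^sup>2 + b\<^sup>2) * r) \<partial>std_normal_distribution)"
proof -
  have "(\<integral>\<^sup>+s. \<integral>\<^sup>+t. g (a * s + b * t) \<partial>std_normal_distribution \<partial>std_normal_distribution)
      = (\<integral>\<^sup>+z. g (a * fst z + b * snd z) \<partial>(std_normal_distribution \<Otimes>\<^sub>M std_normal_distribution))"
    using sigma_finite_measure.nn_integral_fst[OF prob_space_imp_sigma_finite[OF prob_space_std_normal],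
        of "\<lambda>z. g (a * fst z + b * snd z)" std_normal_distribution] by simp
  also have "\<dots> = (\<integral>\<^sup>+\<sigma>. g (a * \<sigma> True + b * \<sigma> False) \<partial>std_normals {True, False})"
    by (subst std_normals.product_nn_integral_pair) simp_all
  also have "\<dots> = (\<integral>\<^sup>+\<sigma>. g (\<Sum>i\<in>{True, False}. (if i then a else b) * \<sigma> i) \<partial>std_normals {True, False})"
    by simp
  also have "\<dots> = (\<integral>\<^sup>+r. g (sqrt (a\<^sup>2 + b\<^sup>2) * r) \<partial>std_normal_distribution)"
    by (subst nn_integral_linear_form) simp_all
  finally show ?thesis .
qed

text \<open>The semigroup property of the Gaussian measure, which is what allows the heat flow to be split into steps.
Peel off one coordinate \<open>i\<close>: after exchanging the order of integration the two \<open>i\<close>-th coordinates can be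
merged by the one-dimensional statement.\<close>

lemma nn_integral_std_normals_add:
  assumes "finite I" "G \<in> borel_measurable (std_normals I)"
  shows "(\<integral>\<^sup>+x. \<integral>\<^sup>+y. G (\<lambda>i\<in>I. a * x i + b * y i) \<partial>std_normals I \<partial>std_normals I) =
         (\<integral>\<^sup>+x. G (\<lambda>i\<in>I. sqrt (a\<^sup>2 + b\<^sup>2) * x i) \<partial>std_normals I)"
  using assms
proof (induction I arbitrary: G rule: finite_induct)
  case empty
  then show ?case by (auto intro!: nn_integral_cong simp: space_PiM nn_integral_const)
next
  case (insert i I)
  let ?N = "std_normal_distribution"
  let ?c = "sqrt (a\<^sup>2 + b\<^sup>2)"
  interpret N: prob_space ?N by simp
  interpret NI: prob_space "std_normals I" by simp
  interpret NiI: prob_space "std_normals (insert i I)" by simp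
  interpret P: pair_sigma_finite "std_normals I" ?N ..
  note [measurable] = insert.prems
  note [simp] = insert.hyps
  have r1 [measurable]: "(\<lambda>(x, y). \<lambda>j\<in>insert i I. a * x j + b * y j) \<in>
      std_normals (insert i I) \<Otimes>\<^sub>M std_normals (insert i I) \<rightarrow>\<^sub>M std_normals (insert i I)"
    unfolding case_prod_beta by (rule measurable_restrict) measurable
  have r2 [measurable]: "(\<lambda>x. \<lambda>j\<in>insert i I. ?c * x j) \<in> std_normals (insert i I) \<rightarrow>\<^sub>M std_normals (insert i I)"
    by (rule measurable_restrict) measurable
  have r3 [measurable]: "(\<lambda>(x, y). \<lambda>j\<in>I. a * x j + b * y j) \<in>
      std_normals I \<Otimes>\<^sub>M std_normals I \<rightarrow>\<^sub>M std_normals I"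
    unfolding case_prod_beta by (rule measurable_restrict) measurable
  have r4: "(\<lambda>y. \<lambda>j\<in>I. a * x j + b * y j) \<in> std_normals I \<rightarrow>\<^sub>M std_normals I" for x
    by (rule measurable_restrict) measurable
  have upd: "(\<lambda>y. G (x(i := y))) \<in> borel_measurable borel" if "x \<in> space (std_normals I)" for x
    using measurable_comp[OF measurable_component_update insert.prems, OF that] by (simp add: comp_def fun_upd_def)
  have "(\<integral>\<^sup>+x. \<integral>\<^sup>+y. G (\<lambda>j\<in>insert i I. a * x j + b * y j) \<partial>std_normals (insert i I) \<partial>std_normals (insert i I))
     = (\<integral>\<^sup>+x. \<integral>\<^sup>+s. (\<integral>\<^sup>+y. G (\<lambda>j\<in>insert i I. a * (x(i := s)) j + b * y j) \<partial>std_normals (insert i I)) \<partial>?N \<partial>std_normals I)"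
    by (rule std_normals.product_nn_integral_insert) (simp_all, measurable)
  also have "\<dots> = (\<integral>\<^sup>+x. \<integral>\<^sup>+s. (\<integral>\<^sup>+y. \<integral>\<^sup>+t. G (\<lambda>j\<in>insert i I. a * (x(i := s)) j + b * (y(i := t)) j) \<partial>?N \<partial>std_normals I) \<partial>?N \<partial>std_normals I)"
  proof (intro nn_integral_cong std_normals.product_nn_integral_insert)
    fix x s assume "x \<in> space (std_normals I)"
    have "(\<lambda>y. \<lambda>j\<in>insert i I. a * (x(i := s)) j + b * y j) \<in> std_normals (insert i I) \<rightarrow>\<^sub>M std_normals (insert i I)"
      by (rule measurable_restrict) measurable
    from measurable_compose[OF this insert.prems]
    show "(\<lambda>y. G (\<lambda>j\<in>insert i I. a * (x(i := s)) j + b * y j)) \<in> borel_measurable (std_normals (insert i I))" .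
  qed simp_all
  also have "\<dots> = (\<integral>\<^sup>+x. \<integral>\<^sup>+s. (\<integral>\<^sup>+y. \<integral>\<^sup>+t. G ((\<lambda>j\<in>I. a * x j + b * y j)(i := a * s + b * t)) \<partial>?N \<partial>std_normals I) \<partial>?N \<partial>std_normals I)"
    by (intro nn_integral_cong arg_cong[where f=G]) (auto simp: fun_eq_iff)
  also have "\<dots> = (\<integral>\<^sup>+x. \<integral>\<^sup>+y. (\<integral>\<^sup>+s. \<integral>\<^sup>+t. G ((\<lambda>j\<in>I. a * x j + b * y j)(i := a * s + b * t)) \<partial>?N \<partial>?N) \<partial>std_normals I \<partial>std_normals I)"
  proof (rule nn_integral_cong)
    fix x assume "x \<in> space (std_normals I)"
    note [measurable] = r4[of x]
    show "(\<integral>\<^sup>+s. (\<integral>\<^sup>+y. \<integral>\<^sup>+t. G ((\<lambda>j\<in>I. a * x j + b * y j)(i := a * s + b * t)) \<partial>?N \<partial>std_normals I) \<partial>?N) = 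
      (\<integral>\<^sup>+y. (\<integral>\<^sup>+s. \<integral>\<^sup>+t. G ((\<lambda>j\<in>I. a * x j + b * y j)(i := a * s + b * t)) \<partial>?N \<partial>?N) \<partial>std_normals I)"
      by (rule P.Fubini') measurable
  qed
  also have "\<dots> = (\<integral>\<^sup>+x. \<integral>\<^sup>+y. (\<integral>\<^sup>+r. G ((\<lambda>j\<in>I. a * x j + b * y j)(i := ?c * r)) \<partial>?N) \<partial>std_normals I \<partial>std_normals I)"
    by (intro nn_integral_cong nn_integral_std_normal_add upd) (auto simp: space_PiM)
  also have "\<dots> = (\<integral>\<^sup>+x. (\<integral>\<^sup>+r. G ((\<lambda>j\<in>I. ?c * x j)(i := ?c * r)) \<partial>?N) \<partial>std_normals I)"
    by (rule insert.IH) measurable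
  also have "\<dots> = (\<integral>\<^sup>+x. (\<integral>\<^sup>+r. G (\<lambda>j\<in>insert i I. ?c * (x(i := r)) j) \<partial>?N) \<partial>std_normals I)"
    by (intro nn_integral_cong arg_cong[where f=G]) (auto simp: fun_eq_iff)
  also have "\<dots> = (\<integral>\<^sup>+x. G (\<lambda>j\<in>insert i I. ?c * x j) \<partial>std_normals (insert i I))"
    by (rule std_normals.product_nn_integral_insert[symmetric]) (simp_all, measurable)
  finally show ?case .
qed

lemma integral_std_normals_add:
  fixes G :: "_ \<Rightarrow> real"
  assumes I: "finite I" and [measurable]: "G \<in> borel_measurable (std_normals I)"
    and G: "\<And>x. 0 \<le> G x" "\<And>x. G x \<le> C"
  shows "(\<integral>x. \<integral>y. G (\<lambda>i\<in>I. a * x i + b * y i) \<partial>std_normals I \<partial>std_normals I) =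
         (\<integral>x. G (\<lambda>i\<in>I. sqrt (a\<^sup>2 + b\<^sup>2) * x i) \<partial>std_normals I)"
proof -
  interpret prob_space "std_normals I" by simp
  have r3 [measurable]: "(\<lambda>(x, y). \<lambda>j\<in>I. a * x j + b * y j) \<in>
      std_normals I \<Otimes>\<^sub>M std_normals I \<rightarrow>\<^sub>M std_normals I"
    unfolding case_prod_beta by (rule measurable_restrict) measurable
  have r4 [measurable]: "(\<lambda>y. \<lambda>j\<in>I. a * x j + b * y j) \<in> std_normals I \<rightarrow>\<^sub>M std_normals I" for x
    by (rule measurable_restrict) measurable
  have r5 [measurable]: "(\<lambda>x. \<lambda>j\<in>I. c * x j) \<in> std_normals I \<rightarrow>\<^sub>M std_normals I" for c
    by (rule measurable_restrict) measurable
  have int: "integrable (std_normals I) (\<lambda>y. G (\<lambda>i\<in>I. a * x i + b * y i))" for x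
    by (rule integrable_const_bound[where B = C]) (auto simp: G)
  have int2: "integrable (std_normals I) (\<lambda>y. G (\<lambda>i\<in>I. c * y i))" for c
    by (rule integrable_const_bound[where B = C]) (auto simp: G)
  have le: "(\<integral>y. G (\<lambda>i\<in>I. a * x i + b * y i) \<partial>std_normals I) \<le> C" for x
    using integral_mono[OF int integrable_const[of C]] G(2) prob_space by simp
  have int3: "integrable (std_normals I) (\<lambda>x. \<integral>y. G (\<lambda>i\<in>I. a * x i + b * y i) \<partial>std_normals I)"
    by (rule integrable_const_bound[where B = C]) (auto simp: G le)
  have "ennreal (\<integral>x. \<integral>y. G (\<lambda>i\<in>I. a * x i + b * y i) \<partial>std_normals I \<partial>std_normals I) =
        (\<integral>\<^sup>+x. \<integral>\<^sup>+y. ennreal (G (\<lambda>i\<in>I. a * x i + b * y i)) \<partial>std_normals I \<partial>std_normals I)"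
    by (simp add: nn_integral_eq_integral int int3 G)
  also have "\<dots> = (\<integral>\<^sup>+x. ennreal (G (\<lambda>i\<in>I. sqrt (a\<^sup>2 + b\<^sup>2) * x i)) \<partial>std_normals I)"
    by (rule nn_integral_std_normals_add[OF I]) measurable
  also have "\<dots> = ennreal (\<integral>x. G (\<lambda>i\<in>I. sqrt (a\<^sup>2 + b\<^sup>2) * x i) \<partial>std_normals I)"
    by (simp add: nn_integral_eq_integral int2 G)
  finally show ?thesis
    by (simp add: G)
qed

section \<open>The Gaussian Brascamp-Lieb inequality\<close>

text \<open>The derivative of the difference of the two sides is \<open>t\<^sup>3 / (1 + t)\<close>, which has the sign of \<open>t\<close>.\<close>

lemma ln_one_plus_le_cubic:
  fixes x :: real
  assumes "-1 < x"
  shows "ln (1 + x) \<le> x - x\<^sup>2 / 2 + x ^ 3 / 3"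
proof -
  define h where "h x = x - x\<^sup>2 / 2 + x ^ 3 / 3 - ln (1 + x)" for x :: real
  have der: "(h has_real_derivative t ^ 3 / (1 + t)) (at t)" if "-1 < t" for t
    unfolding h_def using that
    by (auto intro!: derivative_eq_intros simp: field_simps power2_eq_square power3_eq_cube)
  have "h 0 \<le> h x"
  proof (cases "0 \<le> x")
    case True
    then show ?thesis
      by (rule DERIV_nonneg_imp_nondecreasing) (use der in force)
  next
    case False
    show ?thesis
    proof (rule DERIV_nonpos_imp_nonincreasing[of x 0])
      fix t assume t: "x \<le> t" "t \<le> 0"
      then have "t ^ 3 / (1 + t) \<le> 0"
        using assms by (auto intro!: divide_nonpos_pos simp: power3_eq_cube mult_nonpos_nonneg mult_nonneg_nonpos)
      then show "\<exists>y. (h has_real_derivative y) (at t) \<and> y \<le> 0"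
        using der[of t] t assms by auto
    qed (use False in auto)
  qed
  then show ?thesis by (simp add: h_def)
qed

lemma exp_le_quadratic:
  fixes w :: real
  shows "exp w \<le> 1 + w + w\<^sup>2 / 2 + exp \<bar>w\<bar> * \<bar>w\<bar> ^ 3"
proof -
  obtain t where t: "\<bar>t\<bar> \<le> \<bar>w\<bar>" "exp w = (\<Sum>m<3. w ^ m / fact m) + exp t / fact 3 * w ^ 3"
    using Maclaurin_exp_le[of w 3] by blast
  have "exp t / fact 3 * w ^ 3 \<le> exp t / fact 3 * \<bar>w\<bar> ^ 3"
    by (intro mult_left_mono) (auto simp: power_abs[symmetric])
  also have "\<dots> \<le> exp \<bar>w\<bar> * \<bar>w\<bar> ^ 3"
  proof (rule mult_right_mono)
    have "exp t \<le> exp \<bar>w\<bar>" using t(1) by auto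
    moreover have "exp t / fact 3 \<le> exp t" by (simp add: fact_numeral)
    ultimately show "exp t / fact 3 \<le> exp \<bar>w\<bar>" by (rule order_trans[rotated])
  qed simp
  finally show ?thesis
    unfolding t(2) by (simp add: numeral_3_eq_3 power2_eq_square)
qed

lemma sum_power_le_power_sum:
  fixes x :: "'j \<Rightarrow> real"
  assumes "finite J" "\<And>j. j \<in> J \<Longrightarrow> 0 \<le> x j"
  shows "(\<Sum>j\<in>J. x j ^ Suc n) \<le> (\<Sum>j\<in>J. x j) ^ Suc n"
proof -
  have "x j \<le> (\<Sum>j\<in>J. x j)" if "j \<in> J" for j
    using assms that by (intro member_le_sum) auto
  then have "(\<Sum>j\<in>J. x j * x j ^ n) \<le> (\<Sum>j\<in>J. x j * (\<Sum>j\<in>J. x j) ^ n)"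
    using assms by (intro sum_mono mult_left_mono power_mono) auto
  then show ?thesis by (simp add: sum_distrib_right)
qed

lemma power_sum_le_sum_power:
  fixes x :: "'j \<Rightarrow> real"
  assumes "finite J" "\<And>j. j \<in> J \<Longrightarrow> 0 \<le> x j"
  shows "(\<Sum>j\<in>J. x j) ^ Suc n \<le> real (card J) ^ Suc n * (\<Sum>j\<in>J. x j ^ Suc n)"
proof (cases "J = {}")
  case False
  define m where "m = Max (x ` J)"
  have "m \<in> x ` J" unfolding m_def using assms False by (intro Max_in) auto
  then obtain j where j: "j \<in> J" "m = x j" by auto
  have "(\<Sum>j\<in>J. x j) \<le> real (card J) * m"
    using assms by (intro sum_bounded_above) (auto simp: m_def)
  then have "(\<Sum>j\<in>J. x j) ^ Suc n \<le> (real (card J) * m) ^ Suc n"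
    using assms by (intro power_mono sum_nonneg) auto
  also have "\<dots> = real (card J) ^ Suc n * x j ^ Suc n"
    by (simp only: power_mult_distrib j)
  also have "\<dots> \<le> real (card J) ^ Suc n * (\<Sum>j\<in>J. x j ^ Suc n)"
    using assms j by (intro mult_left_mono member_le_sum) auto
  finally show ?thesis .
qed auto

text \<open>Expand the logarithm, then the exponential. The logarithm is only estimated from above, so the constant depends on
the \<open>\<rho>\<^sub>j\<close> through \<open>S\<close> alone, however close they come to \<open>- 1\<close>.\<close>

lemma prod_powr_le_second_order:
  fixes c :: "'j \<Rightarrow> real"
  assumes J: "finite J" and c: "\<And>j. j \<in> J \<Longrightarrow> 0 \<le> c j \<and> c j \<le> 1" and S: "0 \<le> S"
  obtains C where "0 \<le> C" 
    "\<And>\<rho>. (\<And>j. j \<in> J \<Longrightarrow> -1 < \<rho> j) \<Longrightarrow> (\<Sum>j\<in>J. \<bar>\<rho> j\<bar>) \<le> S \<Longrightarrow>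
      (\<Prod>j\<in>J. (1 + \<rho> j) powr c j) \<le> 1 + (\<Sum>j\<in>J. c j * \<rho> j) + 
         ((\<Sum>j\<in>J. c j * \<rho> j)\<^sup>2 - (\<Sum>j\<in>J. c j * (\<rho> j)\<^sup>2)) / 2 + C * (\<Sum>j\<in>J. \<bar>\<rho> j\<bar>) ^ 3"
proof
  define L where "L = 1 + S + S\<^sup>2"
  have L: "1 \<le> L" "0 \<le> L" using S by (auto simp: L_def)
  show "0 \<le> 1 + L\<^sup>2 + exp (S * L) * L ^ 3" using L by simp
  fix \<rho> :: "'j \<Rightarrow> real"
  assume \<rho>: "\<And>j. j \<in> J \<Longrightarrow> -1 < \<rho> j" and le: "(\<Sum>j\<in>J. \<bar>\<rho> j\<bar>) \<le> S"
  define \<sigma> where "\<sigma> = (\<Sum>j\<in>J. \<bar>\<rho> j\<bar>)"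
  define A where "A = (\<Sum>j\<in>J. c j * \<rho> j)"
  define B where "B = (\<Sum>j\<in>J. c j * (\<rho> j)\<^sup>2) / 2"
  define D where "D = (\<Sum>j\<in>J. c j * (\<rho> j) ^ 3) / 3"
  define w where "w = A - B + D"
  have \<sigma>: "0 \<le> \<sigma>" "\<sigma> \<le> S" using le by (auto simp: \<sigma>_def sum_nonneg)
  have "\<bar>A\<bar> \<le> (\<Sum>j\<in>J. \<bar>c j * \<rho> j\<bar>)" unfolding A_def by (rule sum_abs)
  also have "\<dots> \<le> \<sigma>" unfolding \<sigma>_def
    using c by (intro sum_mono) (auto simp: abs_mult intro: mult_left_le_one_le)
  finally have A: "\<bar>A\<bar> \<le> \<sigma>" .
  have "(\<Sum>j\<in>J. c j * (\<rho> j)\<^sup>2) \<le> (\<Sum>j\<in>J. \<bar>\<rho> j\<bar> ^ Suc 1)"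
    using c by (intro sum_mono) (auto simp flip: numeral_2_eq_2 intro: mult_left_le_one_le)
  also have "\<dots> \<le> \<sigma> ^ Suc 1"
    unfolding \<sigma>_def by (rule sum_power_le_power_sum) (auto simp: J)
  finally have "(\<Sum>j\<in>J. c j * (\<rho> j)\<^sup>2) \<le> \<sigma>\<^sup>2" by (simp add: numeral_2_eq_2)
  moreover have "0 \<le> (\<Sum>j\<in>J. c j * (\<rho> j)\<^sup>2)" using c by (intro sum_nonneg) auto
  ultimately have B: "0 \<le> B" "B \<le> \<sigma>\<^sup>2" by (auto simp: B_def)
  have "\<bar>3 * D\<bar> \<le> (\<Sum>j\<in>J. \<bar>c j * (\<rho> j) ^ 3\<bar>)" unfolding D_def by simp
  also have "\<dots> \<le> (\<Sum>j\<in>J. \<bar>\<rho> j\<bar> ^ Suc 2)"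
    using c by (intro sum_mono) (auto simp: abs_mult power_abs numeral_3_eq_3 intro: mult_left_le_one_le)
  also have "\<dots> \<le> \<sigma> ^ Suc 2"
    unfolding \<sigma>_def by (rule sum_power_le_power_sum) (auto simp: J)
  finally have D: "\<bar>D\<bar> \<le> \<sigma> ^ 3" using \<sigma> by (simp add: numeral_3_eq_3)
  have S2: "\<sigma>\<^sup>2 \<le> S * \<sigma>" "\<sigma> ^ 3 \<le> S\<^sup>2 * \<sigma>" "\<sigma> ^ 3 \<le> S * \<sigma>\<^sup>2"
  proof -
    show "\<sigma>\<^sup>2 \<le> S * \<sigma>"
      unfolding power2_eq_square by (rule mult_right_mono[OF \<sigma>(2,1)])
    have "\<sigma>\<^sup>2 * \<sigma> \<le> S\<^sup>2 * \<sigma>"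
      by (rule mult_right_mono[OF power_mono[OF \<sigma>(2,1)] \<sigma>(1)])
    then show "\<sigma> ^ 3 \<le> S\<^sup>2 * \<sigma>" by (simp add: power2_eq_square power3_eq_cube)
    have "\<sigma> * \<sigma>\<^sup>2 \<le> S * \<sigma>\<^sup>2"
      by (rule mult_right_mono[OF \<sigma>(2)]) simp
    then show "\<sigma> ^ 3 \<le> S * \<sigma>\<^sup>2" by (simp add: power2_eq_square power3_eq_cube)
  qed
  have w1: "\<bar>w\<bar> \<le> L * \<sigma>"
    using A B D S2 by (auto simp: w_def L_def algebra_simps abs_le_iff)
  have w2: "\<bar>w - A\<bar> \<le> L * \<sigma>\<^sup>2"
  proof -
    have "\<bar>w - A\<bar> \<le> \<sigma>\<^sup>2 + S * \<sigma>\<^sup>2" using B D S2 by (auto simp: w_def abs_le_iff)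
    also have "\<dots> \<le> L * \<sigma>\<^sup>2" by (auto simp: L_def algebra_simps)
    finally show ?thesis .
  qed
  have w3: "\<bar>w + A\<bar> \<le> 2 * L * \<sigma>"
  proof -
    have "\<sigma> \<le> L * \<sigma>" using \<sigma> L mult_right_mono[of 1 L \<sigma>] by simp
    then show ?thesis using w1 A by (auto simp: abs_le_iff)
  qed
  have "w\<^sup>2 - A\<^sup>2 = (w - A) * (w + A)" by (simp add: power2_eq_square algebra_simps)
  also have "\<dots> \<le> \<bar>w - A\<bar> * \<bar>w + A\<bar>" by (simp flip: abs_mult)
  also have "\<dots> \<le> (L * \<sigma>\<^sup>2) * (2 * L * \<sigma>)"
    using w2 w3 L \<sigma> by (intro mult_mono) auto
  finally have sq: "w\<^sup>2 / 2 \<le> A\<^sup>2 / 2 + L\<^sup>2 * \<sigma> ^ 3"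
    by (simp add: power2_eq_square power3_eq_cube algebra_simps)
  have "exp \<bar>w\<bar> * \<bar>w\<bar> ^ 3 \<le> exp (S * L) * (L * \<sigma>) ^ 3"
  proof (intro mult_mono power_mono)
    have "L * \<sigma> \<le> L * S" using \<sigma> L by (intro mult_left_mono) auto
    then show "exp \<bar>w\<bar> \<le> exp (S * L)" using w1 by (simp add: mult.commute)
  qed (use w1 in auto)
  then have cube: "exp \<bar>w\<bar> * \<bar>w\<bar> ^ 3 \<le> exp (S * L) * L ^ 3 * \<sigma> ^ 3"
    by (simp add: power_mult_distrib mult.assoc)
  have "(\<Prod>j\<in>J. (1 + \<rho> j) powr c j) = exp (\<Sum>j\<in>J. c j * ln (1 + \<rho> j))"
  proof -
    have "(\<Prod>j\<in>J. (1 + \<rho> j) powr c j) = (\<Prod>j\<in>J. exp (c j * ln (1 + \<rho> j)))"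
    proof (rule prod.cong[OF refl])
      fix j assume "j \<in> J"
      then show "(1 + \<rho> j) powr c j = exp (c j * ln (1 + \<rho> j))"
        using \<rho>[of j] by (simp add: powr_def)
    qed
    then show ?thesis using J by (simp add: exp_sum)
  qed
  also have "\<dots> \<le> exp w"
  proof -
    have "(\<Sum>j\<in>J. c j * ln (1 + \<rho> j)) \<le> (\<Sum>j\<in>J. c j * (\<rho> j - (\<rho> j)\<^sup>2 / 2 + \<rho> j ^ 3 / 3))"
      using c \<rho> by (intro sum_mono mult_left_mono ln_one_plus_le_cubic) auto
    also have "\<dots> = w"
      by (simp add: w_def A_def B_def D_def algebra_simps sum.distrib sum_subtractf sum_divide_distrib)
    finally show ?thesis by simp
  qed
  also have "\<dots> \<le> 1 + w + w\<^sup>2 / 2 + exp \<bar>w\<bar> * \<bar>w\<bar> ^ 3" by (rule exp_le_quadratic)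
  also have "\<dots> \<le> 1 + (A - B + \<sigma> ^ 3) + (A\<^sup>2 / 2 + L\<^sup>2 * \<sigma> ^ 3) + exp (S * L) * L ^ 3 * \<sigma> ^ 3"
    using sq cube D by (simp add: w_def)
  also have "\<dots> = 1 + A + (A\<^sup>2 - (\<Sum>j\<in>J. c j * (\<rho> j)\<^sup>2)) / 2 + (1 + L\<^sup>2 + exp (S * L) * L ^ 3) * \<sigma> ^ 3"
    by (simp add: B_def algebra_simps diff_divide_distrib)
  finally show "(\<Prod>j\<in>J. (1 + \<rho> j) powr c j) \<le> 1 + (\<Sum>j\<in>J. c j * \<rho> j) + 
         ((\<Sum>j\<in>J. c j * \<rho> j)\<^sup>2 - (\<Sum>j\<in>J. c j * (\<rho> j)\<^sup>2)) / 2 + 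
         (1 + L\<^sup>2 + exp (S * L) * L ^ 3) * (\<Sum>j\<in>J. \<bar>\<rho> j\<bar>) ^ 3"
    by (simp add: A_def \<sigma>_def)
qed

text \<open>A quantitative form of twice differentiability that survives averaging: a single constant bounds the function, its
derivative \<open>f'\<close>, and the coefficient of the quadratic remainder.\<close>

definition quadratic_taylor :: "real \<Rightarrow> real \<Rightarrow> (real \<Rightarrow> real) \<Rightarrow> bool" where
  "quadratic_taylor \<delta> M f \<longleftrightarrow> f \<in> borel_measurable borel \<and> (\<forall>x. \<delta> \<le> f x \<and> f x \<le> M) \<and>
     (\<exists>f'\<in>borel_measurable borel. \<forall>x h. \<bar>f' x\<bar> \<le> M \<and> \<bar>f (x + h) - f x - h * f' x\<bar> \<le> M * h\<^sup>2)"

lemma quadratic_taylor_measurable: "quadratic_taylor \<delta> M f \<Longrightarrow> f \<in> borel_measurable borel"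
  by (simp add: quadratic_taylor_def)

lemma quadratic_taylor_bounds: "quadratic_taylor \<delta> M f \<Longrightarrow> \<delta> \<le> f x" "quadratic_taylor \<delta> M f \<Longrightarrow> f x \<le> M"
  by (auto simp: quadratic_taylor_def)

lemma quadratic_taylor_average:
  assumes f: "quadratic_taylor \<delta> M f" and N: "prob_space N" and [measurable]: "X \<in> borel_measurable N"
  shows "quadratic_taylor \<delta> M (\<lambda>t. \<integral>\<omega>. f (t + X \<omega>) \<partial>N)"
proof -
  interpret prob_space N by fact
  obtain f' where [measurable]: "f' \<in> borel_measurable borel"
    and f': "\<And>x. \<bar>f' x\<bar> \<le> M" "\<And>x h. \<bar>f (x + h) - f x - h * f' x\<bar> \<le> M * h\<^sup>2"
    using f by (auto simp: quadratic_taylor_def)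
  note [measurable] = quadratic_taylor_measurable[OF f]
  have bd: "\<bar>f x\<bar> \<le> max \<bar>\<delta>\<bar> \<bar>M\<bar>" for x
    using quadratic_taylor_bounds[OF f, of x] by auto
  have int: "integrable N (\<lambda>\<omega>. f (t + X \<omega>))" for t
    by (rule integrable_const_bound[where B = "max \<bar>\<delta>\<bar> \<bar>M\<bar>"]) (use bd in auto)
  have int': "integrable N (\<lambda>\<omega>. f' (t + X \<omega>))" for t
    by (rule integrable_const_bound[where B = M]) (use f' in auto)
  have "\<bar>(\<integral>\<omega>. f (t + h + X \<omega>) \<partial>N) - (\<integral>\<omega>. f (t + X \<omega>) \<partial>N) - h * (\<integral>\<omega>. f' (t + X \<omega>) \<partial>N)\<bar> \<le> M * h\<^sup>2" for t h
  proof -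
    have "(\<integral>\<omega>. f (t + h + X \<omega>) \<partial>N) - (\<integral>\<omega>. f (t + X \<omega>) \<partial>N) - h * (\<integral>\<omega>. f' (t + X \<omega>) \<partial>N)
      = (\<integral>\<omega>. f (t + h + X \<omega>) - f (t + X \<omega>) - h * f' (t + X \<omega>) \<partial>N)"
      using int int' by simp
    also have "\<bar>\<dots>\<bar> \<le> (\<integral>\<omega>. \<bar>f (t + h + X \<omega>) - f (t + X \<omega>) - h * f' (t + X \<omega>)\<bar> \<partial>N)"
      by (rule integral_abs_bound)
    also have "\<dots> \<le> (\<integral>\<omega>. M * h\<^sup>2 \<partial>N)"
    proof (intro integral_mono integrable_abs Bochner_Integration.integrable_diff integrable_mult_right int int')
      show "\<bar>f (t + h + X \<omega>) - f (t + X \<omega>) - h * f' (t + X \<omega>)\<bar> \<le> M * h\<^sup>2" for \<omega>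
        using f'(2)[of "t + X \<omega>" h] by (simp add: ac_simps)
    qed simp
    finally show ?thesis by (simp add: prob_space)
  qed
  moreover have "\<bar>\<integral>\<omega>. f' (t + X \<omega>) \<partial>N\<bar> \<le> M" for t
    using order_trans[OF integral_abs_bound integral_mono[OF integrable_abs[OF int'] integrable_const f'(1)]] 
    by (simp add: prob_space)
  moreover have "\<delta> \<le> (\<integral>\<omega>. f (t + X \<omega>) \<partial>N)" "(\<integral>\<omega>. f (t + X \<omega>) \<partial>N) \<le> M" for t
    using integral_mono[OF integrable_const[of \<delta>] int[of t]] integral_mono[OF int[of t] integrable_const[of M]]
      quadratic_taylor_bounds[OF f] by (auto simp: prob_space)
  ultimately show ?thesis unfolding quadratic_taylor_def
    by (auto intro!: bexI[where x = "\<lambda>t. \<integral>\<omega>. f' (t + X \<omega>) \<partial>N"])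
qed

lemma powr_second_order_bound:
  fixes q \<delta> M :: real
  assumes "0 < \<delta>"
  obtains C where "0 \<le> C" "\<And>y. y \<in> {\<delta>..M} \<Longrightarrow> \<bar>q * y powr (q - 1)\<bar> \<le> C"
    "\<And>y z. y \<in> {\<delta>..M} \<Longrightarrow> z \<in> {\<delta>..M} \<Longrightarrow> \<bar>z powr q - y powr q - (z - y) * (q * y powr (q - 1))\<bar> \<le> C * (z - y)\<^sup>2"
proof -
  have "compact ((\<lambda>y. q * y powr (q - 1)) ` {\<delta>..M})" "compact ((\<lambda>y. q * (q - 1) * y powr (q - 2)) ` {\<delta>..M})"
    using assms by (auto intro!: compact_continuous_image continuous_intros)
  then have "bounded ((\<lambda>y. q * y powr (q - 1)) ` {\<delta>..M})" "bounded ((\<lambda>y. q * (q - 1) * y powr (q - 2)) ` {\<delta>..M})"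
    by (auto intro: compact_imp_bounded)
  then obtain C1 C2 where C1: "\<And>y. y \<in> {\<delta>..M} \<Longrightarrow> \<bar>q * y powr (q - 1)\<bar> \<le> C1"
    and C2: "\<And>y. y \<in> {\<delta>..M} \<Longrightarrow> \<bar>q * (q - 1) * y powr (q - 2)\<bar> \<le> C2"
    unfolding bounded_iff by (metis image_eqI real_norm_def)
  define C where "C = \<bar>C1\<bar> + \<bar>C2\<bar>"
  show ?thesis
  proof
    show "0 \<le> C" by (simp add: C_def)
    show "\<bar>q * y powr (q - 1)\<bar> \<le> C" if "y \<in> {\<delta>..M}" for y using C1[OF that] by (simp add: C_def)
    show "\<bar>z powr q - y powr q - (z - y) * (q * y powr (q - 1))\<bar> \<le> C * (z - y)\<^sup>2"
      if y: "y \<in> {\<delta>..M}" and z: "z \<in> {\<delta>..M}" for y z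
    proof (cases "z = y")
      case False
      define diff where "diff = (\<lambda>n::nat. if n = 0 then (\<lambda>t. t powr q) else if n = 1 then (\<lambda>t. q * t powr (q - 1))
         else (\<lambda>t. q * (q - 1) * t powr (q - 2)))"
      have "\<exists>t. (if z < y then z < t \<and> t < y else y < t \<and> t < z) \<and>
         z powr q = (\<Sum>m<2. diff m y / fact m * (z - y) ^ m) + diff 2 t / fact 2 * (z - y)\<^sup>2"
      proof (rule Taylor[where a = \<delta> and b = M and diff = diff])
        show "\<forall>m t. m < 2 \<and> \<delta> \<le> t \<and> t \<le> M \<longrightarrow> DERIV (diff m) t :> diff (Suc m) t"
        proof (intro allI impI, elim conjE)
          fix m :: nat and t :: real assume "m < 2" "\<delta> \<le> t" "t \<le> M"
          moreover have "DERIV (\<lambda>t. t powr q) t :> q * t powr (q - 1)" 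
            "DERIV (\<lambda>t. q * t powr (q - 1)) t :> q * (q - 1) * t powr (q - 2)"
            using assms \<open>\<delta> \<le> t\<close> by (auto intro!: derivative_eq_intros)
          ultimately show "DERIV (diff m) t :> diff (Suc m) t"
            by (cases m) (auto simp: diff_def)
        qed
      qed (use y z False in \<open>auto simp: diff_def\<close>)
      then obtain t where t: "if z < y then z < t \<and> t < y else y < t \<and> t < z"
        "z powr q = (\<Sum>m<2. diff m y / fact m * (z - y) ^ m) + diff 2 t / fact 2 * (z - y)\<^sup>2"
        by blast
      have "z powr q - y powr q - (z - y) * (q * y powr (q - 1)) = q * (q - 1) * t powr (q - 2) / 2 * (z - y)\<^sup>2"
        unfolding t(2) by (simp add: diff_def numeral_2_eq_2)
      also have "\<bar>\<dots>\<bar> = \<bar>q * (q - 1) * t powr (q - 2)\<bar> / 2 * (z - y)\<^sup>2"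
        by (simp add: abs_mult)
      also have "\<dots> \<le> C * (z - y)\<^sup>2"
      proof (rule mult_right_mono)
        have "t \<in> {\<delta>..M}" using t(1) y z by (auto split: if_splits)
        then show "\<bar>q * (q - 1) * t powr (q - 2)\<bar> / 2 \<le> C"
          using C2[of t] by (simp add: C_def)
      qed simp
      finally show ?thesis .
    qed simp
  qed
qed

lemma quadratic_taylor_powr:
  assumes f: "quadratic_taylor \<delta> M f" and "0 < \<delta>"
  obtains \<delta>' M' where "0 < \<delta>'" "quadratic_taylor \<delta>' M' (\<lambda>x. f x powr q)"
proof -
  obtain C where C: "0 \<le> C" "\<And>y. y \<in> {\<delta>..M} \<Longrightarrow> \<bar>q * y powr (q - 1)\<bar> \<le> C"
    "\<And>y z. y \<in> {\<delta>..M} \<Longrightarrow> z \<in> {\<delta>..M} \<Longrightarrow> \<bar>z powr q - y powr q - (z - y) * (q * y powr (q - 1))\<bar> \<le> C * (z - y)\<^sup>2"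
    using powr_second_order_bound[OF \<open>0 < \<delta>\<close>, where M=M] by metis
  obtain f' where [measurable]: "f' \<in> borel_measurable borel"
    and f': "\<And>x. \<bar>f' x\<bar> \<le> M" "\<And>x h. \<bar>f (x + h) - f x - h * f' x\<bar> \<le> M * h\<^sup>2"
    using f by (auto simp: quadratic_taylor_def)
  note [measurable] = quadratic_taylor_measurable[OF f]
  have in_range: "f x \<in> {\<delta>..M}" for x using quadratic_taylor_bounds[OF f] by auto
  have M: "0 < M" using in_range[of 0] \<open>0 < \<delta>\<close> by auto
  have lip: "\<bar>f (x + h) - f x\<bar> \<le> 2 * M * \<bar>h\<bar>" for x h
  proof (cases "\<bar>h\<bar> \<le> 1")
    case True
    have "\<bar>f (x + h) - f x\<bar> \<le> \<bar>h * f' x\<bar> + M * h\<^sup>2" using f'(2)[of x h] by linarith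
    also have "\<dots> \<le> \<bar>h\<bar> * M + M * (\<bar>h\<bar> * 1)"
    proof (intro add_mono)
      show "\<bar>h * f' x\<bar> \<le> \<bar>h\<bar> * M" using f'(1) by (simp add: abs_mult mult_left_mono)
      have "h\<^sup>2 = \<bar>h\<bar> * \<bar>h\<bar>" by (simp add: power2_eq_square)
      also have "\<dots> \<le> \<bar>h\<bar> * 1" using True by (intro mult_left_mono) auto
      finally show "M * h\<^sup>2 \<le> M * (\<bar>h\<bar> * 1)" using M by simp
    qed
    finally show ?thesis by simp
  next
    case False
    have "\<bar>f (x + h) - f x\<bar> \<le> M * 1" using in_range[of x] in_range[of "x+h"] \<open>0 < \<delta>\<close> by auto
    also have "\<dots> \<le> M * (2 * \<bar>h\<bar>)" using False M by (intro mult_left_mono) auto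
    finally show ?thesis by simp
  qed
  define m where "m = min (\<delta> powr q) (M powr q)"
  define M' where "M' = max (\<delta> powr q) (M powr q) + C * M + (C * (2 * M)\<^sup>2 + C * M)"
  have "m \<le> f x powr q \<and> f x powr q \<le> max (\<delta> powr q) (M powr q)" for x
  proof (cases "0 \<le> q")
    case True
    then show ?thesis using in_range[of x] \<open>0 < \<delta>\<close> M
      by (auto simp: m_def min_le_iff_disj le_max_iff_disj intro!: powr_mono2)
  next
    case False
    then show ?thesis using in_range[of x] \<open>0 < \<delta>\<close> M
      by (auto simp: m_def min_le_iff_disj le_max_iff_disj intro!: powr_mono2')
  qed
  moreover have "max (\<delta> powr q) (M powr q) \<le> M'"
  proof -
    have "0 \<le> C * M + (C * (2 * M)\<^sup>2 + C * M)" using C(1) M by simp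
    then show ?thesis unfolding M'_def by linarith
  qed
  ultimately have 1: "m \<le> f x powr q \<and> f x powr q \<le> M'" for x by (meson order_trans)
  have 2: "\<bar>q * f x powr (q - 1) * f' x\<bar> \<le> M'" for x
  proof -
    have "\<bar>q * f x powr (q - 1) * f' x\<bar> \<le> C * M"
      using C(1) C(2)[OF in_range[of x]] f'(1)[of x] unfolding abs_mult[of _ "f' x"] by (intro mult_mono) auto
    also have "\<dots> \<le> M'" using C M by (simp add: M'_def le_max_iff_disj add_increasing add_increasing2)
    finally show ?thesis .
  qed
  have 3: "\<bar>f (x + h) powr q - f x powr q - h * (q * f x powr (q - 1) * f' x)\<bar> \<le> M' * h\<^sup>2" for x h
  proof -
    define g where "g = q * f x powr (q - 1)"
    have "\<bar>f (x + h) powr q - f x powr q - (f (x + h) - f x) * g\<bar> \<le> C * (f (x + h) - f x)\<^sup>2"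
      using C(3)[OF in_range in_range] by (simp add: g_def)
    also have "\<dots> \<le> C * (2 * M * \<bar>h\<bar>)\<^sup>2"
      using C(1) lip[of x h] by (intro mult_left_mono) (auto simp: abs_le_square_iff[symmetric])
    finally have a: "\<bar>f (x + h) powr q - f x powr q - (f (x + h) - f x) * g\<bar> \<le> C * (2 * M)\<^sup>2 * h\<^sup>2"
      by (simp add: power_mult_distrib)
    have "\<bar>(f (x + h) - f x - h * f' x) * g\<bar> \<le> (M * h\<^sup>2) * C"
      unfolding abs_mult using f'(2) C(2)[OF in_range[of x]] M C(1) by (intro mult_mono) (auto simp: g_def)
    then have "\<bar>f (x + h) powr q - f x powr q - h * (g * f' x)\<bar> \<le> C * (2 * M)\<^sup>2 * h\<^sup>2 + (M * h\<^sup>2) * C"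
      using a by (simp add: algebra_simps abs_le_iff)
    also have "\<dots> = (C * (2 * M)\<^sup>2 + C * M) * h\<^sup>2" by (simp add: algebra_simps)
    also have "\<dots> \<le> M' * h\<^sup>2"
      using C(1) M by (intro mult_right_mono) (auto simp: M'_def le_max_iff_disj intro!: add_increasing)
    finally show ?thesis by (simp add: g_def)
  qed
  have "quadratic_taylor m M' (\<lambda>x. f x powr q)"
    unfolding quadratic_taylor_def using 1 2 3
    by (auto intro!: bexI[where x = "\<lambda>x. q * f x powr (q - 1) * f' x"])
  moreover have "0 < m" using M \<open>0 < \<delta>\<close> by (auto simp: m_def)
  ultimately show ?thesis using that by blast
qed

text \<open>One step of the heat flow, of standard deviation \<open>e\<close>. Divide each \<open>f\<^sub>j\<close> by its mean and write the
quotient as \<open>1 + \<rho>\<^sub>j\<close>, where \<open>\<rho>\<^sub>j\<close> has mean zero and equals \<open>e l\<^sub>j z\<^sub>j\<close> up to \<open>O (e\<^sup>2)\<close>. In the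
second-order expansion the linear term vanishes in the mean, and the quadratic term is at most \<open>e\<^sup>2/2\<close> times
\<open>E (\<Sum>\<^sub>j c\<^sub>j l\<^sub>j z\<^sub>j)\<^sup>2 - \<Sum>\<^sub>j c\<^sub>j l\<^sub>j\<^sup>2 E z\<^sub>j\<^sup>2\<close>, which is nonpositive because \<open>B\<close> is a contraction and
\<open>E z\<^sub>j\<^sup>2 = c\<^sub>j\<close>. The rest is of order \<open>e\<^sup>3\<close>. The constant must depend on the \<open>f\<^sub>j\<close> only through \<open>\<delta>\<close>
and \<open>M\<close>, which later steps inherit.\<close>

lemma gaussian_step:
  fixes B :: "'j \<Rightarrow> 'i \<Rightarrow> real" and \<delta> M :: real
  assumes I: "finite I" and J: "finite J"
    and contr: "\<And>\<mu>. (\<Sum>i\<in>I. (\<Sum>j\<in>J. \<mu> j * B j i)\<^sup>2) \<le> (\<Sum>j\<in>J. (\<mu> j)\<^sup>2)"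
    and weights: "\<forall>j\<in>J. c j = (\<Sum>i\<in>I. (B j i)\<^sup>2) \<and> c j \<le> 1"
    and \<delta>: "0 < \<delta>" "\<delta> \<le> M"
  shows "\<exists>K\<ge>0. \<forall>e f y. 0 < e \<longrightarrow> e \<le> 1 \<longrightarrow> (\<forall>j\<in>J. quadratic_taylor \<delta> M (f j)) \<longrightarrow>
    (\<integral>\<zeta>. (\<Prod>j\<in>J. f j (y j + e * (\<Sum>i\<in>I. B j i * \<zeta> i)) powr c j) \<partial>std_normals I) \<le>
    (1 + K * e ^ 3) * (\<Prod>j\<in>J. (\<integral>\<zeta>. f j (y j + e * (\<Sum>i\<in>I. B j i * \<zeta> i)) \<partial>std_normals I) powr c j)"
proof -
  have c: "\<And>j. j \<in> J \<Longrightarrow> c j = (\<Sum>i\<in>I. (B j i)\<^sup>2)" "\<And>j. j \<in> J \<Longrightarrow> c j \<le> 1"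
    using weights by auto
  interpret prob_space "std_normals I" by simp
  define z where "z j \<zeta> = (\<Sum>i\<in>I. B j i * \<zeta> i)" for j and \<zeta> :: "'i \<Rightarrow> real"
  define \<kappa> where "\<kappa> = M / \<delta>"
  have \<kappa>: "1 \<le> \<kappa>" "0 \<le> \<kappa>" using \<delta> by (auto simp: \<kappa>_def)
  have z_meas [measurable]: "z j \<in> borel_measurable (std_normals I)" for j
    unfolding z_def by measurable
  have z_int: "integrable (std_normals I) (\<lambda>\<zeta>. z j \<zeta> ^ n)" for j n
    unfolding z_def by (rule linear_form_moment(1)[OF I])
  have z1: "(\<integral>\<zeta>. z j \<zeta> \<partial>std_normals I) = 0" for j
    unfolding z_def by (rule linear_form_moment(2)[OF I])
  have z2: "(\<integral>\<zeta>. (z j \<zeta>)\<^sup>2 \<partial>std_normals I) = c j" if "j \<in> J" for j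
    unfolding z_def c(1)[OF that] by (rule linear_form_moment(3)[OF I])
  define Z where "Z \<zeta> = (\<Sum>j\<in>J. 1 + (z j \<zeta>)\<^sup>2)" for \<zeta>
  have Z_meas [measurable]: "Z \<in> borel_measurable (std_normals I)"
    unfolding Z_def by measurable
  have Z0: "0 \<le> Z \<zeta>" for \<zeta> unfolding Z_def by (intro sum_nonneg) auto
  have Z_int: "integrable (std_normals I) (\<lambda>\<zeta>. Z \<zeta> ^ Suc n)" for n
  proof (rule Bochner_Integration.integrable_bound)
    have "(1 + x\<^sup>2) ^ Suc n = (\<Sum>k\<le>Suc n. real (Suc n choose k) * x ^ (2 * (Suc n - k)))" for x :: real
      unfolding binomial_ring by (simp add: power_mult)
    then show "integrable (std_normals I) (\<lambda>\<zeta>. real (card J) ^ Suc n * (\<Sum>j\<in>J. (1 + (z j \<zeta>)\<^sup>2) ^ Suc n))"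
      by (simp only: power_Suc[symmetric]) (intro integrable_mult_right Bochner_Integration.integrable_sum z_int)
    show "AE \<zeta> in std_normals I. norm (Z \<zeta> ^ Suc n) \<le> norm (real (card J) ^ Suc n * (\<Sum>j\<in>J. (1 + (z j \<zeta>)\<^sup>2) ^ Suc n))"
    proof (rule AE_I2)
      fix \<zeta>
      have "norm (Z \<zeta> ^ Suc n) = Z \<zeta> ^ Suc n" using Z0 by simp
      also have "\<dots> \<le> real (card J) ^ Suc n * (\<Sum>j\<in>J. (1 + (z j \<zeta>)\<^sup>2) ^ Suc n)"
        unfolding Z_def by (rule power_sum_le_sum_power[OF J]) auto
      also have "\<dots> \<le> norm (real (card J) ^ Suc n * (\<Sum>j\<in>J. (1 + (z j \<zeta>)\<^sup>2) ^ Suc n))"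
        unfolding real_norm_def by (rule abs_ge_self)
      finally show "norm (Z \<zeta> ^ Suc n) \<le> norm (real (card J) ^ Suc n * (\<Sum>j\<in>J. (1 + (z j \<zeta>)\<^sup>2) ^ Suc n))" .
    qed
  qed measurable
  have Z_int2: "integrable (std_normals I) (\<lambda>\<zeta>. (Z \<zeta>)\<^sup>2)" and Z_int3: "integrable (std_normals I) (\<lambda>\<zeta>. Z \<zeta> ^ 3)"
    using Z_int[of 1] Z_int[of 2] by (simp_all add: numeral_2_eq_2 numeral_3_eq_3)
  have c01: "0 \<le> c j \<and> c j \<le> 1" if "j \<in> J" for j
    using c that by (simp add: sum_nonneg)
  obtain C where C: "0 \<le> C" 
    "\<And>\<rho>. (\<And>j. j \<in> J \<Longrightarrow> -1 < \<rho> j) \<Longrightarrow> (\<Sum>j\<in>J. \<bar>\<rho> j\<bar>) \<le> real (card J) * \<kappa> \<Longrightarrow>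
      (\<Prod>j\<in>J. (1 + \<rho> j) powr c j) \<le> 1 + (\<Sum>j\<in>J. c j * \<rho> j) + 
         ((\<Sum>j\<in>J. c j * \<rho> j)\<^sup>2 - (\<Sum>j\<in>J. c j * (\<rho> j)\<^sup>2)) / 2 + C * (\<Sum>j\<in>J. \<bar>\<rho> j\<bar>) ^ 3"
    proof (rule prod_powr_le_second_order[OF J c01])
    show "0 \<le> real (card J) * \<kappa>" using \<kappa> by simp
  qed blast+
  define K where "K = 3 * \<kappa>\<^sup>2 * (\<integral>\<zeta>. (Z \<zeta>)\<^sup>2 \<partial>std_normals I) + 8 * C * \<kappa> ^ 3 * (\<integral>\<zeta>. Z \<zeta> ^ 3 \<partial>std_normals I)"
  have "0 \<le> K" using C \<kappa> Z0 by (auto simp: K_def intro!: add_nonneg_nonneg mult_nonneg_nonneg)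
  moreover have "(\<integral>\<zeta>. (\<Prod>j\<in>J. f j (y j + e * z j \<zeta>) powr c j) \<partial>std_normals I) \<le>
    (1 + K * e ^ 3) * (\<Prod>j\<in>J. (\<integral>\<zeta>. f j (y j + e * z j \<zeta>) \<partial>std_normals I) powr c j)"
    if e: "0 < e" "e \<le> 1" and f: "\<And>j. j \<in> J \<Longrightarrow> quadratic_taylor \<delta> M (f j)" for e f y
  proof -
    have [measurable]: "f j \<in> borel_measurable borel" if "j \<in> J" for j
      using quadratic_taylor_measurable f that by blast
    have bds: "\<delta> \<le> f j x" "f j x \<le> M" if "j \<in> J" for j x
      using quadratic_taylor_bounds f that by blast+
    have f_int: "integrable (std_normals I) (\<lambda>\<zeta>. f j (y j + e * z j \<zeta>))" if "j \<in> J" for j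
    proof (rule integrable_const_bound[where B = M], rule AE_I2)
      show "norm (f j (y j + e * z j \<zeta>)) \<le> M" for \<zeta>
        using \<delta> bds(1)[OF that, of "y j + e * z j \<zeta>"] bds(2)[OF that, of "y j + e * z j \<zeta>"] by simp
    qed (use that in measurable)
    define m where "m j = (\<integral>\<zeta>. f j (y j + e * z j \<zeta>) \<partial>std_normals I)" for j
    have m: "\<delta> \<le> m j" "m j \<le> M" if "j \<in> J" for j
      using integral_mono[OF integrable_const[of \<delta>] f_int[OF that]] integral_mono[OF f_int[OF that] integrable_const[of M]]
        bds[OF that] by (auto simp: m_def prob_space)
    have "\<forall>j\<in>J. \<exists>f'. \<forall>x h. \<bar>f' x\<bar> \<le> M \<and> \<bar>f j (x + h) - f j x - h * f' x\<bar> \<le> M * h\<^sup>2"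
      using f unfolding quadratic_taylor_def by blast
    then obtain f' where f': "\<And>j x. j \<in> J \<Longrightarrow> \<bar>f' j x\<bar> \<le> M" 
      "\<And>j x h. j \<in> J \<Longrightarrow> \<bar>f j (x + h) - f j x - h * f' j x\<bar> \<le> M * h\<^sup>2"
      unfolding bchoice_iff by blast
    define \<rho> where "\<rho> j \<zeta> = f j (y j + e * z j \<zeta>) / m j - 1" for j \<zeta>
    define l where "l j = f' j (y j) / m j" for j
    define R where "R j \<zeta> = \<rho> j \<zeta> - e * l j * z j \<zeta>" for j \<zeta>
    have \<rho>_meas [measurable]: "\<rho> j \<in> borel_measurable (std_normals I)" if "j \<in> J" for j
      unfolding \<rho>_def using that by measurable
    have m0: "0 < m j" if "j \<in> J" for j using m(1)[OF that] \<delta> by simp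
    have div: "x / m j \<le> a / \<delta>" if "j \<in> J" "x \<le> a" "0 \<le> a" for j x a
      using that m0[OF that(1)] m(1)[OF that(1)] \<delta>
      by (intro order_trans[OF divide_right_mono[of x a "m j"] divide_left_mono[of \<delta> "m j" a]]) auto
    have \<rho>_range: "-1 < \<rho> j \<zeta>" "\<bar>\<rho> j \<zeta>\<bar> \<le> \<kappa>" if "j \<in> J" for j \<zeta>
    proof -
      have "0 < f j (y j + e * z j \<zeta>)" using bds(1)[OF that] \<delta> by (auto intro: less_le_trans)
      then have pos: "0 < f j (y j + e * z j \<zeta>) / m j" using m0[OF that] by simp
      then show "-1 < \<rho> j \<zeta>" by (simp add: \<rho>_def)
      have "f j (y j + e * z j \<zeta>) / m j \<le> \<kappa>"
        using div[OF that bds(2)[OF that]] \<delta> by (simp add: \<kappa>_def)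
      then show "\<bar>\<rho> j \<zeta>\<bar> \<le> \<kappa>" using pos \<kappa> by (simp add: \<rho>_def abs_le_iff)
    qed
    have \<rho>_int: "integrable (std_normals I) (\<rho> j)" if "j \<in> J" for j
      using that \<rho>_range[OF that] by (intro integrable_const_bound[where B = \<kappa>]) auto
    have \<rho>_mean: "(\<integral>\<zeta>. \<rho> j \<zeta> \<partial>std_normals I) = 0" if "j \<in> J" for j
      unfolding \<rho>_def using f_int[OF that] m0[OF that] by (simp add: prob_space m_def[symmetric])
    have mf: "\<bar>m j - f j (y j)\<bar> \<le> M * e\<^sup>2" if j: "j \<in> J" for j
    proof -
      have zi: "integrable (std_normals I) (z j)" "integrable (std_normals I) (\<lambda>\<zeta>. (z j \<zeta>)\<^sup>2)"
        using z_int[of j 1] z_int[of j 2] by simp_all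
      have "\<bar>m j - f j (y j)\<bar> = \<bar>\<integral>\<zeta>. f j (y j + e * z j \<zeta>) - f j (y j) - (e * z j \<zeta>) * f' j (y j) \<partial>std_normals I\<bar>"
        using f_int[OF j] zi z1 by (simp add: m_def prob_space)
      also have "\<dots> \<le> (\<integral>\<zeta>. \<bar>f j (y j + e * z j \<zeta>) - f j (y j) - (e * z j \<zeta>) * f' j (y j)\<bar> \<partial>std_normals I)"
        by (rule integral_abs_bound)
      also have "\<dots> \<le> (\<integral>\<zeta>. M * (e * z j \<zeta>)\<^sup>2 \<partial>std_normals I)"
      proof (rule integral_mono)
        show "integrable (std_normals I) (\<lambda>\<zeta>. \<bar>f j (y j + e * z j \<zeta>) - f j (y j) - (e * z j \<zeta>) * f' j (y j)\<bar>)"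
          using f_int[OF j] zi by simp
        show "integrable (std_normals I) (\<lambda>\<zeta>. M * (e * z j \<zeta>)\<^sup>2)"
          using zi by (simp add: power_mult_distrib)
      qed (rule f'(2)[OF j])
      also have "\<dots> = M * e\<^sup>2 * c j"
        by (simp add: power_mult_distrib z2[OF j])
      also have "\<dots> \<le> M * e\<^sup>2 * 1"
        using c01[OF j] \<delta> by (intro mult_left_mono) auto
      finally show ?thesis by simp
    qed
    have R_bound: "\<bar>R j \<zeta>\<bar> \<le> \<kappa> * e\<^sup>2 * (1 + (z j \<zeta>)\<^sup>2)" if j: "j \<in> J" for j \<zeta>
    proof -
      have "R j \<zeta> = ((f j (y j) - m j) + (f j (y j + e * z j \<zeta>) - f j (y j) - (e * z j \<zeta>) * f' j (y j))) / m j"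
        using m0[OF j] by (simp add: R_def \<rho>_def l_def field_simps)
      then have "\<bar>R j \<zeta>\<bar> = \<bar>((f j (y j) - m j) + (f j (y j + e * z j \<zeta>) - f j (y j) - (e * z j \<zeta>) * f' j (y j))) / m j\<bar>"
        by (rule arg_cong)
      also have "\<dots> \<le> (M * e\<^sup>2 + M * (e * z j \<zeta>)\<^sup>2) / \<delta>"
        unfolding abs_divide using m0[OF j] mf[OF j] f'(2)[OF j, of "y j" "e * z j \<zeta>"] \<delta>
        by (subst (2) abs_of_pos, simp, intro div[OF j]) (auto simp: abs_le_iff)
      also have "\<dots> = \<kappa> * e\<^sup>2 * (1 + (z j \<zeta>)\<^sup>2)"
        by (simp add: \<kappa>_def power_mult_distrib field_simps)
      finally show ?thesis .
    qed
    have l_bound: "\<bar>l j\<bar> \<le> \<kappa>" if j: "j \<in> J" for j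
      using div[OF j f'(1)[OF j, of "y j"]] \<delta> m0[OF j] by (simp add: l_def \<kappa>_def)
    have lin_bound: "\<bar>e * l j * z j \<zeta>\<bar> \<le> \<kappa> * e * (1 + (z j \<zeta>)\<^sup>2)" if j: "j \<in> J" for j \<zeta>
    proof -
      have "\<bar>z j \<zeta>\<bar> \<le> 1 + (z j \<zeta>)\<^sup>2"
        using zero_le_power2[of "\<bar>z j \<zeta>\<bar> - 1"] zero_le_power2[of "z j \<zeta>"] by (simp add: power2_diff)
      then have "\<bar>l j\<bar> * \<bar>z j \<zeta>\<bar> \<le> \<kappa> * (1 + (z j \<zeta>)\<^sup>2)"
        using l_bound[OF j] \<kappa> by (intro mult_mono) auto
      then have "e * (\<bar>l j\<bar> * \<bar>z j \<zeta>\<bar>) \<le> e * (\<kappa> * (1 + (z j \<zeta>)\<^sup>2))"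
        using e by (intro mult_left_mono) auto
      then show ?thesis using e by (simp add: abs_mult mult_ac)
    qed
    have ee: "e\<^sup>2 \<le> e" using e by (simp add: power2_eq_square)
    have R_bound': "\<bar>R j \<zeta>\<bar> \<le> \<kappa> * e * (1 + (z j \<zeta>)\<^sup>2)" if j: "j \<in> J" for j \<zeta>
      by (rule order_trans[OF R_bound[OF j]]) (use ee \<kappa> in \<open>auto intro!: mult_right_mono mult_left_mono\<close>)
    have \<rho>_bound: "\<bar>\<rho> j \<zeta>\<bar> \<le> 2 * \<kappa> * e * (1 + (z j \<zeta>)\<^sup>2)" if j: "j \<in> J" for j \<zeta>
      using R_bound'[OF j, of \<zeta>] lin_bound[OF j, of \<zeta>] by (simp add: R_def abs_le_iff)
    have \<sigma>_le: "(\<Sum>j\<in>J. \<bar>\<rho> j \<zeta>\<bar>) \<le> 2 * \<kappa> * e * Z \<zeta>" for \<zeta>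
      unfolding Z_def sum_distrib_left by (intro sum_mono \<rho>_bound)
    define Q where "Q \<zeta> = (\<Sum>j\<in>J. c j * l j * z j \<zeta>)\<^sup>2 - (\<Sum>j\<in>J. c j * (l j)\<^sup>2 * (z j \<zeta>)\<^sup>2)" for \<zeta>
    have lin: "(\<Sum>j\<in>J. c j * l j * z j \<zeta>) = (\<Sum>i\<in>I. (\<Sum>j\<in>J. c j * l j * B j i) * \<zeta> i)" for \<zeta>
      unfolding z_def sum_distrib_left sum_distrib_right by (subst sum.swap) (simp add: mult_ac)
    have Q_int: "integrable (std_normals I) Q"
      unfolding Q_def lin by (intro Bochner_Integration.integrable_diff linear_form_moment(1)[OF I] Bochner_Integration.integrable_sum integrable_mult_right z_int)
    \<comment> \<open>The only place where the geometry enters: the quadratic term of the expansion has nonpositive mean.\<close>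
    have Q_mean: "(\<integral>\<zeta>. Q \<zeta> \<partial>std_normals I) \<le> 0"
    proof -
      have "(\<integral>\<zeta>. Q \<zeta> \<partial>std_normals I) = (\<integral>\<zeta>. (\<Sum>j\<in>J. c j * l j * z j \<zeta>)\<^sup>2 \<partial>std_normals I) - (\<Sum>j\<in>J. c j * (l j)\<^sup>2 * c j)"
        unfolding Q_def using linear_form_moment(1)[OF I, where n=2] z_int[of _ 2] z2
        by (subst Bochner_Integration.integral_diff) (auto simp: lin)
      also have "(\<integral>\<zeta>. (\<Sum>j\<in>J. c j * l j * z j \<zeta>)\<^sup>2 \<partial>std_normals I) = (\<Sum>i\<in>I. (\<Sum>j\<in>J. (c j * l j) * B j i)\<^sup>2)"
        unfolding lin by (rule linear_form_moment(3)[OF I])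
      also have "\<dots> \<le> (\<Sum>j\<in>J. (c j * l j)\<^sup>2)" by (rule contr)
      finally show ?thesis by (simp add: power2_eq_square mult_ac)
    qed
    have second: "(\<Sum>j\<in>J. c j * \<rho> j \<zeta>)\<^sup>2 - (\<Sum>j\<in>J. c j * (\<rho> j \<zeta>)\<^sup>2) \<le> e\<^sup>2 * Q \<zeta> + 6 * \<kappa>\<^sup>2 * e ^ 3 * (Z \<zeta>)\<^sup>2" for \<zeta>
    proof -
      define a where "a = (\<Sum>j\<in>J. c j * (e * l j * z j \<zeta>))"
      define r where "r = (\<Sum>j\<in>J. c j * R j \<zeta>)"
      have ar: "(\<Sum>j\<in>J. c j * \<rho> j \<zeta>) = a + r"
        by (simp add: a_def r_def R_def algebra_simps sum.distrib sum_subtractf)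
      have "\<bar>a\<bar> \<le> (\<Sum>j\<in>J. \<kappa> * e * (1 + (z j \<zeta>)\<^sup>2))" unfolding a_def
      proof (rule order_trans[OF sum_abs sum_mono])
        fix j assume j: "j \<in> J"
        have "\<bar>c j * (e * l j * z j \<zeta>)\<bar> \<le> \<bar>e * l j * z j \<zeta>\<bar>"
          unfolding abs_mult[of "c j"] using c01[OF j] by (intro mult_left_le_one_le) auto
        then show "\<bar>c j * (e * l j * z j \<zeta>)\<bar> \<le> \<kappa> * e * (1 + (z j \<zeta>)\<^sup>2)"
          using lin_bound[OF j, of \<zeta>] by linarith
      qed
      then have a: "\<bar>a\<bar> \<le> \<kappa> * e * Z \<zeta>" by (simp add: Z_def sum_distrib_left)
      have "\<bar>r\<bar> \<le> (\<Sum>j\<in>J. \<kappa> * e\<^sup>2 * (1 + (z j \<zeta>)\<^sup>2))" unfolding r_def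
      proof (rule order_trans[OF sum_abs sum_mono])
        fix j assume j: "j \<in> J"
        have "\<bar>c j * R j \<zeta>\<bar> \<le> \<bar>R j \<zeta>\<bar>"
          unfolding abs_mult[of "c j"] using c01[OF j] by (intro mult_left_le_one_le) auto
        then show "\<bar>c j * R j \<zeta>\<bar> \<le> \<kappa> * e\<^sup>2 * (1 + (z j \<zeta>)\<^sup>2)"
          using R_bound[OF j, of \<zeta>] by linarith
      qed
      then have r: "\<bar>r\<bar> \<le> \<kappa> * e\<^sup>2 * Z \<zeta>" by (simp add: Z_def sum_distrib_left)
      have r': "\<bar>r\<bar> \<le> \<kappa> * e * Z \<zeta>"
        by (rule order_trans[OF r]) (use ee \<kappa> Z0 in \<open>auto intro!: mult_right_mono mult_left_mono\<close>)
      have "(a + r)\<^sup>2 - a\<^sup>2 = r * (2 * a + r)" by (simp add: power2_eq_square algebra_simps)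
      also have "\<dots> \<le> \<bar>r\<bar> * \<bar>2 * a + r\<bar>" by (simp flip: abs_mult)
      also have "\<dots> \<le> (\<kappa> * e\<^sup>2 * Z \<zeta>) * (3 * (\<kappa> * e * Z \<zeta>))"
        using a r r' e \<kappa> Z0 by (intro mult_mono) (auto simp: abs_le_iff)
      also have "\<dots> = 3 * \<kappa>\<^sup>2 * e ^ 3 * (Z \<zeta>)\<^sup>2" by (simp add: power2_eq_square power3_eq_cube)
      finally have 1: "(a + r)\<^sup>2 \<le> a\<^sup>2 + 3 * \<kappa>\<^sup>2 * e ^ 3 * (Z \<zeta>)\<^sup>2" by simp
      have "(\<Sum>j\<in>J. c j * (e * l j * z j \<zeta>)\<^sup>2) - (\<Sum>j\<in>J. c j * (\<rho> j \<zeta>)\<^sup>2)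
          \<le> (\<Sum>j\<in>J. 3 * \<kappa>\<^sup>2 * e ^ 3 * (1 + (z j \<zeta>)\<^sup>2) ^ Suc 1)"
        unfolding sum_subtractf[symmetric]
      proof (rule sum_mono)
        fix j assume j: "j \<in> J"
        define u where "u = 1 + (z j \<zeta>)\<^sup>2"
        have u: "0 \<le> u" by (simp add: u_def)
        define b where "b = e * l j * z j \<zeta>"
        have b: "\<bar>b\<bar> \<le> \<kappa> * e * u" using lin_bound[OF j, of \<zeta>] by (simp add: u_def b_def)
        have "b\<^sup>2 - (\<rho> j \<zeta>)\<^sup>2 = - (R j \<zeta> * (2 * b + R j \<zeta>))"
          by (simp add: power2_eq_square algebra_simps R_def b_def)
        also have "\<dots> \<le> \<bar>R j \<zeta>\<bar> * \<bar>2 * b + R j \<zeta>\<bar>" by (simp flip: abs_mult)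
        also have "\<dots> \<le> (\<kappa> * e\<^sup>2 * u) * (3 * (\<kappa> * e * u))"
          using b R_bound[OF j, of \<zeta>] R_bound'[OF j, of \<zeta>] e \<kappa> u
          by (intro mult_mono) (auto simp: abs_le_iff u_def)
        also have "\<dots> = 3 * \<kappa>\<^sup>2 * e ^ 3 * u ^ Suc 1" by (simp add: power2_eq_square power3_eq_cube)
        finally have "c j * (b\<^sup>2 - (\<rho> j \<zeta>)\<^sup>2) \<le> c j * (3 * \<kappa>\<^sup>2 * e ^ 3 * u ^ Suc 1)"
          using c01[OF j] by (intro mult_left_mono) auto
        also have "\<dots> \<le> 3 * \<kappa>\<^sup>2 * e ^ 3 * u ^ Suc 1"
          using c01[OF j] e \<kappa> u by (intro mult_left_le_one_le) auto
        finally show "c j * (e * l j * z j \<zeta>)\<^sup>2 - c j * (\<rho> j \<zeta>)\<^sup>2 \<le> 3 * \<kappa>\<^sup>2 * e ^ 3 * (1 + (z j \<zeta>)\<^sup>2) ^ Suc 1"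
          by (simp add: b_def u_def algebra_simps)
      qed
      also have "\<dots> = 3 * \<kappa>\<^sup>2 * e ^ 3 * (\<Sum>j\<in>J. (1 + (z j \<zeta>)\<^sup>2) ^ Suc 1)" by (simp only: sum_distrib_left)
      also have "\<dots> \<le> 3 * \<kappa>\<^sup>2 * e ^ 3 * (Z \<zeta>) ^ Suc 1"
        unfolding Z_def using e \<kappa> J by (intro mult_left_mono sum_power_le_power_sum) auto
      finally have 2: "(\<Sum>j\<in>J. c j * (e * l j * z j \<zeta>)\<^sup>2) - (\<Sum>j\<in>J. c j * (\<rho> j \<zeta>)\<^sup>2) \<le> 3 * \<kappa>\<^sup>2 * e ^ 3 * (Z \<zeta>)\<^sup>2"
        by (simp add: numeral_2_eq_2)
      have "a = e * (\<Sum>j\<in>J. c j * l j * z j \<zeta>)" by (simp add: a_def sum_distrib_left mult_ac)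
      moreover have "(\<Sum>j\<in>J. c j * (e * l j * z j \<zeta>)\<^sup>2) = e\<^sup>2 * (\<Sum>j\<in>J. c j * (l j)\<^sup>2 * (z j \<zeta>)\<^sup>2)"
        by (simp add: sum_distrib_left power_mult_distrib mult_ac)
      ultimately have "a\<^sup>2 - (\<Sum>j\<in>J. c j * (e * l j * z j \<zeta>)\<^sup>2) = e\<^sup>2 * Q \<zeta>"
        by (simp add: Q_def power_mult_distrib algebra_simps)
      then show ?thesis using 1 2 unfolding ar by linarith
    qed
    define U where "U \<zeta> = 1 + (\<Sum>j\<in>J. c j * \<rho> j \<zeta>) + (e\<^sup>2 * Q \<zeta> + 6 * \<kappa>\<^sup>2 * e ^ 3 * (Z \<zeta>)\<^sup>2) / 2
       + C * ((2 * \<kappa> * e) ^ 3 * Z \<zeta> ^ 3)" for \<zeta>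
    have pw: "(\<Prod>j\<in>J. (1 + \<rho> j \<zeta>) powr c j) \<le> U \<zeta>" for \<zeta>
    proof -
      have "(\<Sum>j\<in>J. \<bar>\<rho> j \<zeta>\<bar>) ^ 3 \<le> (2 * \<kappa> * e * Z \<zeta>) ^ 3"
        using \<sigma>_le by (intro power_mono sum_nonneg) auto
      then have cube: "C * (\<Sum>j\<in>J. \<bar>\<rho> j \<zeta>\<bar>) ^ 3 \<le> C * ((2 * \<kappa> * e) ^ 3 * Z \<zeta> ^ 3)"
        using C(1) by (intro mult_left_mono) (auto simp: power_mult_distrib)
      have "(\<Sum>j\<in>J. \<bar>\<rho> j \<zeta>\<bar>) \<le> real (card J) * \<kappa>"
        using \<rho>_range(2) by (intro sum_bounded_above) auto
      note C(2)[of "\<lambda>j. \<rho> j \<zeta>", OF _ this]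
      then have "(\<Prod>j\<in>J. (1 + \<rho> j \<zeta>) powr c j) \<le> 1 + (\<Sum>j\<in>J. c j * \<rho> j \<zeta>) + 
         ((\<Sum>j\<in>J. c j * \<rho> j \<zeta>)\<^sup>2 - (\<Sum>j\<in>J. c j * (\<rho> j \<zeta>)\<^sup>2)) / 2 + C * (\<Sum>j\<in>J. \<bar>\<rho> j \<zeta>\<bar>) ^ 3"
        using \<rho>_range(1) by blast
      then show ?thesis
        unfolding U_def
        by (rule order_trans) (intro add_mono divide_right_mono order_refl second cube; simp)
    qed
    have int0: "integrable (std_normals I) (\<lambda>\<zeta>. \<Prod>j\<in>J. (1 + \<rho> j \<zeta>) powr c j)"
    proof (rule integrable_const_bound[where B = "(1 + \<kappa>) ^ card J"])
      show "AE \<zeta> in std_normals I. norm (\<Prod>j\<in>J. (1 + \<rho> j \<zeta>) powr c j) \<le> (1 + \<kappa>) ^ card J"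
      proof (rule AE_I2)
        fix \<zeta>
        have "(1 + \<rho> j \<zeta>) powr c j \<le> 1 + \<kappa>" if j: "j \<in> J" for j
        proof -
          have "(1 + \<rho> j \<zeta>) powr c j \<le> (1 + \<kappa>) powr c j"
            using \<rho>_range[OF j, of \<zeta>] c01[OF j] by (intro powr_mono2) (auto simp: abs_le_iff)
          also have "\<dots> \<le> (1 + \<kappa>) powr 1" using c01[OF j] \<kappa> by (intro powr_mono) auto
          finally show ?thesis using \<kappa> by simp
        qed
        then have "(\<Prod>j\<in>J. (1 + \<rho> j \<zeta>) powr c j) \<le> (\<Prod>j\<in>J. 1 + \<kappa>)"
          by (intro prod_mono) auto
        then show "norm (\<Prod>j\<in>J. (1 + \<rho> j \<zeta>) powr c j) \<le> (1 + \<kappa>) ^ card J"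
          by (simp add: prod_nonneg)
      qed
    qed measurable
    have intU: "integrable (std_normals I) U"
      unfolding U_def using \<rho>_int Q_int Z_int2 Z_int3 by auto
    have "(\<integral>\<zeta>. (\<Prod>j\<in>J. (1 + \<rho> j \<zeta>) powr c j) \<partial>std_normals I) \<le> (\<integral>\<zeta>. U \<zeta> \<partial>std_normals I)"
      using int0 intU pw by (rule integral_mono)
    also have "\<dots> = 1 + (e\<^sup>2 * (\<integral>\<zeta>. Q \<zeta> \<partial>std_normals I) + 6 * \<kappa>\<^sup>2 * e ^ 3 * (\<integral>\<zeta>. (Z \<zeta>)\<^sup>2 \<partial>std_normals I)) / 2
       + C * ((2 * \<kappa> * e) ^ 3 * (\<integral>\<zeta>. Z \<zeta> ^ 3 \<partial>std_normals I))"
      unfolding U_def using \<rho>_int Q_int Z_int2 Z_int3 \<rho>_mean by (simp add: prob_space)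
    also have "\<dots> \<le> 1 + K * e ^ 3"
      using Q_mean e by (simp add: K_def power_mult_distrib algebra_simps mult_nonneg_nonpos)
    finally have main: "(\<integral>\<zeta>. (\<Prod>j\<in>J. (1 + \<rho> j \<zeta>) powr c j) \<partial>std_normals I) \<le> 1 + K * e ^ 3" .
    have "(\<integral>\<zeta>. (\<Prod>j\<in>J. f j (y j + e * z j \<zeta>) powr c j) \<partial>std_normals I) = 
       (\<integral>\<zeta>. (\<Prod>j\<in>J. m j powr c j) * (\<Prod>j\<in>J. (1 + \<rho> j \<zeta>) powr c j) \<partial>std_normals I)"
    proof (intro Bochner_Integration.integral_cong refl, unfold prod.distrib[symmetric], intro prod.cong refl)
      fix \<zeta> j assume j: "j \<in> J"
      have "f j (y j + e * z j \<zeta>) = m j * (1 + \<rho> j \<zeta>)" using m0[OF j] by (simp add: \<rho>_def)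
      then show "f j (y j + e * z j \<zeta>) powr c j = m j powr c j * (1 + \<rho> j \<zeta>) powr c j"
        using m0[OF j] \<rho>_range(1)[OF j, of \<zeta>] by (simp add: powr_mult)
    qed
    also have "\<dots> = (\<Prod>j\<in>J. m j powr c j) * (\<integral>\<zeta>. (\<Prod>j\<in>J. (1 + \<rho> j \<zeta>) powr c j) \<partial>std_normals I)"
      by simp
    also have "\<dots> \<le> (\<Prod>j\<in>J. m j powr c j) * (1 + K * e ^ 3)"
      using main by (intro mult_left_mono prod_nonneg) auto
    finally show ?thesis by (simp add: m_def mult.commute)
  qed
  ultimately show ?thesis unfolding z_def by blast
qed

text \<open>Run \<open>n\<close> steps with \<open>e = 1 / sqrt n\<close>. Averaging over a step replaces \<open>f\<^sub>j\<close> by a function of the same class,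
so induction applies, and the accumulated factor \<open>(1 + K n\<^sup>-\<^sup>3\<^sup>/\<^sup>2)\<^sup>n\<close> tends to 1.\<close>

lemma gaussian_brascamp_lieb_regular:
  fixes B :: "'j \<Rightarrow> 'i \<Rightarrow> real" and \<delta> M :: real
  assumes I: "finite I" and J: "finite J"
    and contr: "\<And>\<mu>. (\<Sum>i\<in>I. (\<Sum>j\<in>J. \<mu> j * B j i)\<^sup>2) \<le> (\<Sum>j\<in>J. (\<mu> j)\<^sup>2)"
    and c: "\<And>j. j \<in> J \<Longrightarrow> c j = (\<Sum>i\<in>I. (B j i)\<^sup>2)" "\<And>j. j \<in> J \<Longrightarrow> c j \<le> 1"
    and \<delta>: "0 < \<delta>" and f: "\<And>j. j \<in> J \<Longrightarrow> quadratic_taylor \<delta> M (f j)"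
  shows "(\<integral>\<zeta>. (\<Prod>j\<in>J. f j (\<Sum>i\<in>I. B j i * \<zeta> i) powr c j) \<partial>std_normals I) \<le>
    (\<Prod>j\<in>J. (\<integral>\<zeta>. f j (\<Sum>i\<in>I. B j i * \<zeta> i) \<partial>std_normals I) powr c j)"
proof (cases "J = {}")
  case True
  interpret prob_space "std_normals I" by simp
  show ?thesis using True prob_space by simp
next
  case False
  interpret prob_space "std_normals I" by simp
  have "\<delta> \<le> M" using False f quadratic_taylor_bounds by (metis ex_in_conv order_trans)
  have "\<forall>j\<in>J. c j = (\<Sum>i\<in>I. (B j i)\<^sup>2) \<and> c j \<le> 1" using c by auto
  from gaussian_step[where B = B and c = c, OF I J contr this \<delta> \<open>\<delta> \<le> M\<close>]
  obtain K where K0: "0 \<le> K" and K1: "\<forall>e f y. 0 < e \<longrightarrow> e \<le> 1 \<longrightarrow> (\<forall>j\<in>J. quadratic_taylor \<delta> M (f j)) \<longrightarrow>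
    (\<integral>\<zeta>. (\<Prod>j\<in>J. f j (y j + e * (\<Sum>i\<in>I. B j i * \<zeta> i)) powr c j) \<partial>std_normals I) \<le>
    (1 + K * e ^ 3) * (\<Prod>j\<in>J. (\<integral>\<zeta>. f j (y j + e * (\<Sum>i\<in>I. B j i * \<zeta> i)) \<partial>std_normals I) powr c j)"
    by (elim exE conjE) simp_all
  have K: "0 \<le> K" "\<And>e f y. 0 < e \<Longrightarrow> e \<le> 1 \<Longrightarrow> (\<And>j. j \<in> J \<Longrightarrow> quadratic_taylor \<delta> M (f j)) \<Longrightarrow>
    (\<integral>\<zeta>. (\<Prod>j\<in>J. f j (y j + e * (\<Sum>i\<in>I. B j i * \<zeta> i)) powr c j) \<partial>std_normals I) \<le>
    (1 + K * e ^ 3) * (\<Prod>j\<in>J. (\<integral>\<zeta>. f j (y j + e * (\<Sum>i\<in>I. B j i * \<zeta> i)) \<partial>std_normals I) powr c j)"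
    using K0 K1[rule_format] by blast+
  define z where "z j \<zeta> = (\<Sum>i\<in>I. B j i * \<zeta> i)" for j and \<zeta> :: "'i \<Rightarrow> real"
  have z_meas [measurable]: "z j \<in> borel_measurable (std_normals I)" for j
    unfolding z_def by measurable
  have z_add: "z j (\<lambda>i\<in>I. a * x i + b * y i) = a * z j x + b * z j y" for j a b x y
    by (simp add: z_def algebra_simps sum.distrib sum_distrib_left)
  have z_scale: "z j (\<lambda>i\<in>I. a * x i) = a * z j x" for j a x
    by (simp add: z_def algebra_simps sum_distrib_left)
  have c0: "0 \<le> c j" if "j \<in> J" for j using c(1)[OF that] by (simp add: sum_nonneg)
  have step: "(\<integral>\<zeta>. (\<Prod>j\<in>J. f j (y j + (sqrt (real n) * e) * z j \<zeta>) powr c j) \<partial>std_normals I) \<le>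
      (1 + K * e ^ 3) ^ n * (\<Prod>j\<in>J. (\<integral>\<zeta>. f j (y j + (sqrt (real n) * e) * z j \<zeta>) \<partial>std_normals I) powr c j)"
    if e: "0 < e" "e \<le> 1" and f: "\<And>j. j \<in> J \<Longrightarrow> quadratic_taylor \<delta> M (f j)" for e n y and f :: "'j \<Rightarrow> real \<Rightarrow> real"
    using f
  proof (induction n arbitrary: f)
    case 0
    then show ?case by (simp add: prob_space)
  next
    case (Suc n)
    have [measurable]: "f j \<in> borel_measurable borel" if "j \<in> J" for j
      using quadratic_taylor_measurable Suc.prems that by blast
    have bds: "\<delta> \<le> f j x" "f j x \<le> M" if "j \<in> J" for j x
      using quadratic_taylor_bounds Suc.prems that by blast+
    have pos: "0 \<le> f j x" if "j \<in> J" for j x using bds(1)[OF that, of x] \<delta> by linarith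
    define a where "a = sqrt (real n) * e"
    define a' where "a' = sqrt (real (Suc n)) * e"
    have a': "sqrt (a\<^sup>2 + e\<^sup>2) = a'"
      unfolding a_def a'_def using e
      by (intro real_sqrt_unique) (auto simp: power_mult_distrib algebra_simps)
    define g where "g j t = (\<integral>\<zeta>. f j (t + e * z j \<zeta>) \<partial>std_normals I)" for j t
    have g: "quadratic_taylor \<delta> M (g j)" if "j \<in> J" for j
      unfolding g_def by (rule quadratic_taylor_average[OF Suc.prems[OF that]]) auto
    have [measurable]: "g j \<in> borel_measurable borel" if "j \<in> J" for j
      using quadratic_taylor_measurable[OF g[OF that]] .
    have gbds: "\<delta> \<le> g j x" "g j x \<le> M" if "j \<in> J" for j x
      using quadratic_taylor_bounds[OF g[OF that]] by blast+
    have prodM: "(\<Prod>j\<in>J. h j powr c j) \<le> (\<Prod>j\<in>J. M powr c j)"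
       if "\<And>j. j \<in> J \<Longrightarrow> 0 \<le> h j" "\<And>j. j \<in> J \<Longrightarrow> h j \<le> M" for h
      using that c0 by (intro prod_mono) (auto intro: powr_mono2)
    define G where "G x = (\<Prod>j\<in>J. (if j \<in> J then f j (y j + z j x) else 0) powr c j)" for x
    have G_eq: "G x = (\<Prod>j\<in>J. f j (y j + z j x) powr c j)" for x
      unfolding G_def by (intro prod.cong) auto
    have [measurable]: "G \<in> borel_measurable (std_normals I)"
      unfolding G_eq by measurable
    have "(\<integral>x. G (\<lambda>i\<in>I. sqrt (a\<^sup>2 + e\<^sup>2) * x i) \<partial>std_normals I) =
       (\<integral>x. \<integral>x'. G (\<lambda>i\<in>I. a * x i + e * x' i) \<partial>std_normals I \<partial>std_normals I)"
      by (rule integral_std_normals_add[OF I, symmetric, where C = "\<Prod>j\<in>J. M powr c j"])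
         (use prodM pos bds in \<open>auto simp: G_eq intro!: prod_nonneg\<close>)
    then have "(\<integral>\<zeta>. (\<Prod>j\<in>J. f j (y j + a' * z j \<zeta>) powr c j) \<partial>std_normals I) =
       (\<integral>x. \<integral>x'. (\<Prod>j\<in>J. f j ((y j + a * z j x) + e * z j x') powr c j) \<partial>std_normals I \<partial>std_normals I)"
      by (simp add: G_eq z_add z_scale a' add.assoc)
    also have "\<dots> \<le> (\<integral>x. (1 + K * e ^ 3) * (\<Prod>j\<in>J. g j (y j + a * z j x) powr c j) \<partial>std_normals I)"
    proof (rule integral_mono)
      fix x
      show "(\<integral>x'. (\<Prod>j\<in>J. f j ((y j + a * z j x) + e * z j x') powr c j) \<partial>std_normals I) \<le>
        (1 + K * e ^ 3) * (\<Prod>j\<in>J. g j (y j + a * z j x) powr c j)"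
        using K(2)[of e f "\<lambda>j. y j + a * z j x", OF e Suc.prems] by (simp add: g_def z_def)
    next
      show "integrable (std_normals I) (\<lambda>x. (1 + K * e ^ 3) * (\<Prod>j\<in>J. g j (y j + a * z j x) powr c j))"
      proof (intro integrable_mult_right integrable_const_bound[where B = "\<Prod>j\<in>J. M powr c j"] AE_I2)
        fix x
        show "norm (\<Prod>j\<in>J. g j (y j + a * z j x) powr c j) \<le> (\<Prod>j\<in>J. M powr c j)"
          using prodM[of "\<lambda>j. g j (y j + a * z j x)"] gbds \<delta>
          by (simp add: prod_nonneg) (meson less_le_trans less_imp_le)
      qed measurable
    next
      have meas: "(\<lambda>x. \<integral>x'. (\<Prod>j\<in>J. f j ((y j + a * z j x) + e * z j x') powr c j) \<partial>std_normals I) \<in> borel_measurable (std_normals I)"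
        by measurable
      have i: "integrable (std_normals I) (\<lambda>x'. (\<Prod>j\<in>J. f j ((y j + a * z j x) + e * z j x') powr c j))" for x
        by (rule integrable_const_bound[where B = "\<Prod>j\<in>J. M powr c j"])
           (use prodM pos bds in \<open>auto intro!: AE_I2 simp: prod_nonneg\<close>)
      show "integrable (std_normals I) (\<lambda>x. \<integral>x'. (\<Prod>j\<in>J. f j ((y j + a * z j x) + e * z j x') powr c j) \<partial>std_normals I)"
      proof (rule integrable_const_bound[where B = "\<Prod>j\<in>J. M powr c j", OF AE_I2 meas])
        fix x
        have "(\<integral>x'. (\<Prod>j\<in>J. f j ((y j + a * z j x) + e * z j x') powr c j) \<partial>std_normals I) \<le> 
          (\<integral>x'. (\<Prod>j\<in>J. M powr c j) \<partial>std_normals I)"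
          using prodM pos bds by (intro integral_mono i) auto
        moreover have "0 \<le> (\<integral>x'. (\<Prod>j\<in>J. f j ((y j + a * z j x) + e * z j x') powr c j) \<partial>std_normals I)"
          by (intro Bochner_Integration.integral_nonneg prod_nonneg) auto
        ultimately show "norm (\<integral>x'. (\<Prod>j\<in>J. f j ((y j + a * z j x) + e * z j x') powr c j) \<partial>std_normals I) \<le> (\<Prod>j\<in>J. M powr c j)"
          by (simp add: prob_space)
      qed
    qed
    also have "\<dots> = (1 + K * e ^ 3) * (\<integral>x. (\<Prod>j\<in>J. g j (y j + a * z j x) powr c j) \<partial>std_normals I)"
      by simp
    also have "\<dots> \<le> (1 + K * e ^ 3) * ((1 + K * e ^ 3) ^ n * (\<Prod>j\<in>J. (\<integral>\<zeta>. g j (y j + a * z j \<zeta>) \<partial>std_normals I) powr c j))"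
      using Suc.IH[of g, OF g] K(1) e by (intro mult_left_mono) (auto simp: a_def)
    also have "(\<Prod>j\<in>J. (\<integral>\<zeta>. g j (y j + a * z j \<zeta>) \<partial>std_normals I) powr c j) = (\<Prod>j\<in>J. (\<integral>\<zeta>. f j (y j + a' * z j \<zeta>) \<partial>std_normals I) powr c j)"
    proof (rule prod.cong[OF refl])
      fix j assume j: "j \<in> J"
      have "(\<integral>x. f j (y j + z j (\<lambda>i\<in>I. sqrt (a\<^sup>2 + e\<^sup>2) * x i)) \<partial>std_normals I) =
       (\<integral>x. \<integral>x'. f j (y j + z j (\<lambda>i\<in>I. a * x i + e * x' i)) \<partial>std_normals I \<partial>std_normals I)"
        by (rule integral_std_normals_add[OF I, symmetric, where C = M and G = "\<lambda>x. f j (y j + z j x)"])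
           (use j pos bds in auto)
      then show "(\<integral>\<zeta>. g j (y j + a * z j \<zeta>) \<partial>std_normals I) powr c j = (\<integral>\<zeta>. f j (y j + a' * z j \<zeta>) \<partial>std_normals I) powr c j"
        by (simp add: g_def z_add z_scale a' add.assoc)
    qed
    finally show ?case by (simp add: a'_def mult.assoc)
  qed
  have lim: "(\<lambda>n. exp (K / sqrt (real n)) * (\<Prod>j\<in>J. (\<integral>\<zeta>. f j (z j \<zeta>) \<partial>std_normals I) powr c j))
     \<longlonglongrightarrow> exp 0 * (\<Prod>j\<in>J. (\<integral>\<zeta>. f j (z j \<zeta>) \<partial>std_normals I) powr c j)"
  proof (intro tendsto_mult tendsto_exp tendsto_const)
    show "(\<lambda>n. K / sqrt (real n)) \<longlonglongrightarrow> 0"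
      by (rule real_tendsto_divide_at_top[OF tendsto_const])
         (rule filterlim_compose[OF sqrt_at_top filterlim_real_sequentially])
  qed
  have "(\<integral>\<zeta>. (\<Prod>j\<in>J. f j (z j \<zeta>) powr c j) \<partial>std_normals I) \<le>
      exp 0 * (\<Prod>j\<in>J. (\<integral>\<zeta>. f j (z j \<zeta>) \<partial>std_normals I) powr c j)"
  proof (rule tendsto_lowerbound[OF lim])
    show "\<forall>\<^sub>F n in sequentially. (\<integral>\<zeta>. (\<Prod>j\<in>J. f j (z j \<zeta>) powr c j) \<partial>std_normals I) \<le>
      exp (K / sqrt (real n)) * (\<Prod>j\<in>J. (\<integral>\<zeta>. f j (z j \<zeta>) \<partial>std_normals I) powr c j)"
      using eventually_gt_at_top[of 0]
    proof eventually_elim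
      fix n :: nat assume n: "0 < n"
      \<comment> \<open>The total variance of the steps is 1.\<close>
      define e where "e = 1 / sqrt (real n)"
      have e: "0 < e" "e \<le> 1" "sqrt (real n) * e = 1" using n by (auto simp: e_def)
      have "(1 + K * e ^ 3) ^ n \<le> exp (K * e ^ 3) ^ n"
        using K(1) e by (intro power_mono) auto
      also have "\<dots> = exp (real n * (K * e ^ 3))" by (simp add: exp_of_nat_mult)
      also have "real n * (K * e ^ 3) = K / sqrt (real n)"
        using n by (simp add: e_def power3_eq_cube field_simps)
      finally have le: "(1 + K * e ^ 3) ^ n \<le> exp (K / sqrt (real n))" .
      have "(\<integral>\<zeta>. (\<Prod>j\<in>J. f j (z j \<zeta>) powr c j) \<partial>std_normals I) \<le>
        (1 + K * e ^ 3) ^ n * (\<Prod>j\<in>J. (\<integral>\<zeta>. f j (z j \<zeta>) \<partial>std_normals I) powr c j)"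
        using step[of e f "\<lambda>_. 0" n, OF e(1,2) f] by (simp add: e(3))
      also have "\<dots> \<le> exp (K / sqrt (real n)) * (\<Prod>j\<in>J. (\<integral>\<zeta>. f j (z j \<zeta>) \<partial>std_normals I) powr c j)"
        using le by (intro mult_right_mono prod_nonneg) auto
      finally show "(\<integral>\<zeta>. (\<Prod>j\<in>J. f j (z j \<zeta>) powr c j) \<partial>std_normals I) \<le> \<dots>" .
    qed
  qed simp
  then show ?thesis by (simp add: z_def)
qed

text \<open>The general case is the regular one for \<open>(h\<^sub>j + \<delta>)\<^sup>1\<^sup>/\<^sup>c\<close>, which is bounded away from zero, followed by
\<open>\<delta> \<rightarrow> 0\<close>.\<close>

theorem gaussian_brascamp_lieb:
  fixes B :: "'j \<Rightarrow> 'i \<Rightarrow> real" and M :: real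
  assumes I: "finite I" and J: "finite J"
    and contr: "\<And>\<mu>. (\<Sum>i\<in>I. (\<Sum>j\<in>J. \<mu> j * B j i)\<^sup>2) \<le> (\<Sum>j\<in>J. (\<mu> j)\<^sup>2)"
    and c: "\<And>j. j \<in> J \<Longrightarrow> c j = (\<Sum>i\<in>I. (B j i)\<^sup>2)" "\<And>j. j \<in> J \<Longrightarrow> 0 < c j" "\<And>j. j \<in> J \<Longrightarrow> c j \<le> 1"
    and h: "\<And>j. j \<in> J \<Longrightarrow> quadratic_taylor 0 M (h j)"
  shows "(\<integral>\<zeta>. (\<Prod>j\<in>J. h j (\<Sum>i\<in>I. B j i * \<zeta> i)) \<partial>std_normals I) \<le>
    (\<Prod>j\<in>J. (\<integral>\<zeta>. h j (\<Sum>i\<in>I. B j i * \<zeta> i) powr (1 / c j) \<partial>std_normals I) powr c j)"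
proof -
  interpret prob_space "std_normals I" by simp
  define z where "z j \<zeta> = (\<Sum>i\<in>I. B j i * \<zeta> i)" for j and \<zeta> :: "'i \<Rightarrow> real"
  have z_meas [measurable]: "z j \<in> borel_measurable (std_normals I)" for j
    unfolding z_def by measurable
  have [measurable]: "h j \<in> borel_measurable borel" if "j \<in> J" for j
    using quadratic_taylor_measurable h that by blast
  have bds: "0 \<le> h j x" "h j x \<le> M" if "j \<in> J" for j x
    using quadratic_taylor_bounds h that by blast+
  have shifted: "(\<integral>\<zeta>. (\<Prod>j\<in>J. h j (z j \<zeta>)) \<partial>std_normals I) \<le>
    (\<Prod>j\<in>J. (\<integral>\<zeta>. (h j (z j \<zeta>) + \<delta>) powr (1 / c j) \<partial>std_normals I) powr c j)" if \<delta>: "0 < \<delta>" "\<delta> \<le> 1" for \<delta>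
  proof -
    have "\<exists>d m. 0 < d \<and> quadratic_taylor d m (\<lambda>x. (h j x + \<delta>) powr (1 / c j))" if j: "j \<in> J" for j
    proof -
      obtain h' where "h' \<in> borel_measurable borel"
        "\<And>x k. \<bar>h' x\<bar> \<le> M \<and> \<bar>h j (x + k) - h j x - k * h' x\<bar> \<le> M * k\<^sup>2"
        using h[OF j] by (auto simp: quadratic_taylor_def)
      moreover have "M * k\<^sup>2 \<le> (M + \<delta>) * k\<^sup>2" for k using \<delta> by (intro mult_right_mono) auto
      ultimately have "quadratic_taylor \<delta> (M + \<delta>) (\<lambda>x. h j x + \<delta>)"
        unfolding quadratic_taylor_def using \<delta> bds[OF j] j
        by (auto intro!: bexI[where x = h'] intro: order_trans add_increasing2)
      from quadratic_taylor_powr[OF this \<delta>(1)] show ?thesis by metis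
    qed
    then obtain d m where dm: "\<And>j. j \<in> J \<Longrightarrow> 0 < d j" "\<And>j. j \<in> J \<Longrightarrow> quadratic_taylor (d j) (m j) (\<lambda>x. (h j x + \<delta>) powr (1 / c j))"
      by metis
    define D where "D = Min (insert 1 (d ` J))"
    define M' where "M' = Max (insert 1 (m ` J))"
    have D: "0 < D" "\<And>j. j \<in> J \<Longrightarrow> D \<le> d j" using J dm(1) by (auto simp: D_def)
    have M': "\<And>j. j \<in> J \<Longrightarrow> m j \<le> M'" using J by (auto simp: M'_def)
    have t: "quadratic_taylor D M' (\<lambda>x. (h j x + \<delta>) powr (1 / c j))" if j: "j \<in> J" for j
    proof -
      have "m j * k\<^sup>2 \<le> M' * k\<^sup>2" for k using M'[OF j] by (intro mult_right_mono) auto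
      then show ?thesis
        using dm(2)[OF j] D(2)[OF j] M'[OF j] unfolding quadratic_taylor_def by (meson order_trans)
    qed
    have "(\<integral>\<zeta>. (\<Prod>j\<in>J. h j (z j \<zeta>)) \<partial>std_normals I) \<le>
      (\<integral>\<zeta>. (\<Prod>j\<in>J. ((h j (z j \<zeta>) + \<delta>) powr (1 / c j)) powr c j) \<partial>std_normals I)"
    proof (rule integral_mono)
      have le: "(\<Prod>j\<in>J. h j (z j \<zeta>) + \<delta>) \<le> (\<Prod>j\<in>J. M + \<delta>)" "(\<Prod>j\<in>J. h j (z j \<zeta>)) \<le> (\<Prod>j\<in>J. M)" for \<zeta>
        using bds \<delta> by (auto intro!: prod_mono add_nonneg_nonneg simp del: prod_constant)
      have eq: "(\<Prod>j\<in>J. ((h j (z j \<zeta>) + \<delta>) powr (1 / c j)) powr c j) = (\<Prod>j\<in>J. h j (z j \<zeta>) + \<delta>)" for \<zeta>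
      proof (rule prod.cong[OF refl])
        fix j assume j: "j \<in> J"
        have "0 \<le> h j (z j \<zeta>) + \<delta>" using bds(1)[OF j, of "z j \<zeta>"] \<delta> by linarith
        then show "((h j (z j \<zeta>) + \<delta>) powr (1 / c j)) powr c j = h j (z j \<zeta>) + \<delta>"
          using c(2)[OF j] by (simp add: powr_powr)
      qed
      show "integrable (std_normals I) (\<lambda>\<zeta>. \<Prod>j\<in>J. h j (z j \<zeta>))"
        by (rule integrable_const_bound[where B = "\<Prod>j\<in>J. M"], rule AE_I2)
           (use le bds in \<open>auto simp: prod_nonneg\<close>)
      show "integrable (std_normals I) (\<lambda>\<zeta>. \<Prod>j\<in>J. ((h j (z j \<zeta>) + \<delta>) powr (1 / c j)) powr c j)"
        unfolding eq
      proof (rule integrable_const_bound[where B = "\<Prod>j\<in>J. M + \<delta>"], rule AE_I2)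
        fix \<zeta>
        have "0 \<le> (\<Prod>j\<in>J. h j (z j \<zeta>) + \<delta>)" using bds \<delta> by (intro prod_nonneg add_nonneg_nonneg) auto
        then show "norm (\<Prod>j\<in>J. h j (z j \<zeta>) + \<delta>) \<le> (\<Prod>j\<in>J. M + \<delta>)" using le(1)[of \<zeta>] by simp
      qed measurable
      show "(\<Prod>j\<in>J. h j (z j \<zeta>)) \<le> (\<Prod>j\<in>J. ((h j (z j \<zeta>) + \<delta>) powr (1 / c j)) powr c j)" for \<zeta>
        unfolding eq using bds \<delta> by (intro prod_mono) auto
    qed
    also have "\<dots> \<le> (\<Prod>j\<in>J. (\<integral>\<zeta>. (h j (z j \<zeta>) + \<delta>) powr (1 / c j) \<partial>std_normals I) powr c j)"
      using gaussian_brascamp_lieb_regular[OF I J contr c(1) c(3) D(1) t] by (simp add: z_def)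
    finally show ?thesis .
  qed
  have lim: "(\<lambda>n. \<Prod>j\<in>J. (\<integral>\<zeta>. (h j (z j \<zeta>) + 1 / real (Suc n)) powr (1 / c j) \<partial>std_normals I) powr c j)
     \<longlonglongrightarrow> (\<Prod>j\<in>J. (\<integral>\<zeta>. h j (z j \<zeta>) powr (1 / c j) \<partial>std_normals I) powr c j)"
  proof (intro tendsto_prod tendsto_powr' tendsto_const)
    fix j assume j: "j \<in> J"
    show "(\<lambda>n. \<integral>\<zeta>. (h j (z j \<zeta>) + 1 / real (Suc n)) powr (1 / c j) \<partial>std_normals I)
       \<longlonglongrightarrow> (\<integral>\<zeta>. h j (z j \<zeta>) powr (1 / c j) \<partial>std_normals I)"
    proof (rule integral_dominated_convergence[where w = "\<lambda>_. (M + 1) powr (1 / c j)"])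
      show "AE \<zeta> in std_normals I. (\<lambda>n. (h j (z j \<zeta>) + 1 / real (Suc n)) powr (1 / c j)) \<longlonglongrightarrow> h j (z j \<zeta>) powr (1 / c j)"
      proof (intro AE_I2 tendsto_powr' tendsto_const disjI2)
        fix \<zeta>
        show "(\<lambda>n. h j (z j \<zeta>) + 1 / real (Suc n)) \<longlonglongrightarrow> h j (z j \<zeta>)"
          using tendsto_add[OF tendsto_const LIMSEQ_inverse_real_of_nat, of "h j (z j \<zeta>)"]
          by (simp add: inverse_eq_divide)
      qed (use c(2)[OF j] bds(1)[OF j] in \<open>auto intro!: always_eventually add_nonneg_nonneg\<close>)
      show "AE \<zeta> in std_normals I. norm ((h j (z j \<zeta>) + 1 / real (Suc n)) powr (1 / c j)) \<le> (M + 1) powr (1 / c j)" for n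
      proof (rule AE_I2)
        fix \<zeta>
        show "norm ((h j (z j \<zeta>) + 1 / real (Suc n)) powr (1 / c j)) \<le> (M + 1) powr (1 / c j)"
          using bds[OF j, of "z j \<zeta>"] c(2)[OF j]
          by (auto intro!: powr_mono2 add_mono)
      qed
    qed (use j in auto)
  qed (use c(2) in \<open>auto intro!: always_eventually\<close>)
  have "(\<integral>\<zeta>. (\<Prod>j\<in>J. h j (z j \<zeta>)) \<partial>std_normals I) \<le>
    (\<Prod>j\<in>J. (\<integral>\<zeta>. h j (z j \<zeta>) powr (1 / c j) \<partial>std_normals I) powr c j)"
    by (rule tendsto_lowerbound[OF lim]) (auto intro!: always_eventually shifted)
  then show ?thesis by (simp add: z_def)
qed

section \<open>Fourier duality between a subspace and its orthogonal complement\<close>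

lemma complex_integrable_PiM_prod_bounded:
  fixes f :: "'j \<Rightarrow> real \<Rightarrow> real" and \<theta> :: "'w \<Rightarrow> 'j \<Rightarrow> real"
  assumes J: "finite J" and N: "prob_space N" and f: "\<And>j. j \<in> J \<Longrightarrow> integrable lborel (f j)" 
    and \<theta> [measurable]: "\<And>j. j \<in> J \<Longrightarrow> (\<lambda>w. \<theta> w j) \<in> borel_measurable N"
  shows "integrable (N \<Otimes>\<^sub>M Pi\<^sub>M J (\<lambda>_. lborel)) (\<lambda>(w, S). \<Prod>j\<in>J. complex_of_real (f j (S j)) * iexp (\<theta> w j * S j))"
proof -
  interpret N: prob_space N by fact
  interpret L: product_sigma_finite "\<lambda>_::'j. lborel :: real measure"
    by (simp add: product_sigma_finite_def sigma_finite_lborel)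
  interpret LJ: finite_product_sigma_finite "\<lambda>_::'j. lborel :: real measure" J
    by standard (rule J)
  interpret P: pair_sigma_finite N "Pi\<^sub>M J (\<lambda>_::'j. lborel :: real measure)" ..
  have fm [measurable]: "f j \<in> borel_measurable borel" if "j \<in> J" for j
    using borel_measurable_integrable[OF f[OF that]] by simp
  have intf: "integrable (Pi\<^sub>M J (\<lambda>_. lborel)) (\<lambda>S. \<Prod>j\<in>J. \<bar>f j (S j)\<bar>)"
    using f by (intro L.product_integrable_prod J) auto
  have eq: "norm (\<Prod>j\<in>J. complex_of_real (f j (S j)) * iexp (\<theta> w j * S j)) = (\<Prod>j\<in>J. \<bar>f j (S j)\<bar>)" for w S
    by (simp add: prod_norm[symmetric] norm_mult)
  show ?thesis
  proof (rule P.Fubini_integrable)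
    show "(\<lambda>(w, S). \<Prod>j\<in>J. complex_of_real (f j (S j)) * iexp (\<theta> w j * S j)) \<in> borel_measurable (N \<Otimes>\<^sub>M Pi\<^sub>M J (\<lambda>_. lborel))"
      by measurable
    show "integrable N (\<lambda>w. LINT S|Pi\<^sub>M J (\<lambda>_. lborel). norm (case (w, S) of (w, S) \<Rightarrow> \<Prod>j\<in>J. complex_of_real (f j (S j)) * iexp (\<theta> w j * S j)))"
      unfolding case_prod_conv eq by simp
    show "AE w in N. integrable (Pi\<^sub>M J (\<lambda>_. lborel)) (\<lambda>S. case (w, S) of (w, S) \<Rightarrow> \<Prod>j\<in>J. complex_of_real (f j (S j)) * iexp (\<theta> w j * S j))"
    proof (rule AE_I2)
      fix w assume "w \<in> space N"
      have "integrable (Pi\<^sub>M J (\<lambda>_. lborel)) (\<lambda>S. \<Prod>j\<in>J. complex_of_real (f j (S j)) * iexp (\<theta> w j * S j))"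
        by (rule Bochner_Integration.integrable_bound[OF intf]) (measurable, rule AE_I2, unfold eq, simp add: abs_prod)
      then show "integrable (Pi\<^sub>M J (\<lambda>_. lborel)) (\<lambda>S. case (w, S) of (w, S) \<Rightarrow> \<Prod>j\<in>J. complex_of_real (f j (S j)) * iexp (\<theta> w j * S j))"
        by simp
    qed
  qed
qed

text \<open>Write each \<open>g\<^sub>j\<close> as the Fourier integral of \<open>f\<^sub>j\<close> and take the Gaussian average first: it is the
characteristic function of a linear form.\<close>

lemma gaussian_average_of_fourier_product:
  fixes f g :: "'j \<Rightarrow> real \<Rightarrow> real" and B :: "'j \<Rightarrow> 'i \<Rightarrow> real"
  assumes J: "finite J" and I: "finite I" and f: "\<And>j. j \<in> J \<Longrightarrow> integrable lborel (f j)" 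
    and g: "\<And>j t. j \<in> J \<Longrightarrow> complex_of_real (g j t) = (CLINT s|lborel. complex_of_real (f j s) * iexp (t * s))"
  shows "(\<integral>\<zeta>. (\<Prod>j\<in>J. g j (\<Sum>i\<in>I. B j i * \<zeta> i)) \<partial>std_normals I) =
     (\<integral>S. (\<Prod>j\<in>J. f j (S j)) * exp (- (\<Sum>i\<in>I. (\<Sum>j\<in>J. B j i * S j)\<^sup>2) / 2) \<partial>Pi\<^sub>M J (\<lambda>_. lborel))"
proof -
  interpret N: prob_space "std_normals I" by simp
  interpret L: product_sigma_finite "\<lambda>_::'j. lborel :: real measure"
    by (simp add: product_sigma_finite_def sigma_finite_lborel)
  interpret LJ: finite_product_sigma_finite "\<lambda>_::'j. lborel :: real measure" J
    by standard (rule J)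
  interpret P: pair_sigma_finite "std_normals I" "Pi\<^sub>M J (\<lambda>_::'j. lborel :: real measure)" ..
  define z where "z \<zeta> j = (\<Sum>i\<in>I. B j i * \<zeta> i)" for j and \<zeta> :: "'i \<Rightarrow> real"
  have z_meas [measurable]: "(\<lambda>\<zeta>. z \<zeta> j) \<in> borel_measurable (std_normals I)" for j
    unfolding z_def by measurable
  have fm [measurable]: "f j \<in> borel_measurable borel" if "j \<in> J" for j
    using borel_measurable_integrable[OF f[OF that]] by simp
  have fi: "integrable lborel (\<lambda>s. complex_of_real (f j s) * iexp (t * s))" if "j \<in> J" for j t
    by (rule Bochner_Integration.integrable_bound[OF f[OF that]]) (use that in \<open>auto simp: norm_mult\<close>)
  have "complex_of_real (\<integral>\<zeta>. (\<Prod>j\<in>J. g j (z \<zeta> j)) \<partial>std_normals I) 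
     = (CLINT \<zeta>|std_normals I. \<Prod>j\<in>J. complex_of_real (g j (z \<zeta> j)))"
    by (simp flip: of_real_prod)
  also have "\<dots> = (CLINT \<zeta>|std_normals I. \<Prod>j\<in>J. CLINT s|lborel. complex_of_real (f j s) * iexp (z \<zeta> j * s))"
    using g by (intro Bochner_Integration.integral_cong prod.cong refl) simp
  also have "\<dots> = (CLINT \<zeta>|std_normals I. CLINT S|Pi\<^sub>M J (\<lambda>_. lborel). \<Prod>j\<in>J. complex_of_real (f j (S j)) * iexp (z \<zeta> j * S j))"
    by (intro Bochner_Integration.integral_cong refl L.product_integral_prod[symmetric] J fi)
  also have "\<dots> = (CLINT S|Pi\<^sub>M J (\<lambda>_. lborel). CLINT \<zeta>|std_normals I. \<Prod>j\<in>J. complex_of_real (f j (S j)) * iexp (z \<zeta> j * S j))"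
    by (rule P.Fubini_integral[symmetric])
       (rule complex_integrable_PiM_prod_bounded[OF J prob_space_std_normals f z_meas])
  also have "\<dots> = (CLINT S|Pi\<^sub>M J (\<lambda>_. lborel). complex_of_real ((\<Prod>j\<in>J. f j (S j)) * exp (- (\<Sum>i\<in>I. (\<Sum>j\<in>J. B j i * S j)\<^sup>2) / 2)))"
  proof (intro Bochner_Integration.integral_cong refl)
    fix S :: "'j \<Rightarrow> real"
    have "(\<Prod>j\<in>J. complex_of_real (f j (S j)) * iexp (z \<zeta> j * S j)) =
       complex_of_real (\<Prod>j\<in>J. f j (S j)) * iexp (\<Sum>i\<in>I. (\<Sum>j\<in>J. B j i * S j) * \<zeta> i)" for \<zeta>
    proof -
      have "(\<Sum>j\<in>J. z \<zeta> j * S j) = (\<Sum>i\<in>I. (\<Sum>j\<in>J. B j i * S j) * \<zeta> i)"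
        unfolding z_def sum_distrib_right by (subst sum.swap) (simp add: mult_ac)
      moreover have "(\<Prod>j\<in>J. iexp (z \<zeta> j * S j)) = iexp (\<Sum>j\<in>J. z \<zeta> j * S j)"
        using J by (simp add: exp_sum sum_distrib_left)
      ultimately show ?thesis by (simp add: prod.distrib)
    qed
    then have "(CLINT \<zeta>|std_normals I. \<Prod>j\<in>J. complex_of_real (f j (S j)) * iexp (z \<zeta> j * S j)) =
      (CLINT \<zeta>|std_normals I. complex_of_real (\<Prod>j\<in>J. f j (S j)) * iexp (\<Sum>i\<in>I. (\<Sum>j\<in>J. B j i * S j) * \<zeta> i))"
      by simp
    also have "\<dots> = complex_of_real (\<Prod>j\<in>J. f j (S j)) * (CLINT \<zeta>|std_normals I. iexp (\<Sum>i\<in>I. (\<Sum>j\<in>J. B j i * S j) * \<zeta> i))"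
      by (rule integral_mult_right_zero)
    also have "\<dots> = complex_of_real ((\<Prod>j\<in>J. f j (S j)) * exp (- (\<Sum>i\<in>I. (\<Sum>j\<in>J. B j i * S j)\<^sup>2) / 2))"
      unfolding char_linear_form[OF I] of_real_mult ..
    finally show "(CLINT \<zeta>|std_normals I. \<Prod>j\<in>J. complex_of_real (f j (S j)) * iexp (z \<zeta> j * S j)) = \<dots>" .
  qed
  also have "\<dots> = complex_of_real (\<integral>S. (\<Prod>j\<in>J. f j (S j)) * exp (- (\<Sum>i\<in>I. (\<Sum>j\<in>J. B j i * S j)\<^sup>2) / 2) \<partial>Pi\<^sub>M J (\<lambda>_. lborel))"
    by (rule integral_complex_of_real)
  finally show ?thesis unfolding z_def of_real_eq_iff .
qed

text \<open>Here the columns of \<open>a\<close> are an orthonormal basis of a subspace \<open>E\<close> of \<open>\<real>\<^sup>J\<close>, and \<open>B\<close> satisfies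
\<open>B B\<^sup>T = 1 - a a\<^sup>T\<close>, so that it maps a standard Gaussian to one on \<open>E\<^sup>\<bottom>\<close>. The average of the transforms is the
integral of \<open>\<Prod>\<^sub>j f\<^sub>j S\<^sub>j\<close> against \<open>exp (- T |B\<^sup>T S|\<^sup>2 / 2)\<close>, where \<open>|B\<^sup>T S|\<close> is the distance of \<open>S\<close> from
\<open>E\<close>. By Pythagoras, this Gaussian in the distance from \<open>E\<close> is the integral over all points \<open>a x\<close> of
\<open>E\<close> of a Gaussian in \<open>S - a x\<close>, and the latter factors over the coordinates \<open>j\<close>.\<close>

lemma gaussian_duality:
  fixes f g :: "'j \<Rightarrow> real \<Rightarrow> real" and a :: "'j \<Rightarrow> 'b \<Rightarrow> real" and B :: "'j \<Rightarrow> 'i \<Rightarrow> real"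
  assumes fin: "finite J" "finite K" "finite I" and card: "card J = card K + card I"
    and orth: "\<And>b b'. b \<in> K \<Longrightarrow> b' \<in> K \<Longrightarrow> (\<Sum>j\<in>J. a j b * a j b') = (if b = b' then 1 else 0)"
    and compl: "\<And>j j'. j \<in> J \<Longrightarrow> j' \<in> J \<Longrightarrow> (\<Sum>i\<in>I. B j i * B j' i) = (if j = j' then 1 else 0) - (\<Sum>b\<in>K. a j b * a j' b)"
    and f: "\<And>j. j \<in> J \<Longrightarrow> integrable lborel (f j)" "\<And>j s. j \<in> J \<Longrightarrow> 0 \<le> f j s"
    and g: "\<And>j t. j \<in> J \<Longrightarrow> complex_of_real (g j t) = (CLINT s|lborel. complex_of_real (f j s) * iexp (t * s))"
    and T: "0 < T"
  shows "ennreal (sqrt (T / (2 * pi)) ^ card I * (\<integral>\<zeta>. (\<Prod>j\<in>J. g j (sqrt T * (\<Sum>i\<in>I. B j i * \<zeta> i))) \<partial>std_normals I)) =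
    (\<integral>\<^sup>+x. (\<Prod>j\<in>J. \<integral>\<^sup>+s. ennreal (f j s * normal_density (\<Sum>b\<in>K. a j b * x b) (1 / sqrt T) s) \<partial>lborel) \<partial>Pi\<^sub>M K (\<lambda>_. lborel))"
proof -
  interpret L: product_sigma_finite "\<lambda>_::'j. lborel :: real measure"
    by (simp add: product_sigma_finite_def sigma_finite_lborel)
  interpret LJ: finite_product_sigma_finite "\<lambda>_::'j. lborel :: real measure" J
    by standard (rule fin)
  interpret LB: product_sigma_finite "\<lambda>_::'b. lborel :: real measure"
    by (simp add: product_sigma_finite_def sigma_finite_lborel)
  interpret LK: finite_product_sigma_finite "\<lambda>_::'b. lborel :: real measure" K
    by standard (rule fin)
  interpret P: pair_sigma_finite "Pi\<^sub>M J (\<lambda>_::'j. lborel :: real measure)" "Pi\<^sub>M K (\<lambda>_::'b. lborel :: real measure)" ..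
  let ?r = "sqrt (T / (2 * pi))"
  have r0: "0 < ?r" using T by simp
  have fm [measurable]: "f j \<in> borel_measurable borel" if "j \<in> J" for j
    using borel_measurable_integrable[OF f(1)[OF that]] by simp
  have nd: "normal_density \<mu> (1 / sqrt T) s = ?r * exp (- T * (s - \<mu>)\<^sup>2 / 2)" for \<mu> s
    using T by (simp add: normal_density_def real_sqrt_divide power_divide field_simps)
  define q where "q S = (\<Sum>i\<in>I. (\<Sum>j\<in>J. B j i * S j)\<^sup>2)" for S
  have q0: "0 \<le> q S" for S by (simp add: q_def sum_nonneg)
  have qm [measurable]: "q \<in> borel_measurable (Pi\<^sub>M J (\<lambda>_. lborel))"
    unfolding q_def by measurable
  define y where "y S b = (\<Sum>j\<in>J. a j b * S j)" for S b
  define s where "s x j = (\<Sum>b\<in>K. a j b * x b)" for x j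
  have sm [measurable]: "(\<lambda>x. s x j) \<in> borel_measurable (Pi\<^sub>M K (\<lambda>_. lborel))" for j
    unfolding s_def by measurable
  have q_eq: "q S = (\<Sum>j\<in>J. (S j)\<^sup>2) - (\<Sum>b\<in>K. (y S b)\<^sup>2)" for S
  proof -
    have "q S = (\<Sum>i\<in>I. \<Sum>j\<in>J. \<Sum>j'\<in>J. (B j i * S j) * (B j' i * S j'))"
      by (simp add: q_def power2_eq_square sum_product)
    also have "\<dots> = (\<Sum>j\<in>J. \<Sum>j'\<in>J. \<Sum>i\<in>I. (B j i * S j) * (B j' i * S j'))"
      by (subst sum.swap, intro sum.cong refl, subst sum.swap, rule refl)
    also have "\<dots> = (\<Sum>j\<in>J. \<Sum>j'\<in>J. (S j * S j') * (\<Sum>i\<in>I. B j i * B j' i))"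
      by (simp add: sum_distrib_left mult_ac)
    also have "\<dots> = (\<Sum>j\<in>J. \<Sum>j'\<in>J. (if j = j' then S j * S j' else 0) - (\<Sum>b\<in>K. (a j b * S j) * (a j' b * S j')))"
      by (intro sum.cong refl) (auto simp: compl algebra_simps sum_distrib_left)
    also have "\<dots> = (\<Sum>j\<in>J. (S j)\<^sup>2) - (\<Sum>j\<in>J. \<Sum>j'\<in>J. \<Sum>b\<in>K. (a j b * S j) * (a j' b * S j'))"
      using fin by (simp add: sum_subtractf power2_eq_square)
    also have "(\<Sum>j\<in>J. \<Sum>j'\<in>J. \<Sum>b\<in>K. (a j b * S j) * (a j' b * S j')) = (\<Sum>b\<in>K. \<Sum>j\<in>J. \<Sum>j'\<in>J. (a j b * S j) * (a j' b * S j'))"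
      by (subst (2) sum.swap, subst sum.swap, rule refl)
    also have "\<dots> = (\<Sum>b\<in>K. (y S b)\<^sup>2)"
      by (simp add: y_def power2_eq_square sum_product)
    finally show ?thesis .
  qed
  have s_sq: "(\<Sum>j\<in>J. (s x j)\<^sup>2) = (\<Sum>b\<in>K. (x b)\<^sup>2)" for x
  proof -
    have "(\<Sum>j\<in>J. (s x j)\<^sup>2) = (\<Sum>j\<in>J. \<Sum>b\<in>K. \<Sum>b'\<in>K. (a j b * x b) * (a j b' * x b'))"
      by (simp add: s_def power2_eq_square sum_product)
    also have "\<dots> = (\<Sum>b\<in>K. \<Sum>b'\<in>K. \<Sum>j\<in>J. (a j b * x b) * (a j b' * x b'))"
      by (subst sum.swap, intro sum.cong refl, subst sum.swap, rule refl)
    also have "\<dots> = (\<Sum>b\<in>K. \<Sum>b'\<in>K. (x b * x b') * (\<Sum>j\<in>J. a j b * a j b'))"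
      by (simp add: sum_distrib_left mult_ac)
    also have "\<dots> = (\<Sum>b\<in>K. \<Sum>b'\<in>K. if b = b' then x b * x b' else 0)"
      by (intro sum.cong refl) (auto simp: orth)
    also have "\<dots> = (\<Sum>b\<in>K. (x b)\<^sup>2)"
      using fin by (simp add: power2_eq_square)
    finally show ?thesis .
  qed
  have sy: "(\<Sum>j\<in>J. S j * s x j) = (\<Sum>b\<in>K. x b * y S b)" for S x
    unfolding s_def y_def sum_distrib_left by (subst sum.swap) (simp add: mult_ac)
  \<comment> \<open>Pythagoras: \<open>q S\<close> is the squared distance from the subspace, and \<open>y S\<close> are the coordinates of the
    projection to it.\<close>
  have square: "(\<Sum>j\<in>J. (S j - s x j)\<^sup>2) = q S + (\<Sum>b\<in>K. (x b - y S b)\<^sup>2)" for S x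
  proof -
    have "(\<Sum>j\<in>J. (S j - s x j)\<^sup>2) = (\<Sum>j\<in>J. (S j)\<^sup>2) + (\<Sum>j\<in>J. (s x j)\<^sup>2) - 2 * (\<Sum>j\<in>J. S j * s x j)"
      by (simp add: power2_diff sum.distrib sum_subtractf sum_distrib_left mult.assoc)
    also have "\<dots> = q S + (\<Sum>b\<in>K. (y S b)\<^sup>2) + (\<Sum>b\<in>K. (x b)\<^sup>2) - 2 * (\<Sum>b\<in>K. x b * y S b)"
      by (simp add: q_eq s_sq sy)
    also have "\<dots> = q S + (\<Sum>b\<in>K. (x b - y S b)\<^sup>2)"
      by (simp add: power2_diff sum.distrib sum_subtractf sum_distrib_left mult.assoc)
    finally show ?thesis .
  qed
  have prod_nd: "(\<Prod>j\<in>J. normal_density (s x j) (1 / sqrt T) (S j)) =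
     ?r ^ card I * exp (- T * q S / 2) * (\<Prod>b\<in>K. normal_density (y S b) (1 / sqrt T) (x b))" for x S
  proof -
    have "(\<Prod>j\<in>J. normal_density (s x j) (1 / sqrt T) (S j)) = ?r ^ card J * exp (- T * (\<Sum>j\<in>J. (S j - s x j)\<^sup>2) / 2)"
      using fin by (simp add: nd prod.distrib exp_sum[symmetric] sum_distrib_left sum_divide_distrib sum_negf)
    also have "\<dots> = ?r ^ card I * exp (- T * q S / 2) * (?r ^ card K * exp (- T * (\<Sum>b\<in>K. (x b - y S b)\<^sup>2) / 2))"
    proof -
      have "- T * (\<Sum>j\<in>J. (S j - s x j)\<^sup>2) / 2 = - T * q S / 2 + - T * (\<Sum>b\<in>K. (x b - y S b)\<^sup>2) / 2"
        unfolding square by (simp add: algebra_simps add_divide_distrib diff_divide_distrib)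
      then show ?thesis by (simp only: exp_add card power_add mult_ac)
    qed
    also have "?r ^ card K * exp (- T * (\<Sum>b\<in>K. (x b - y S b)\<^sup>2) / 2) = (\<Prod>b\<in>K. normal_density (y S b) (1 / sqrt T) (x b))"
      using fin by (simp add: nd prod.distrib exp_sum[symmetric] sum_distrib_left sum_divide_distrib sum_negf)
    finally show ?thesis .
  qed
  have mass: "(\<integral>\<^sup>+x. ennreal (\<Prod>b\<in>K. normal_density (y S b) (1 / sqrt T) (x b)) \<partial>Pi\<^sub>M K (\<lambda>_. lborel)) = 1" for S
  proof -
    have "(\<integral>\<^sup>+x. ennreal (\<Prod>b\<in>K. normal_density (y S b) (1 / sqrt T) (x b)) \<partial>Pi\<^sub>M K (\<lambda>_. lborel)) =
      (\<integral>\<^sup>+x. (\<Prod>b\<in>K. ennreal (normal_density (y S b) (1 / sqrt T) (x b))) \<partial>Pi\<^sub>M K (\<lambda>_. lborel))"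
      by (simp add: prod_ennreal)
    also have "\<dots> = (\<Prod>b\<in>K. \<integral>\<^sup>+x. ennreal (normal_density (y S b) (1 / sqrt T) x) \<partial>lborel)"
      by (rule LB.product_nn_integral_prod[OF fin(2)]) measurable
    also have "\<dots> = 1"
      using T by (intro prod.neutral ballI) (simp add: nn_integral_eq_integral)
    finally show ?thesis .
  qed
  have intf: "integrable (Pi\<^sub>M J (\<lambda>_. lborel)) (\<lambda>S. \<Prod>j\<in>J. f j (S j))"
    using f by (intro L.product_integrable_prod fin) auto
  have int: "integrable (Pi\<^sub>M J (\<lambda>_. lborel)) (\<lambda>S. (\<Prod>j\<in>J. f j (S j)) * exp (- T * q S / 2))"
    by (rule Bochner_Integration.integrable_bound[OF intf])
       (use f T q0 in \<open>auto intro!: AE_I2 mult_left_le simp: abs_mult prod_nonneg\<close>)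
  have "(\<integral>\<zeta>. (\<Prod>j\<in>J. g j (sqrt T * (\<Sum>i\<in>I. B j i * \<zeta> i))) \<partial>std_normals I) =
     (\<integral>\<zeta>. (\<Prod>j\<in>J. g j (\<Sum>i\<in>I. (sqrt T * B j i) * \<zeta> i)) \<partial>std_normals I)"
    by (simp add: sum_distrib_left mult.assoc)
  also have "\<dots> = (\<integral>S. (\<Prod>j\<in>J. f j (S j)) * exp (- (\<Sum>i\<in>I. (\<Sum>j\<in>J. (sqrt T * B j i) * S j)\<^sup>2) / 2) \<partial>Pi\<^sub>M J (\<lambda>_. lborel))"
    by (rule gaussian_average_of_fourier_product[OF fin(1,3) f(1) g])
  also have "\<dots> = (\<integral>S. (\<Prod>j\<in>J. f j (S j)) * exp (- T * q S / 2) \<partial>Pi\<^sub>M J (\<lambda>_. lborel))"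
    using T by (simp add: q_def mult.assoc sum_distrib_left[symmetric] power_mult_distrib)
  finally have E: "(\<integral>\<zeta>. (\<Prod>j\<in>J. g j (sqrt T * (\<Sum>i\<in>I. B j i * \<zeta> i))) \<partial>std_normals I) = \<dots>" .
  have "ennreal (?r ^ card I * (\<integral>\<zeta>. (\<Prod>j\<in>J. g j (sqrt T * (\<Sum>i\<in>I. B j i * \<zeta> i))) \<partial>std_normals I)) =
     ennreal (?r ^ card I) * (\<integral>\<^sup>+S. ennreal ((\<Prod>j\<in>J. f j (S j)) * exp (- T * q S / 2)) \<partial>Pi\<^sub>M J (\<lambda>_. lborel))"
  proof -
    have "(\<integral>\<^sup>+S. ennreal ((\<Prod>j\<in>J. f j (S j)) * exp (- T * q S / 2)) \<partial>Pi\<^sub>M J (\<lambda>_. lborel)) =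
      ennreal (\<integral>S. (\<Prod>j\<in>J. f j (S j)) * exp (- T * q S / 2) \<partial>Pi\<^sub>M J (\<lambda>_. lborel))"
      using f by (intro nn_integral_eq_integral[OF int] AE_I2 mult_nonneg_nonneg prod_nonneg) auto
    then show ?thesis unfolding E using r0 by (simp add: ennreal_mult')
  qed
  also have "\<dots> = (\<integral>\<^sup>+S. ennreal (?r ^ card I) * ennreal ((\<Prod>j\<in>J. f j (S j)) * exp (- T * q S / 2)) \<partial>Pi\<^sub>M J (\<lambda>_. lborel))"
    by (rule nn_integral_cmult[symmetric]) measurable
  also have "\<dots> = (\<integral>\<^sup>+S. \<integral>\<^sup>+x. ennreal (\<Prod>j\<in>J. f j (S j) * normal_density (s x j) (1 / sqrt T) (S j)) \<partial>Pi\<^sub>M K (\<lambda>_. lborel) \<partial>Pi\<^sub>M J (\<lambda>_. lborel))"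
  proof (rule nn_integral_cong)
    fix S :: "'j \<Rightarrow> real"
    have "(\<integral>\<^sup>+x. ennreal (\<Prod>j\<in>J. f j (S j) * normal_density (s x j) (1 / sqrt T) (S j)) \<partial>Pi\<^sub>M K (\<lambda>_. lborel)) =
      (\<integral>\<^sup>+x. ennreal ((\<Prod>j\<in>J. f j (S j)) * (?r ^ card I * exp (- T * q S / 2))) * ennreal (\<Prod>b\<in>K. normal_density (y S b) (1 / sqrt T) (x b)) \<partial>Pi\<^sub>M K (\<lambda>_. lborel))"
      unfolding prod.distrib prod_nd using f r0
      by (intro nn_integral_cong) (simp add: ennreal_mult[symmetric] prod_nonneg mult.assoc)
    also have "\<dots> = ennreal ((\<Prod>j\<in>J. f j (S j)) * (?r ^ card I * exp (- T * q S / 2)))"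
      by (subst nn_integral_cmult) (measurable, simp add: mass)
    also have "\<dots> = ennreal (?r ^ card I) * ennreal ((\<Prod>j\<in>J. f j (S j)) * exp (- T * q S / 2))"
      using f r0 by (simp add: ennreal_mult[symmetric] prod_nonneg mult_ac)
    finally show "ennreal (?r ^ card I) * ennreal ((\<Prod>j\<in>J. f j (S j)) * exp (- T * q S / 2)) =
      (\<integral>\<^sup>+x. ennreal (\<Prod>j\<in>J. f j (S j) * normal_density (s x j) (1 / sqrt T) (S j)) \<partial>Pi\<^sub>M K (\<lambda>_. lborel))" ..
  qed
  also have "\<dots> = (\<integral>\<^sup>+x. \<integral>\<^sup>+S. ennreal (\<Prod>j\<in>J. f j (S j) * normal_density (s x j) (1 / sqrt T) (S j)) \<partial>Pi\<^sub>M J (\<lambda>_. lborel) \<partial>Pi\<^sub>M K (\<lambda>_. lborel))"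
    by (rule P.Fubini'[symmetric]) (unfold normal_density_def, measurable)
  also have "\<dots> = (\<integral>\<^sup>+x. (\<Prod>j\<in>J. \<integral>\<^sup>+t. ennreal (f j t * normal_density (s x j) (1 / sqrt T) t) \<partial>lborel) \<partial>Pi\<^sub>M K (\<lambda>_. lborel))"
  proof (rule nn_integral_cong)
    fix x :: "'b \<Rightarrow> real"
    have "(\<integral>\<^sup>+S. ennreal (\<Prod>j\<in>J. f j (S j) * normal_density (s x j) (1 / sqrt T) (S j)) \<partial>Pi\<^sub>M J (\<lambda>_. lborel)) =
       (\<integral>\<^sup>+S. (\<Prod>j\<in>J. ennreal (f j (S j) * normal_density (s x j) (1 / sqrt T) (S j))) \<partial>Pi\<^sub>M J (\<lambda>_. lborel))"
      using f by (simp add: prod_ennreal)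
    also have "\<dots> = (\<Prod>j\<in>J. \<integral>\<^sup>+t. ennreal (f j t * normal_density (s x j) (1 / sqrt T) t) \<partial>lborel)"
      by (rule L.product_nn_integral_prod[OF fin(1)]) measurable
    finally show "(\<integral>\<^sup>+S. ennreal (\<Prod>j\<in>J. f j (S j) * normal_density (s x j) (1 / sqrt T) (S j)) \<partial>Pi\<^sub>M J (\<lambda>_. lborel)) = \<dots>" .
  qed
  finally show ?thesis by (simp add: s_def)
qed

section \<open>Volumes as integrals of exponentials\<close>

lemma sigma_finite_lborel_family: "product_sigma_finite (\<lambda>_::'i. lborel :: real measure)"
  by (simp add: product_sigma_finite_def sigma_finite_lborel)

lemma nn_integral_exp_tail:
  assumes "0 \<le> u"
  shows "(\<integral>\<^sup>+t. ennreal (exp (- t)) * indicator {u..} t \<partial>lborel) = ennreal (exp (- u))"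
proof -
  have "(\<integral>\<^sup>+t. ennreal (exp (- t)) * indicator {u..} t \<partial>lborel) = ennreal (0 - (- exp (- u)))"
  proof (rule nn_integral_FTC_atLeast)
    show "((\<lambda>t::real. - exp (- t)) \<longlongrightarrow> 0) at_top"
      by real_asymp
  qed (auto intro!: derivative_eq_intros)
  then show ?thesis by simp
qed

lemma emeasure_sublevel_scale:
  fixes N :: "('i \<Rightarrow> real) \<Rightarrow> real"
  assumes I: "finite I" and [measurable]: "N \<in> borel_measurable (Pi\<^sub>M I (\<lambda>_. lborel))"
    and hom: "\<And>r x. 0 < r \<Longrightarrow> N (\<lambda>i\<in>I. r * x i) = r * N x" and r: "0 < r"
  shows "emeasure (Pi\<^sub>M I (\<lambda>_. lborel)) {x \<in> space (Pi\<^sub>M I (\<lambda>_. lborel)). N x \<le> r} =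
    ennreal (r ^ card I) * emeasure (Pi\<^sub>M I (\<lambda>_. lborel)) {x \<in> space (Pi\<^sub>M I (\<lambda>_. lborel)). N x \<le> 1}"
proof -
  let ?L = "Pi\<^sub>M I (\<lambda>_. lborel :: real measure)"
  let ?G = "\<lambda>x. indicator {x \<in> space ?L. N x \<le> r} x :: ennreal"
  have "emeasure ?L {x \<in> space ?L. N x \<le> r} = (\<integral>\<^sup>+x. ?G x \<partial>?L)"
    by simp
  also have "\<dots> = (\<integral>\<^sup>+x. (\<Prod>i\<in>I. ennreal r) * ?G (\<lambda>i\<in>I. r * x i) \<partial>?L)"
  proof (rule nn_integral_PiM_substitute[where w = "\<lambda>_. ennreal r"])
    show "(\<integral>\<^sup>+t. g t \<partial>lborel) = (\<integral>\<^sup>+t. ennreal r * g (r * t) \<partial>lborel)" if "g \<in> borel_measurable borel" for g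
      using nn_integral_real_affine[OF that, of r 0] r that by (simp add: nn_integral_cmult)
  qed (auto simp: sigma_finite_lborel I)
  also have "\<dots> = (\<integral>\<^sup>+x. ennreal (r ^ card I) * indicator {x \<in> space ?L. N x \<le> 1} x \<partial>?L)"
    using r by (intro nn_integral_cong) (auto simp: hom ennreal_power indicator_def space_PiM)
  also have "\<dots> = ennreal (r ^ card I) * emeasure ?L {x \<in> space ?L. N x \<le> 1}"
    by (simp add: nn_integral_cmult)
  finally show ?thesis .
qed

text \<open>Layer-cake: write \<open>exp (- u)\<close> as the integral of \<open>exp (- t)\<close> over \<open>t \<ge> u\<close>. The set \<open>N\<^sup>p \<le> t\<close> is the unit
ball dilated by \<open>t\<^sup>1\<^sup>/\<^sup>p\<close>, so a Gamma integral remains.\<close>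

lemma nn_integral_exp_neg_gauge_powr:
  fixes N :: "('i \<Rightarrow> real) \<Rightarrow> real"
  assumes I: "finite I" and [measurable]: "N \<in> borel_measurable (Pi\<^sub>M I (\<lambda>_. lborel))"
    and hom: "\<And>r x. 0 < r \<Longrightarrow> N (\<lambda>i\<in>I. r * x i) = r * N x" and nonneg: "\<And>x. 0 \<le> N x" and p: "0 < p"
  shows "(\<integral>\<^sup>+x. ennreal (exp (- (N x powr p))) \<partial>Pi\<^sub>M I (\<lambda>_. lborel)) =
    ennreal (Gamma (1 + real (card I) / p)) * emeasure (Pi\<^sub>M I (\<lambda>_. lborel)) {x \<in> space (Pi\<^sub>M I (\<lambda>_. lborel)). N x \<le> 1}"
proof -
  let ?L = "Pi\<^sub>M I (\<lambda>_. lborel :: real measure)"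
  interpret product_sigma_finite "\<lambda>_::'i. lborel :: real measure" by (rule sigma_finite_lborel_family)
  interpret finite_product_sigma_finite "\<lambda>_::'i. lborel :: real measure" I by standard (rule I)
  interpret pair_sigma_finite ?L "lborel :: real measure" ..
  let ?V = "emeasure ?L {x \<in> space ?L. N x \<le> 1}"
  have "(\<integral>\<^sup>+x. ennreal (exp (- (N x powr p))) \<partial>?L) = 
     (\<integral>\<^sup>+x. \<integral>\<^sup>+t. ennreal (exp (- t)) * indicator {(x, t). N x powr p \<le> t} (x, t) \<partial>lborel \<partial>?L)"
    by (subst nn_integral_exp_tail[symmetric]) (auto intro!: nn_integral_cong simp: indicator_def)
  also have "\<dots> = (\<integral>\<^sup>+t. \<integral>\<^sup>+x. ennreal (exp (- t)) * indicator {(x, t). N x powr p \<le> t} (x, t) \<partial>?L \<partial>lborel)"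
    by (rule Fubini'[symmetric]) (simp add: indicator_def, measurable)
  also have "\<dots> = (\<integral>\<^sup>+t. ennreal (indicator {0..} t * t powr ((1 + real (card I) / p) - 1) / exp t) * ?V \<partial>lborel)"
  proof (rule nn_integral_cong_AE)
    have "AE t in lborel. t \<noteq> (0::real)" by (rule AE_lborel_singleton)
    then show "AE t in lborel. (\<integral>\<^sup>+x. ennreal (exp (- t)) * indicator {(x, t). N x powr p \<le> t} (x, t) \<partial>?L) =
      ennreal (indicator {0..} t * t powr ((1 + real (card I) / p) - 1) / exp t) * ?V"
    proof eventually_elim
      fix t :: real assume "t \<noteq> 0"
      have "(\<integral>\<^sup>+x. ennreal (exp (- t)) * indicator {(x, t). N x powr p \<le> t} (x, t) \<partial>?L) =
         (\<integral>\<^sup>+x. ennreal (exp (- t)) * indicator {x \<in> space ?L. N x powr p \<le> t} x \<partial>?L)"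
        by (intro nn_integral_cong) (auto simp: indicator_def)
      also have "\<dots> = ennreal (exp (- t)) * emeasure ?L {x \<in> space ?L. N x powr p \<le> t}"
        by (subst nn_integral_cmult) simp_all
      also have "\<dots> = ennreal (indicator {0..} t * t powr ((1 + real (card I) / p) - 1) / exp t) * ?V"
      proof (cases "0 < t")
        case True
        have "N x powr p \<le> t \<longleftrightarrow> N x \<le> t powr (1 / p)" for x
        proof
          assume "N x powr p \<le> t"
          then have "(N x powr p) powr (1 / p) \<le> t powr (1 / p)" using p by (intro powr_mono2) auto
          then show "N x \<le> t powr (1 / p)" using p nonneg[of x] by (simp add: powr_powr)
        next
          assume "N x \<le> t powr (1 / p)"
          then have "N x powr p \<le> (t powr (1 / p)) powr p" using p nonneg[of x] by (intro powr_mono2) auto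
          then show "N x powr p \<le> t" using p True by (simp add: powr_powr)
        qed
        then have "emeasure ?L {x \<in> space ?L. N x powr p \<le> t} = ennreal ((t powr (1 / p)) ^ card I) * ?V"
          using emeasure_sublevel_scale[OF I _ hom, of "t powr (1 / p)"] True by simp
        moreover have "(t powr (1 / p)) ^ card I = t powr (real (card I) / p)"
          using True by (simp add: powr_powr flip: powr_realpow)
        ultimately show ?thesis
          using True by (simp add: mult.assoc[symmetric] ennreal_mult[symmetric] exp_minus field_simps)
      next
        case False
        with \<open>t \<noteq> 0\<close> have "t < 0" by simp
        then have empty: "{x \<in> space ?L. N x powr p \<le> t} = {}"
          using powr_ge_zero[of "N _" p] by (auto simp: not_le intro: less_le_trans)
        show ?thesis unfolding empty using \<open>t < 0\<close> by simp
      qed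
      finally show "(\<integral>\<^sup>+x. ennreal (exp (- t)) * indicator {(x, t). N x powr p \<le> t} (x, t) \<partial>?L) = \<dots>" .
    qed
  qed
  also have "\<dots> = (\<integral>\<^sup>+t. ennreal (indicator {0..} t * t powr ((1 + real (card I) / p) - 1) / exp t) \<partial>lborel) * ?V"
    by (rule nn_integral_multc) simp
  also have "(\<integral>\<^sup>+t. ennreal (indicator {0..} t * t powr ((1 + real (card I) / p) - 1) / exp t) \<partial>lborel) = ennreal (Gamma (1 + real (card I) / p))"
    using p by (intro Gamma_conv_nn_integral_real[symmetric]) (auto intro: add_pos_nonneg)
  finally show ?thesis .
qed

lemma nn_integral_PiM_unit:
  assumes "f \<in> borel_measurable lborel"
  shows "(\<integral>\<^sup>+x. f (x ()) \<partial>Pi\<^sub>M {()} (\<lambda>_. lborel)) = (\<integral>\<^sup>+t. f t \<partial>(lborel :: real measure))"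
  by (rule product_sigma_finite.product_nn_integral_singleton[OF sigma_finite_lborel_family assms])

text \<open>The case of dimension one of the layer-cake formula, in which the unit ball has length 2.\<close>

lemma nn_integral_exp_neg_abs_powr:
  assumes p: "0 < p"
  shows "(\<integral>\<^sup>+x. ennreal (exp (- (\<bar>x\<bar> powr p))) \<partial>lborel) = ennreal (alpha_p p)"
proof -
  let ?L = "Pi\<^sub>M {()} (\<lambda>_. lborel :: real measure)"
  have "(\<integral>\<^sup>+x. ennreal (exp (- (\<bar>x\<bar> powr p))) \<partial>lborel) = (\<integral>\<^sup>+x. ennreal (exp (- (\<bar>x ()\<bar> powr p))) \<partial>?L)"
    by (rule nn_integral_PiM_unit[symmetric]) simp
  also have "\<dots> = ennreal (Gamma (1 + real (card {()}) / p)) * emeasure ?L {x \<in> space ?L. \<bar>x ()\<bar> \<le> 1}"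
    using p by (intro nn_integral_exp_neg_gauge_powr) (auto simp: abs_mult)
  also have "emeasure ?L {x \<in> space ?L. \<bar>x ()\<bar> \<le> 1} = (\<integral>\<^sup>+x. indicator {-1..1} (x ()) \<partial>?L)"
  proof -
    have "(\<integral>\<^sup>+x. indicator {-1..1} (x ()) \<partial>?L) = (\<integral>\<^sup>+x. indicator {x \<in> space ?L. \<bar>x ()\<bar> \<le> 1} x \<partial>?L)"
      by (intro nn_integral_cong) (auto simp: indicator_def)
    then show ?thesis by (simp add: nn_integral_indicator)
  qed
  also have "\<dots> = emeasure lborel {-1..1::real}"
    by (subst nn_integral_PiM_unit) simp_all
  also have "\<dots> = 2" by simp
  also have "ennreal (Gamma (1 + real (card {()}) / p)) * 2 = ennreal (alpha_p p)"
    by (simp add: alpha_p_def ennreal_mult' mult.commute)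
  finally show ?thesis .
qed

lemma alpha_p_pos: "0 < p \<Longrightarrow> 0 < alpha_p p"
  by (simp add: alpha_p_def Gamma_real_pos add_pos_pos)

lemma integrable_exp_neg_abs_powr:
  assumes "0 < p"
  shows "integrable lborel (\<lambda>x. exp (- (\<bar>x\<bar> powr p)))"
    and "(\<integral>x. exp (- (\<bar>x\<bar> powr p)) \<partial>lborel) = alpha_p p"
proof -
  show 1: "integrable lborel (\<lambda>x. exp (- (\<bar>x\<bar> powr p)))"
    by (rule integrableI_bounded) (auto simp: nn_integral_exp_neg_abs_powr assms)
  have "ennreal (\<integral>x. exp (- (\<bar>x\<bar> powr p)) \<partial>lborel) = ennreal (alpha_p p)"
    using nn_integral_eq_integral[OF 1] by (simp add: nn_integral_exp_neg_abs_powr assms)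
  then show "(\<integral>x. exp (- (\<bar>x\<bar> powr p)) \<partial>lborel) = alpha_p p"
    using alpha_p_pos[OF assms] by (simp add: ennreal_inj less_imp_le)
qed

lemma integrable_exp_neg_abs:
  assumes "0 < c"
  shows "integrable lborel (\<lambda>x::real. exp (- c * \<bar>x\<bar>))"
  using lborel_integrable_real_affine[OF integrable_exp_neg_abs_powr(1)[of 1], of c 0] assms
  by (simp add: abs_mult)

lemma abs_minus_one_le_powr:
  assumes "1 \<le> p" shows "\<bar>x\<bar> - 1 \<le> \<bar>x::real\<bar> powr p"
proof (cases "1 \<le> \<bar>x\<bar>")
  case True
  then have "\<bar>x\<bar> powr 1 \<le> \<bar>x\<bar> powr p" using assms by (intro powr_mono) auto
  then show ?thesis using True by simp
qed (auto intro: order_trans[of _ 0])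

lemma integrable_exp_neg_powr_scaled:
  fixes c p :: real
  assumes "0 < c" "1 \<le> p"
  shows "integrable lborel (\<lambda>x. exp (- c * (\<bar>x\<bar> powr p)))"
proof (rule Bochner_Integration.integrable_bound)
  show "integrable lborel (\<lambda>x::real. exp c * exp (- c * \<bar>x\<bar>))"
    by (intro integrable_mult_right integrable_exp_neg_abs assms)
  show "AE x in lborel. norm (exp (- c * (\<bar>x\<bar> powr p))) \<le> norm (exp c * exp (- c * \<bar>x::real\<bar>))"
  proof (rule AE_I2)
    fix x :: real
    have "c * (\<bar>x\<bar> - 1) \<le> c * \<bar>x\<bar> powr p"
      using assms abs_minus_one_le_powr by (intro mult_left_mono) auto
    then show "norm (exp (- c * (\<bar>x\<bar> powr p))) \<le> norm (exp c * exp (- c * \<bar>x\<bar>))"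
      by (simp add: exp_add[symmetric] algebra_simps)
  qed
qed simp

text \<open>On \<open>[-1, 1]\<close> the integrand is at least \<open>1 - |x|\<close>, whose integral is 1. This lets factors \<open>\<alpha>\<^sub>p\<close> be dropped from
a lower bound.\<close>

lemma alpha_p_ge_1:
  assumes "1 \<le> p" shows "1 \<le> alpha_p p"
proof -
  have le: "(1 - \<bar>x\<bar>) * indicator {-1..1} x \<le> exp (- (\<bar>x\<bar> powr p))" for x :: real
  proof (cases "x \<in> {-1..1}")
    case True
    have "\<bar>x\<bar> powr p \<le> \<bar>x\<bar> powr 1" using True assms by (intro powr_mono') auto
    then have "1 - \<bar>x\<bar> \<le> 1 + - (\<bar>x\<bar> powr p)" by simp
    also have "\<dots> \<le> exp (- (\<bar>x\<bar> powr p))" by (rule exp_ge_add_one_self)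
    finally show ?thesis using True by simp
  qed simp
  have 1: "has_bochner_integral lborel (\<lambda>x. (1 - x) * indicator {0..1} x) (1/2 :: real)"
  proof -
    have "((\<lambda>x. x - x\<^sup>2 / 2) has_real_derivative 1 - x) (at x)" for x :: real
      by (auto intro!: derivative_eq_intros)
    then show ?thesis
      using has_bochner_integral_FTC_Icc_real[of 0 1 "\<lambda>x. x - x\<^sup>2 / 2" "\<lambda>x. 1 - x"]
      by (simp add: mult.commute)
  qed
  have 2: "has_bochner_integral lborel (\<lambda>x. (1 + x) * indicator {-1..0} x) (1/2 :: real)"
  proof -
    have "((\<lambda>x. x + x\<^sup>2 / 2) has_real_derivative 1 + x) (at x)" for x :: real
      by (auto intro!: derivative_eq_intros)
    then show ?thesis
      using has_bochner_integral_FTC_Icc_real[of "-1" 0 "\<lambda>x. x + x\<^sup>2 / 2" "\<lambda>x. 1 + x"]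
      by (simp add: mult.commute)
  qed
  have "has_bochner_integral lborel (\<lambda>x. (1 - x) * indicator {0..1} x + (1 + x) * indicator {-1..0} x) (1/2 + 1/2 :: real)"
    by (rule has_bochner_integral_add[OF 1 2])
  then have 3: "has_bochner_integral lborel (\<lambda>x. (1 - x) * indicator {0..1} x + (1 + x) * indicator {-1..0} x) (1 :: real)" by simp
  have 4: "AE x in lborel. (1 - x) * indicator {0..1} x + (1 + x) * indicator {-1..0} x \<le> exp (- (\<bar>x\<bar> powr p))"
  proof -
    have "AE x in lborel. x \<noteq> (0::real)" by (rule AE_lborel_singleton)
    then show ?thesis
    proof eventually_elim
      fix x :: real assume "x \<noteq> 0"
      then have "(1 - x) * indicator {0..1} x + (1 + x) * indicator {-1..0} x = (1 - \<bar>x\<bar>) * indicator {-1..1} x"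
        by (auto simp: indicator_def)
      then show "(1 - x) * indicator {0..1} x + (1 + x) * indicator {-1..0} x \<le> exp (- (\<bar>x\<bar> powr p))"
        using le by simp
    qed
  qed
  have "1 \<le> (\<integral>x. exp (- (\<bar>x\<bar> powr p)) \<partial>lborel)"
    using integral_mono_AE[OF _ integrable_exp_neg_abs_powr(1) 4] 3 assms
    by (simp add: has_bochner_integral_iff)
  then show ?thesis using integrable_exp_neg_abs_powr(2)[of p] assms by simp
qed

lemma vol_ball_lp_eq:
  assumes p: "0 < p"
  shows "Gamma (1 + real k / p) * vol_ball_lp p k = alpha_p p ^ k"
proof -
  let ?L = "Pi\<^sub>M {..<k} (\<lambda>_. lborel :: real measure)"
  interpret product_sigma_finite "\<lambda>_::nat. lborel :: real measure" by (rule sigma_finite_lborel_family)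
  define N where "N x = (\<Sum>i<k. \<bar>x i\<bar> powr p) powr (1 / p)" for x :: "nat \<Rightarrow> real"
  have Np: "N x powr p = (\<Sum>i<k. \<bar>x i\<bar> powr p)" for x
    using p by (simp add: N_def powr_powr sum_nonneg)
  have "(\<integral>\<^sup>+x. ennreal (exp (- (N x powr p))) \<partial>?L) = (\<integral>\<^sup>+x. (\<Prod>i<k. ennreal (exp (- (\<bar>x i\<bar> powr p)))) \<partial>?L)"
    by (simp add: Np prod_ennreal exp_sum flip: sum_negf)
  also have "\<dots> = (\<Prod>i<k. ennreal (alpha_p p))"
    by (subst product_nn_integral_prod) (simp_all add: nn_integral_exp_neg_abs_powr p)
  also have "\<dots> = ennreal (alpha_p p ^ k)"
    using alpha_p_pos[OF p] by (simp add: ennreal_power)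
  finally have 1: "(\<integral>\<^sup>+x. ennreal (exp (- (N x powr p))) \<partial>?L) = ennreal (alpha_p p ^ k)" .
  have "N (\<lambda>i\<in>{..<k}. r * x i) = r * N x" if r: "0 < r" for r x
  proof -
    have "N (\<lambda>i\<in>{..<k}. r * x i) = (r powr p * (\<Sum>i<k. \<bar>x i\<bar> powr p)) powr (1 / p)"
      using r by (simp add: N_def abs_mult powr_mult sum_distrib_left)
    also have "\<dots> = r * N x"
      using r p by (simp add: N_def powr_mult powr_powr sum_nonneg)
    finally show ?thesis .
  qed
  then have 2: "(\<integral>\<^sup>+x. ennreal (exp (- (N x powr p))) \<partial>?L) =
    ennreal (Gamma (1 + real (card {..<k}) / p)) * emeasure ?L {x \<in> space ?L. N x \<le> 1}"
    using p by (intro nn_integral_exp_neg_gauge_powr) (auto simp: N_def)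
  have set: "{x \<in> space ?L. N x \<le> 1} = ball_lp p k"
    by (auto simp: ball_lp_def N_def space_PiM PiE_def)
  have G: "0 < Gamma (1 + real k / p)" using p by (intro Gamma_real_pos) (auto intro: add_pos_nonneg)
  have eq: "ennreal (Gamma (1 + real k / p)) * emeasure ?L (ball_lp p k) = ennreal (alpha_p p ^ k)"
    using 1 2 set by simp
  have "emeasure ?L (ball_lp p k) \<noteq> \<infinity>"
  proof
    assume "emeasure ?L (ball_lp p k) = \<infinity>"
    then show False using eq G by (simp add: ennreal_mult_top)
  qed
  then have "emeasure ?L (ball_lp p k) = ennreal (vol_ball_lp p k)"
    by (simp add: vol_ball_lp_def emeasure_eq_ennreal_measure)
  then show ?thesis
    using eq G alpha_p_pos[OF p] by (simp add: ennreal_mult[symmetric] vol_ball_lp_def)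
qed

section \<open>Mixtures of centred Gaussians and their Fourier transforms\<close>

text \<open>Instead of a mixing measure, the class is generated from Gaussians by nonnegative combinations and bounded pointwise
limits. All properties needed of mixtures are stable under these operations and are proved by induction.\<close>

inductive gaussian_mixture :: "(real \<Rightarrow> real) \<Rightarrow> bool" where
  gauss: "0 < \<omega> \<Longrightarrow> gaussian_mixture (\<lambda>t. exp (- \<omega> * t\<^sup>2))"
| zero: "gaussian_mixture (\<lambda>_. 0)"
| scale: "0 \<le> r \<Longrightarrow> gaussian_mixture g \<Longrightarrow> gaussian_mixture (\<lambda>t. r * g t)"
| add: "gaussian_mixture g \<Longrightarrow> gaussian_mixture h \<Longrightarrow> gaussian_mixture (\<lambda>t. g t + h t)"
| limit: "(\<And>n. gaussian_mixture (G n)) \<Longrightarrow> (\<And>n t. G n t \<le> C) \<Longrightarrow> (\<And>t. (\<lambda>n. G n t) \<longlonglongrightarrow> g t) \<Longrightarrow> gaussian_mixture g"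

lemma gaussian_mixture_nonneg: "gaussian_mixture g \<Longrightarrow> 0 \<le> g t"
proof (induction arbitrary: t rule: gaussian_mixture.induct)
  case (limit G C g)
  show ?case by (rule LIMSEQ_le_const[OF limit.hyps(3)]) (use limit.IH in blast)
qed auto

lemma gaussian_mixture_bounded:
  assumes "gaussian_mixture g" shows "\<exists>C\<ge>0. \<forall>t. g t \<le> C"
  using assms
proof (induction rule: gaussian_mixture.induct)
  case (gauss \<omega>)
  then show ?case by (intro exI[of _ 1]) auto
next
  case (scale r g)
  then show ?case by (metis mult_left_mono mult_nonneg_nonneg)
next
  case (add g h)
  then show ?case by (metis add_mono add_nonneg_nonneg)
next
  case (limit G C g)
  then have "g t \<le> C" for t by (intro LIMSEQ_le_const2[OF limit.hyps(3)]) auto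
  moreover have "0 \<le> C" using gaussian_mixture_nonneg[OF limit.hyps(1)] limit.hyps(2) by (meson order_trans)
  ultimately show ?case by blast
qed auto

lemma gaussian_mixture_measurable: "gaussian_mixture g \<Longrightarrow> g \<in> borel_measurable borel"
proof (induction rule: gaussian_mixture.induct)
  case (limit G C g)
  show ?case by (rule borel_measurable_LIMSEQ_real[OF limit.hyps(3) limit.IH])
qed auto

text \<open>Hoelder's inequality for two terms, by Young's inequality after normalising the two sums to 1.\<close>

lemma weighted_product_superadditive:
  fixes a b c d \<theta> :: real
  assumes "0 \<le> a" "0 \<le> b" "0 \<le> c" "0 \<le> d" "0 < \<theta>" "\<theta> < 1"
  shows "a powr \<theta> * b powr (1 - \<theta>) + c powr \<theta> * d powr (1 - \<theta>) \<le> (a + c) powr \<theta> * (b + d) powr (1 - \<theta>)"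
proof (cases "a + c = 0 \<or> b + d = 0")
  case True
  then show ?thesis using assms by (auto simp: add_nonneg_eq_0_iff)
next
  case False
  then have p: "0 < a + c" "0 < b + d" using assms by auto
  have Y: "x powr \<theta> * y powr (1 - \<theta>) \<le> \<theta> * x + (1 - \<theta>) * y" if "0 \<le> x" "0 \<le> y" for x y :: real
  proof (cases "x = 0 \<or> y = 0")
    case True then show ?thesis using that assms by auto
  next
    case False
    then show ?thesis using Youngs_inequality_0[of \<theta> "1 - \<theta>" x y] that assms by auto
  qed
  let ?P = "(a + c) powr \<theta> * (b + d) powr (1 - \<theta>)"
  have "a powr \<theta> * b powr (1 - \<theta>) = ?P * ((a / (a + c)) powr \<theta> * (b / (b + d)) powr (1 - \<theta>))"
    "c powr \<theta> * d powr (1 - \<theta>) = ?P * ((c / (a + c)) powr \<theta> * (d / (b + d)) powr (1 - \<theta>))"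
    using p assms by (simp_all add: powr_divide)
  then have "a powr \<theta> * b powr (1 - \<theta>) + c powr \<theta> * d powr (1 - \<theta>) = ?P * 
     ((a / (a + c)) powr \<theta> * (b / (b + d)) powr (1 - \<theta>) + (c / (a + c)) powr \<theta> * (d / (b + d)) powr (1 - \<theta>))"
    by (simp add: distrib_left)
  also have "\<dots> \<le> ?P * ((\<theta> * (a / (a + c)) + (1 - \<theta>) * (b / (b + d))) + (\<theta> * (c / (a + c)) + (1 - \<theta>) * (d / (b + d))))"
    using p assms by (intro mult_left_mono add_mono Y) auto
  also have "(\<theta> * (a / (a + c)) + (1 - \<theta>) * (b / (b + d))) + (\<theta> * (c / (a + c)) + (1 - \<theta>) * (d / (b + d))) = 1"
  proof -
    have "a / (a + c) + c / (a + c) = 1" "b / (b + d) + d / (b + d) = 1"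
      using p by (simp_all add: add_divide_distrib[symmetric])
    then have "\<theta> * (a / (a + c) + c / (a + c)) + (1 - \<theta>) * (b / (b + d) + d / (b + d)) = 1" by simp
    then show ?thesis by (simp add: algebra_simps)
  qed
  finally show ?thesis by simp
qed

text \<open>Log-convexity of \<open>g\<close> in the variable \<open>t\<^sup>2\<close>, between the points \<open>0\<close> and \<open>t\<^sup>2\<close>. For a single Gaussian
it is an equality, and the right-hand side is superadditive in \<open>g\<close> by Hoelder's inequality.\<close>

lemma gaussian_mixture_log_convex_in_square:
  assumes "gaussian_mixture g" and \<theta>: "0 < \<theta>" "\<theta> < 1"
  shows "g (sqrt \<theta> * t) \<le> g t powr \<theta> * g 0 powr (1 - \<theta>)"
  using assms(1)
proof (induction rule: gaussian_mixture.induct)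
  case (gauss \<omega>)
  have "exp (- \<omega> * (sqrt \<theta> * t)\<^sup>2) = exp (- \<omega> * t\<^sup>2) powr \<theta>"
    using \<theta> by (simp add: power_mult_distrib powr_def)
  then show ?case by simp
next
  case (scale r g)
  have "r powr \<theta> * r powr (1 - \<theta>) = r" if "r \<noteq> 0"
    using that scale(1) by (simp flip: powr_add)
  then have "(r * g t) powr \<theta> * (r * g 0) powr (1 - \<theta>) = r * (g t powr \<theta> * g 0 powr (1 - \<theta>))"
    using scale(1) gaussian_mixture_nonneg[OF scale(2)] \<theta> by (cases "r = 0") (auto simp: powr_mult mult_ac)
  then show ?case using scale(1,3) by (simp add: mult_left_mono)
next
  case (add g h)
  have "g (sqrt \<theta> * t) + h (sqrt \<theta> * t) \<le> g t powr \<theta> * g 0 powr (1 - \<theta>) + h t powr \<theta> * h 0 powr (1 - \<theta>)"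
    by (rule add_mono[OF add.IH])
  also have "\<dots> \<le> (g t + h t) powr \<theta> * (g 0 + h 0) powr (1 - \<theta>)"
    using add \<theta> by (intro weighted_product_superadditive gaussian_mixture_nonneg) auto
  finally show ?case .
next
  case (limit G C g)
  have "(\<lambda>n. G n t powr \<theta> * G n 0 powr (1 - \<theta>)) \<longlonglongrightarrow> g t powr \<theta> * g 0 powr (1 - \<theta>)"
    using \<theta> gaussian_mixture_nonneg[OF limit.hyps(1)] 
    by (intro tendsto_mult tendsto_powr' limit.hyps(3) tendsto_const disjI2 conjI always_eventually) auto
  then show ?case
    by (rule LIMSEQ_le[OF limit.hyps(3)]) (use limit.IH in blast)
qed auto

text \<open>Both sides are linear and continuous in each \<open>g\<^sub>j\<close> separately, so the factors can be passed from Gaussians to mixtures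
one at a time; \<open>S\<close> is the set of those already passed.\<close>

lemma gaussian_mixture_multilinear_comparison:
  fixes X :: "'w \<Rightarrow> 'j \<Rightarrow> real" and Y :: "'v \<Rightarrow> 'j \<Rightarrow> real"
  assumes J: "finite J" and M: "finite_measure M" and N: "finite_measure N"
    and X [measurable]: "\<And>j. (\<lambda>x. X x j) \<in> borel_measurable M" 
    and Y [measurable]: "\<And>j. (\<lambda>y. Y y j) \<in> borel_measurable N"
    and gauss: "\<And>\<omega>. (\<And>j. j \<in> J \<Longrightarrow> 0 < \<omega> j) \<Longrightarrow>
      (\<integral>y. exp (- (\<Sum>j\<in>J. \<omega> j * (Y y j)\<^sup>2)) \<partial>N) \<le> (\<integral>x. exp (- (\<Sum>j\<in>J. \<omega> j * (X x j)\<^sup>2)) \<partial>M)"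
    and g: "\<And>j. j \<in> J \<Longrightarrow> gaussian_mixture (g j)"
  shows "(\<integral>y. (\<Prod>j\<in>J. g j (Y y j)) \<partial>N) \<le> (\<integral>x. (\<Prod>j\<in>J. g j (X x j)) \<partial>M)"
proof -
  interpret M: finite_measure M by fact
  interpret N: finite_measure N by fact
  have "(\<integral>y. (\<Prod>j\<in>J. g j (Y y j)) \<partial>N) \<le> (\<integral>x. (\<Prod>j\<in>J. g j (X x j)) \<partial>M)"
    if "S \<subseteq> J" "\<And>j. j \<in> J \<Longrightarrow> gaussian_mixture (g j)" "\<And>j. j \<in> J - S \<Longrightarrow> \<exists>\<omega>>0. g j = (\<lambda>t. exp (- \<omega> * t\<^sup>2))" for S g
    using finite_subset[OF that(1) J] that
  proof (induction S arbitrary: g rule: finite_induct)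
    case empty
    then obtain \<omega> where \<omega>: "\<And>j. j \<in> J \<Longrightarrow> 0 < \<omega> j" "\<And>j. j \<in> J \<Longrightarrow> g j = (\<lambda>t. exp (- \<omega> j * t\<^sup>2))"
      by (metis Diff_empty)
    have "(\<Prod>j\<in>J. g j (x j)) = exp (- (\<Sum>j\<in>J. \<omega> j * (x j)\<^sup>2))" for x
      using J by (simp add: \<omega>(2) exp_sum flip: sum_negf)
    then show ?case using gauss[of \<omega>] \<omega>(1) by simp
  next
    case (insert i S)
    have i: "i \<in> J" using insert by auto
    define R where "R x = (\<Prod>j\<in>J - {i}. g j (x j))" for x
    have gaussian_mixture_j: "gaussian_mixture (g j)" if "j \<in> J - {i}" for j using insert.prems that by auto
    have gmeas [measurable]: "g j \<in> borel_measurable borel" if "j \<in> J - {i}" for j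
      using gaussian_mixture_measurable gaussian_mixture_j that by blast
    have R_split: "(\<Prod>j\<in>J. (g(i := h)) j (x j)) = h (x i) * R x" for h x
      unfolding R_def using prod.remove[OF J i, of "\<lambda>j. (g(i := h)) j (x j)"] by simp
    have R0: "0 \<le> R x" for x unfolding R_def using gaussian_mixture_j gaussian_mixture_nonneg by (intro prod_nonneg) blast
    have "\<forall>j\<in>J - {i}. \<exists>C\<ge>0. \<forall>t. g j t \<le> C" using gaussian_mixture_j gaussian_mixture_bounded by blast
    then obtain D where D: "\<And>j t. j \<in> J - {i} \<Longrightarrow> g j t \<le> D j" by metis
    have RD: "R x \<le> (\<Prod>j\<in>J - {i}. D j)" for x
      unfolding R_def using gaussian_mixture_nonneg[OF gaussian_mixture_j] D by (intro prod_mono) auto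
    have RX [measurable]: "(\<lambda>x. R (X x)) \<in> borel_measurable M" and RY [measurable]: "(\<lambda>y. R (Y y)) \<in> borel_measurable N"
      unfolding R_def by measurable
    have bd: "\<bar>h t * R x\<bar> \<le> C * (\<Prod>j\<in>J - {i}. D j)" if "gaussian_mixture h" "\<And>t. h t \<le> C" for h t x C
      using that gaussian_mixture_nonneg[OF that(1)] R0[of x] RD[of x]
      by (subst abs_of_nonneg) (auto intro!: mult_mono intro: order_trans[OF gaussian_mixture_nonneg])
    have intM: "integrable M (\<lambda>x. h (X x i) * R (X x))" and intN: "integrable N (\<lambda>y. h (Y y i) * R (Y y))" if h: "gaussian_mixture h" for h
    proof -
      obtain C where C: "\<And>t. h t \<le> C" using gaussian_mixture_bounded[OF h] by blast
      note [measurable] = gaussian_mixture_measurable[OF h]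
      show "integrable M (\<lambda>x. h (X x i) * R (X x))"
        by (rule M.integrable_const_bound[where B = "C * (\<Prod>j\<in>J - {i}. D j)"]) (use bd[OF h C] in \<open>auto\<close>)
      show "integrable N (\<lambda>y. h (Y y i) * R (Y y))"
        by (rule N.integrable_const_bound[where B = "C * (\<Prod>j\<in>J - {i}. D j)"]) (use bd[OF h C] in \<open>auto\<close>)
    qed
    have "gaussian_mixture h \<Longrightarrow> (\<integral>y. h (Y y i) * R (Y y) \<partial>N) \<le> (\<integral>x. h (X x i) * R (X x) \<partial>M)" for h
    proof (induction rule: gaussian_mixture.induct)
      case (gauss \<omega>)
      let ?h = "\<lambda>t. exp (- \<omega> * t\<^sup>2)"
      have "(\<integral>y. (\<Prod>j\<in>J. (g(i := ?h)) j (Y y j)) \<partial>N) \<le> (\<integral>x. (\<Prod>j\<in>J. (g(i := ?h)) j (X x j)) \<partial>M)"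
        using insert.prems insert.hyps gauss gaussian_mixture.gauss[OF gauss] by (intro insert.IH) auto
      then show ?case by (simp only: R_split)
    next
      case zero
      then show ?case by simp
    next
      case (scale r h)
      then show ?case by (simp add: mult.assoc mult_left_mono)
    next
      case (add h h')
      then show ?case using intM intN by (simp add: distrib_right)
    next
      case (limit G C h)
      have gh: "gaussian_mixture h" using gaussian_mixture.limit[OF limit.hyps] .
      have hm [measurable]: "h \<in> borel_measurable borel" "\<And>n. G n \<in> borel_measurable borel"
        using gaussian_mixture_measurable gh limit.hyps(1) by blast+
      have 1: "(\<lambda>n. \<integral>y. G n (Y y i) * R (Y y) \<partial>N) \<longlonglongrightarrow> (\<integral>y. h (Y y i) * R (Y y) \<partial>N)"
        by (rule integral_dominated_convergence[where w = "\<lambda>_. C * (\<Prod>j\<in>J - {i}. D j)"])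
           (use bd[OF limit.hyps(1,2)] in \<open>auto intro!: tendsto_mult limit.hyps(3)\<close>)
      have 2: "(\<lambda>n. \<integral>x. G n (X x i) * R (X x) \<partial>M) \<longlonglongrightarrow> (\<integral>x. h (X x i) * R (X x) \<partial>M)"
        by (rule integral_dominated_convergence[where w = "\<lambda>_. C * (\<Prod>j\<in>J - {i}. D j)"])
           (use bd[OF limit.hyps(1,2)] in \<open>auto intro!: tendsto_mult limit.hyps(3)\<close>)
      show ?case by (rule LIMSEQ_le[OF 1 2]) (use limit.IH in blast)
    qed
    \<comment> \<open>The \<open>i\<close>-th factor is now an arbitrary mixture, the others being as before.\<close>
    from this[of "g i"] show ?case
      using insert.prems(2)[OF i] R_split[of "g i"] by simp
  qed
  from this[of J] g show ?thesis by simp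
qed

text \<open>The transform \<open>g\<close> is taken to be real-valued, as it is for every even \<open>f\<close>.\<close>

definition fourier_pair :: "(real \<Rightarrow> real) \<Rightarrow> (real \<Rightarrow> real) \<Rightarrow> bool" where
  "fourier_pair f g \<longleftrightarrow> integrable lborel f \<and> (\<forall>t. complex_of_real (g t) = (CLINT s|lborel. complex_of_real (f s) * iexp (t * s)))"

lemma fourier_pair_integrable:
  assumes "integrable lborel f"
  shows "complex_integrable lborel (\<lambda>s. complex_of_real (f s) * iexp (t * s))"
  by (rule Bochner_Integration.integrable_bound[OF assms]) (use assms in \<open>auto simp: norm_mult\<close>)

lemma fourier_pair_cos:
  assumes "fourier_pair f g"
  shows "g t = (\<integral>s. f s * cos (t * s) \<partial>lborel)"
proof -
  have f: "integrable lborel f" using assms by (simp add: fourier_pair_def)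
  have "complex_of_real (g t) = (CLINT s|lborel. complex_of_real (f s) * iexp (t * s))"
    using assms by (simp only: fourier_pair_def)
  then have "g t = Re (CLINT s|lborel. complex_of_real (f s) * iexp (t * s))"
    by (metis Re_complex_of_real)
  also have "\<dots> = (\<integral>s. Re (complex_of_real (f s) * iexp (t * s)) \<partial>lborel)"
    by (rule integral_Re[symmetric, OF fourier_pair_integrable[OF f]])
  finally show ?thesis by (simp add: Re_exp)
qed

lemma fourier_pair_scale: "fourier_pair f g \<Longrightarrow> fourier_pair (\<lambda>s. r * f s) (\<lambda>t. r * g t)"
  by (auto simp: fourier_pair_def mult.assoc)

lemma fourier_pair_add:
  "fourier_pair f g \<Longrightarrow> fourier_pair f' g' \<Longrightarrow> fourier_pair (\<lambda>s. f s + f' s) (\<lambda>t. g t + g' t)"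
  unfolding fourier_pair_def
  using fourier_pair_integrable[of f] fourier_pair_integrable[of f'] by (auto simp: distrib_right)

lemma fourier_pair_dilate:
  assumes fg: "fourier_pair f g" and A: "0 < A"
  shows "fourier_pair (\<lambda>s. f (s / A)) (\<lambda>t. A * g (A * t))"
  unfolding fourier_pair_def
proof (intro conjI allI)
  have f: "integrable lborel f" using fg by (simp add: fourier_pair_def)
  show "integrable lborel (\<lambda>s. f (s / A))"
    using lborel_integrable_real_affine[OF f, of "1 / A" 0] A by simp
  fix t
  have "(CLINT s|lborel. complex_of_real (f (s / A)) * iexp (t * s)) = 
      A *\<^sub>R (CLINT s|lborel. complex_of_real (f ((0 + A * s) / A)) * iexp (t * (0 + A * s)))"
    using lborel_integral_real_affine[of A "\<lambda>s. complex_of_real (f (s / A)) * iexp (t * s)" 0] A by simp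
  also have "\<dots> = A *\<^sub>R (CLINT s|lborel. complex_of_real (f s) * iexp ((A * t) * s))"
    using A by (simp add: mult_ac)
  also have "\<dots> = complex_of_real (A * g (A * t))"
    using fg by (simp add: fourier_pair_def scaleR_conv_of_real)
  finally show "complex_of_real (A * g (A * t)) = (CLINT s|lborel. complex_of_real (f (s / A)) * iexp (t * s))" ..
qed

text \<open>This is the characteristic function of the standard normal distribution.\<close>

lemma fourier_pair_std_gauss:
  "fourier_pair (\<lambda>s. exp (- s\<^sup>2 / 2)) (\<lambda>t. sqrt (2 * pi) * exp (- t\<^sup>2 / 2))"
  unfolding fourier_pair_def
proof (intro conjI allI)
  have eq: "exp (- s\<^sup>2 / 2) = sqrt (2 * pi) * std_normal_density s" for s :: real
    by (simp add: std_normal_density_def)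
  show "integrable lborel (\<lambda>s::real. exp (- s\<^sup>2 / 2))" unfolding eq by simp
  fix t :: real
  have "complex_of_real (exp (- t\<^sup>2 / 2)) = (CLINT s|std_normal_distribution. iexp (t * s))"
    using fun_cong[OF char_std_normal_distribution, of t] by (simp add: char_def)
  also have "\<dots> = (CLINT s|lborel. std_normal_density s *\<^sub>R iexp (t * s))"
    by (rule integral_density) auto
  finally have "complex_of_real (sqrt (2 * pi) * exp (- t\<^sup>2 / 2)) = 
      complex_of_real (sqrt (2 * pi)) * (CLINT s|lborel. std_normal_density s *\<^sub>R iexp (t * s))" by simp
  also have "\<dots> = (CLINT s|lborel. complex_of_real (exp (- s\<^sup>2 / 2)) * iexp (t * s))"
    unfolding eq of_real_mult scaleR_conv_of_real mult.assoc by (rule integral_mult_right_zero[symmetric])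
  finally show "complex_of_real (sqrt (2 * pi) * exp (- t\<^sup>2 / 2)) = \<dots>" .
qed

lemma fourier_pair_gauss:
  assumes "0 < \<omega>"
  shows "fourier_pair (\<lambda>s. exp (- \<omega> * s\<^sup>2)) (\<lambda>t. sqrt (pi / \<omega>) * exp (- (1 / (4 * \<omega>)) * t\<^sup>2))"
proof -
  have "fourier_pair (\<lambda>s. exp (- (s / (1 / sqrt (2 * \<omega>)))\<^sup>2 / 2)) 
    (\<lambda>t. (1 / sqrt (2 * \<omega>)) * (sqrt (2 * pi) * exp (- (1 / sqrt (2 * \<omega>) * t)\<^sup>2 / 2)))"
    using fourier_pair_dilate[OF fourier_pair_std_gauss, of "1 / sqrt (2 * \<omega>)"] assms by simp
  moreover have "- (s / (1 / sqrt (2 * \<omega>)))\<^sup>2 / 2 = - \<omega> * s\<^sup>2" for s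
    using assms by (simp add: power_mult_distrib)
  moreover have "- (1 / sqrt (2 * \<omega>) * t)\<^sup>2 / 2 = - (1 / (4 * \<omega>)) * t\<^sup>2" for t
    using assms by (simp add: power_divide power_mult_distrib)
  moreover have "(1 / sqrt (2 * \<omega>)) * (sqrt (2 * pi) * x) = sqrt (pi / \<omega>) * x" for x
    using assms by (simp add: real_sqrt_mult real_sqrt_divide)
  ultimately show ?thesis by simp
qed

definition has_mixture_transform :: "(real \<Rightarrow> real) \<Rightarrow> bool" where
  "has_mixture_transform f \<longleftrightarrow> (\<exists>g. gaussian_mixture g \<and> fourier_pair f g)"

text \<open>Under a common integrable bound, convergence of functions gives bounded pointwise convergence of transforms, which
the class of mixtures admits. The point \<open>0\<close> is left out because the approximations of \<open>exp (- |x|\<^sup>p)\<close> below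
are power series in a variable that is 1 there.\<close>

lemma has_mixture_transform_limit:
  assumes F: "\<And>n. has_mixture_transform (F n)" and w: "integrable lborel w"
    and bound: "\<And>n s. s \<noteq> 0 \<Longrightarrow> \<bar>F n s\<bar> \<le> w s"
    and [measurable]: "f \<in> borel_measurable borel" and lim: "\<And>s. s \<noteq> 0 \<Longrightarrow> (\<lambda>n. F n s) \<longlonglongrightarrow> f s"
  shows "has_mixture_transform f"
proof -
  obtain G where G: "\<And>n. gaussian_mixture (G n)" "\<And>n. fourier_pair (F n) (G n)"
    using F unfolding has_mixture_transform_def by metis
  have Fm [measurable]: "F n \<in> borel_measurable borel" for n
    using G(2)[of n] borel_measurable_integrable[of lborel "F n"] by (simp add: fourier_pair_def)
  have nz: "AE s in lborel. s \<noteq> (0::real)" by (rule AE_lborel_singleton)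
  have AE0: "AE s in lborel. (\<lambda>n. F n s) \<longlonglongrightarrow> f s"
    using nz by eventually_elim (rule lim)
  have AEb: "AE s in lborel. \<bar>F n s\<bar> \<le> w s" for n
    using nz by eventually_elim (rule bound)
  have f: "integrable lborel f"
    by (rule integrable_dominated_convergence[where s = F and w = w]) (use AE0 AEb w in auto)
  define g where "g t = (\<integral>s. f s * cos (t * s) \<partial>lborel)" for t
  have clim: "(\<lambda>n. CLINT s|lborel. complex_of_real (F n s) * iexp (t * s)) \<longlonglongrightarrow> (CLINT s|lborel. complex_of_real (f s) * iexp (t * s))" for t
  proof (rule integral_dominated_convergence[OF _ _ w])
    show "AE s in lborel. (\<lambda>n. complex_of_real (F n s) * iexp (t * s)) \<longlonglongrightarrow> complex_of_real (f s) * iexp (t * s)"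
      using AE0 by eventually_elim (intro tendsto_mult tendsto_of_real tendsto_const)
  qed (use AEb in \<open>auto simp: norm_mult\<close>)
  then have clim': "(\<lambda>n. complex_of_real (G n t)) \<longlonglongrightarrow> (CLINT s|lborel. complex_of_real (f s) * iexp (t * s))" for t
    using G(2) by (simp add: fourier_pair_def)
  have glim: "(\<lambda>n. G n t) \<longlonglongrightarrow> Re (CLINT s|lborel. complex_of_real (f s) * iexp (t * s))" for t
    using tendsto_Re[OF clim'] by simp
  have im: "Im (CLINT s|lborel. complex_of_real (f s) * iexp (t * s)) = 0" for t
    using tendsto_Im[OF clim'[of t]] by (simp add: LIMSEQ_const_iff)
  have gle: "G n t \<le> (\<integral>s. w s \<partial>lborel)" for n t
  proof -
    have Fi: "integrable lborel (F n)" using G(2) by (simp add: fourier_pair_def)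
    have "G n t = (\<integral>s. F n s * cos (t * s) \<partial>lborel)" by (rule fourier_pair_cos[OF G(2)])
    also have "\<dots> \<le> (\<integral>s. w s \<partial>lborel)"
    proof (rule integral_mono_AE[OF _ w])
      show "integrable lborel (\<lambda>s. F n s * cos (t * s))"
        by (rule Bochner_Integration.integrable_bound[OF Fi]) (auto simp: abs_mult intro!: mult_left_le)
      have "F n s * cos (t * s) \<le> \<bar>F n s\<bar>" for s
      proof -
        have "F n s * cos (t * s) \<le> \<bar>F n s\<bar> * \<bar>cos (t * s)\<bar>" by (metis abs_ge_self abs_mult)
        also have "\<dots> \<le> \<bar>F n s\<bar>" by (intro mult_left_le) auto
        finally show ?thesis .
      qed
      then show "AE s in lborel. F n s * cos (t * s) \<le> w s"
        using AEb[of n] by (auto elim!: eventually_mono intro: order_trans)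
    qed
    finally show ?thesis .
  qed
  have "gaussian_mixture (\<lambda>t. Re (CLINT s|lborel. complex_of_real (f s) * iexp (t * s)))"
    by (rule gaussian_mixture.limit[OF G(1) gle glim])
  moreover have "fourier_pair f (\<lambda>t. Re (CLINT s|lborel. complex_of_real (f s) * iexp (t * s)))"
    using f im by (auto simp: fourier_pair_def complex_eq_iff)
  ultimately show ?thesis unfolding has_mixture_transform_def by blast
qed

text \<open>The finite mixtures, considered as functions to be transformed rather than as transforms. Only strictly positive
exponents \<open>\<omega>\<close> are admitted, so all these functions are integrable; products stay in the class.\<close>

inductive gaussian_combination :: "(real \<Rightarrow> real) \<Rightarrow> bool" where
  gauss: "0 < \<omega> \<Longrightarrow> gaussian_combination (\<lambda>t. exp (- \<omega> * t\<^sup>2))"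
| zero: "gaussian_combination (\<lambda>_. 0)"
| scale: "0 \<le> r \<Longrightarrow> gaussian_combination g \<Longrightarrow> gaussian_combination (\<lambda>t. r * g t)"
| add: "gaussian_combination g \<Longrightarrow> gaussian_combination h \<Longrightarrow> gaussian_combination (\<lambda>t. g t + h t)"

lemma gaussian_combination_sum:
  fixes n :: nat
  shows "(\<And>k. k < n \<Longrightarrow> gaussian_combination (F k)) \<Longrightarrow> gaussian_combination (\<lambda>t. \<Sum>k<n. F k t)"
  by (induction n) (auto intro: gaussian_combination.zero gaussian_combination.add)

lemma gaussian_combination_mult:
  assumes "gaussian_combination g" "gaussian_combination h"
  shows "gaussian_combination (\<lambda>t. g t * h t)"
  using assms(1)
proof (induction rule: gaussian_combination.induct)
  case (gauss \<omega>)
  show ?case using assms(2)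
  proof (induction rule: gaussian_combination.induct)
    case (gauss \<omega>')
    then show ?case using gaussian_combination.gauss[of "\<omega> + \<omega>'"] \<open>0 < \<omega>\<close> by (simp add: algebra_simps exp_add[symmetric])
  next
    case (scale r g)
    then show ?case using gaussian_combination.scale by (simp add: mult.left_commute)
  next
    case (add g h)
    then show ?case using gaussian_combination.add by (simp add: distrib_left)
  qed (auto intro: gaussian_combination.zero)
next
  case (scale r g)
  then show ?case using gaussian_combination.scale by (simp add: mult.assoc)
next
  case (add g h)
  then show ?case using gaussian_combination.add by (simp add: distrib_right)
qed (auto intro: gaussian_combination.zero)

lemma gaussian_combination_power: "gaussian_combination g \<Longrightarrow> gaussian_combination (\<lambda>t. g t ^ Suc n)"
  by (induction n) (auto intro: gaussian_combination_mult)

lemma gaussian_combination_transform: "gaussian_combination f \<Longrightarrow> has_mixture_transform f"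
proof (induction rule: gaussian_combination.induct)
  case (gauss \<omega>)
  have "gaussian_mixture (\<lambda>t. sqrt (pi / \<omega>) * exp (- (1 / (4 * \<omega>)) * t\<^sup>2))"
    using gauss by (intro gaussian_mixture.scale gaussian_mixture.gauss) auto
  then show ?case using fourier_pair_gauss[OF gauss] unfolding has_mixture_transform_def by blast
next
  case zero
  have "fourier_pair (\<lambda>_. 0) (\<lambda>_. 0)" by (simp add: fourier_pair_def)
  then show ?case using gaussian_mixture.zero unfolding has_mixture_transform_def by blast
next
  case (scale r f)
  then show ?case using gaussian_mixture.scale fourier_pair_scale unfolding has_mixture_transform_def by blast
next
  case (add f f')
  then show ?case using gaussian_mixture.add fourier_pair_add unfolding has_mixture_transform_def by blast
qed

section \<open>The transform of exp(-|x|^p) is a mixture of Gaussians\<close>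

text \<open>These are the coefficients of \<open>1 - (1 - z)\<^sup>a\<close>, the generating function of Sibuya's distribution. From one to the
next, the ratio is \<open>(k - a) / (k + 1)\<close> with \<open>k \<ge> 1\<close>, which is nonnegative as \<open>a \<le> 1\<close>.\<close>

lemma sibuya_coefficient_nonneg:
  fixes a :: real
  assumes "0 < a" "a \<le> 1"
  shows "0 \<le> - ((a gchoose Suc k) * (- 1) ^ Suc k)"
proof (induction k)
  case 0
  then show ?case using assms by simp
next
  case (Suc k)
  have rec: "real (Suc (Suc k)) * (a gchoose Suc (Suc k)) = (a - real (Suc k)) * (a gchoose Suc k)"
    using gbinomial_absorb_comp[of a "Suc k"] gbinomial_absorption[of "Suc k" a]
    by (simp add: algebra_simps)
  have "real (Suc (Suc k)) * (- ((a gchoose Suc (Suc k)) * (- 1) ^ Suc (Suc k))) = 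
     - (real (Suc (Suc k)) * (a gchoose Suc (Suc k))) * (- 1) ^ Suc (Suc k)"
    by (simp del: of_nat_Suc)
  also have "\<dots> = (real (Suc k) - a) * (- ((a gchoose Suc k) * (- 1) ^ Suc k))"
    unfolding rec by (simp add: algebra_simps)
  also have "0 \<le> \<dots>" using assms Suc by (intro mult_nonneg_nonneg) auto
  finally show ?case by (simp only: zero_le_mult_iff) (auto simp del: power_Suc)
qed

lemma one_minus_powr_series:
  fixes a z :: real
  assumes a: "0 < a" "a \<le> 1" and z: "0 \<le> z" "z < 1"
  defines "b \<equiv> \<lambda>k. - ((a gchoose Suc k) * (- 1) ^ Suc k)"
  shows "(\<lambda>k. b k * z ^ Suc k) sums (1 - (1 - z) powr a)"
proof -
  have "(\<lambda>n. (a gchoose n) * (- z) ^ n) sums (1 - z) powr a"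
    using gen_binomial_real[of "- z" a] z by simp
  then have "(\<lambda>n. (a gchoose Suc n) * (- z) ^ Suc n) sums ((1 - z) powr a - 1)"
    using sums_Suc_iff[of "\<lambda>n. (a gchoose n) * (- z) ^ n" "(1 - z) powr a - 1"] by simp
  then have "(\<lambda>n. - ((a gchoose Suc n) * (- z) ^ Suc n)) sums (1 - (1 - z) powr a)"
    using sums_minus by fastforce
  moreover have "- ((a gchoose Suc n) * (- z) ^ Suc n) = b n * z ^ Suc n" for n
    by (simp add: b_def power_minus[of z] mult_ac)
  ultimately show ?thesis by (simp only:)
qed

text \<open>Used with \<open>y = x\<^sup>2 / M\<close> to dominate all approximations by \<open>exp (- |x|\<^sup>p / 2)\<close>. For \<open>y \<le> 1\<close> one has
\<open>1 - e\<^sup>-\<^sup>y \<ge> y / 2\<close>; for \<open>y > 1\<close> the left-hand side is at most \<open>e\<^sup>-\<^sup>y\<close>.\<close>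

lemma one_minus_powr_le_exp:
  fixes a y :: real
  assumes a: "0 < a" "a \<le> 1" and y: "0 < y"
  shows "1 - (1 - exp (- y)) powr a \<le> exp (- (y powr a) / 2)"
proof (cases "y \<le> 1")
  case True
  have "exp (- y) \<le> 1 - y / 2"
  proof -
    have "exp (- y) \<le> 1 / (1 + y)"
      using exp_ge_add_one_self[of y] y by (simp add: exp_minus field_simps)
    also have "\<dots> \<le> 1 - y / 2"
      using y True by (simp add: field_simps)
    finally show ?thesis .
  qed
  then have "(y / 2) powr a \<le> (1 - exp (- y)) powr a"
    using y a by (intro powr_mono2) auto
  moreover have "y powr a / 2 \<le> (y / 2) powr a"
  proof -
    have "2 powr a \<le> (2::real) powr 1" using a by (intro powr_mono) auto
    then have "y powr a / 2 \<le> y powr a / 2 powr a" by (intro divide_left_mono) auto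
    then show ?thesis using y by (simp add: powr_divide)
  qed
  ultimately have "1 - (1 - exp (- y)) powr a \<le> 1 + (- (y powr a) / 2)" by simp
  also have "\<dots> \<le> exp (- (y powr a) / 2)" by (rule exp_ge_add_one_self)
  finally show ?thesis .
next
  case False
  have "(1 - exp (- y)) powr 1 \<le> (1 - exp (- y)) powr a"
    using y a by (intro powr_mono') auto
  then have "1 - (1 - exp (- y)) powr a \<le> exp (- y)" using y by simp
  also have "\<dots> \<le> exp (- (y powr a) / 2)"
  proof -
    have "y powr a \<le> y powr 1" using False a by (intro powr_mono) auto
    moreover have "0 \<le> y powr a" by simp
    ultimately show ?thesis using y by simp
  qed
  finally show ?thesis .
qed

lemma sibuya_power_limit:
  fixes a s :: real
  assumes a: "0 < a" "a \<le> 1" and s: "0 < s"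
  shows "(\<lambda>n. (1 - (1 - exp (- s / real (Suc n) powr (1 / a))) powr a) ^ Suc n) \<longlonglongrightarrow> exp (- (s powr a))"
  using assms by real_asymp

text \<open>With \<open>a = p/2\<close> and \<open>M = n\<^sup>1\<^sup>/\<^sup>a\<close>, the function \<open>exp (- |x|\<^sup>p)\<close> is the limit of \<open>(1 - (1 - z)\<^sup>a)\<^sup>n\<close> at
\<open>z = exp (- x\<^sup>2 / M)\<close>. By the previous lemmas each of these is a power series in \<open>z\<close> with nonnegative
coefficients and without constant term, hence a limit of finite combinations of Gaussians in \<open>x\<close>. This replaces
the construction of a positive stable law.\<close>

lemma has_mixture_transform_exp_neg_powr:
  assumes p: "1 \<le> p" "p \<le> 2"
  shows "has_mixture_transform (\<lambda>x. exp (- (\<bar>x\<bar> powr p)))"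
proof -
  define a where "a = p / 2"
  have a: "0 < a" "a \<le> 1" using p by (auto simp: a_def)
  define b where "b k = - ((a gchoose Suc k) * (- 1) ^ Suc k)" for k
  have b: "0 \<le> b k" for k unfolding b_def by (rule sibuya_coefficient_nonneg[OF a])
  define M where "M n = real (Suc n) powr (1 / a)" for n
  have M: "0 < M n" for n by (simp add: M_def)
  define w where "w x = exp (- (1/2) * (\<bar>x\<bar> powr p))" for x :: real
  have w: "integrable lborel w"
    unfolding w_def by (rule integrable_exp_neg_powr_scaled) (use p in auto)
  define F where "F n x = (1 - (1 - exp (- x\<^sup>2 / M n)) powr a) ^ Suc n" for n and x :: real
  have sq: "(x\<^sup>2) powr a = \<bar>x\<bar> powr p" if "x \<noteq> 0" for x :: real
  proof -
    have "(x\<^sup>2) powr a = (\<bar>x\<bar> powr 2) powr a" using that by simp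
    also have "\<dots> = \<bar>x\<bar> powr p" by (simp only: powr_powr) (simp add: a_def)
    finally show ?thesis .
  qed
  have base0: "0 \<le> 1 - (1 - exp (- y)) powr a" if "0 < y" for y
    using powr_le1[of a "1 - exp (- y)"] a that by simp
  have F_bound: "\<bar>F n x\<bar> \<le> w x" if "x \<noteq> 0" for n x
  proof -
    have y: "0 < x\<^sup>2 / M n" using that M by simp
    have "F n x \<le> exp (- ((x\<^sup>2 / M n) powr a) / 2) ^ Suc n"
      unfolding F_def using base0[OF y] one_minus_powr_le_exp[OF a y] by (intro power_mono) auto
    also have "\<dots> = exp (real (Suc n) * (- ((x\<^sup>2 / M n) powr a) / 2))"
      by (rule exp_of_nat_mult[symmetric])
    also have "real (Suc n) * (- ((x\<^sup>2 / M n) powr a) / 2) = - (1/2) * (\<bar>x\<bar> powr p)"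
    proof -
      have "(M n) powr a = real (Suc n)" using a by (simp add: M_def powr_powr)
      moreover have "(x\<^sup>2 / M n) powr a = \<bar>x\<bar> powr p / (M n) powr a"
        using M[of n] by (simp only: powr_divide zero_le_power2 less_imp_le sq[OF that])
      ultimately show ?thesis by (simp del: of_nat_Suc)
    qed
    finally have "F n x \<le> w x" by (simp add: w_def)
    moreover have "0 \<le> F n x" unfolding F_def using base0[OF y] by simp
    ultimately show ?thesis by simp
  qed
  have F: "has_mixture_transform (F n)" for n
  proof (rule has_mixture_transform_limit[OF _ w])
    let ?P = "\<lambda>K x. \<Sum>k<K. b k * exp (- x\<^sup>2 / M n) ^ Suc k"
    show "has_mixture_transform (\<lambda>x. ?P K x ^ Suc n)" for K :: nat
    proof (intro gaussian_combination_transform gaussian_combination_power gaussian_combination_sum gaussian_combination.scale b)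
      show "gaussian_combination (\<lambda>x. exp (- x\<^sup>2 / M n))"
        using gaussian_combination.gauss[of "1 / M n"] M[of n] by simp
    qed
    have sums: "(\<lambda>k. b k * exp (- x\<^sup>2 / M n) ^ Suc k) sums (1 - (1 - exp (- x\<^sup>2 / M n)) powr a)" if "x \<noteq> 0" for x
      unfolding b_def using that M[of n] by (intro one_minus_powr_series[OF a]) auto
    show "(\<lambda>K. ?P K x ^ Suc n) \<longlonglongrightarrow> F n x" if "x \<noteq> 0" for x
      unfolding F_def using sums[OF that] by (intro tendsto_power) (simp add: sums_def)
    show "\<bar>?P K x ^ Suc n\<bar> \<le> w x" if "x \<noteq> 0" for K x
    proof -
      have nn: "0 \<le> ?P K x" using b by (intro sum_nonneg) auto
      have "?P K x \<le> (\<Sum>k. b k * exp (- x\<^sup>2 / M n) ^ Suc k)"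
        using sums[OF that] b by (intro sum_le_suminf) (auto simp: sums_iff)
      also have "\<dots> = 1 - (1 - exp (- x\<^sup>2 / M n)) powr a"
        using sums[OF that] by (simp only: sums_iff)
      finally have "?P K x ^ Suc n \<le> F n x"
        unfolding F_def using nn by (intro power_mono)
      moreover have "0 \<le> ?P K x ^ Suc n" using nn by (rule zero_le_power)
      ultimately show ?thesis using F_bound[OF that, of n] by linarith
    qed
    show "F n \<in> borel_measurable borel" unfolding F_def by simp
  qed
  show ?thesis
  proof (rule has_mixture_transform_limit[OF F w F_bound])
    show "(\<lambda>n. F n x) \<longlonglongrightarrow> exp (- (\<bar>x\<bar> powr p))" if "x \<noteq> 0" for x
      using sibuya_power_limit[OF a, of "x\<^sup>2"] that by (simp add: F_def M_def sq)
  qed simp_all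
qed

lemma fourier_pair_gamma_p:
  assumes "0 < p"
  shows "fourier_pair (\<lambda>x. exp (- (\<bar>x\<bar> powr p))) (gamma_p p)"
  unfolding fourier_pair_def
proof (intro conjI allI)
  fix t
  show "complex_of_real (gamma_p p t) = (CLINT s|lborel. complex_of_real (exp (- (\<bar>s\<bar> powr p))) * iexp (t * s))"
    unfolding gamma_p_complex by (simp add: mult.commute)
qed (rule integrable_exp_neg_abs_powr[OF assms])

lemma gaussian_mixture_gamma_p:
  assumes p: "1 \<le> p" "p \<le> 2"
  shows "gaussian_mixture (gamma_p p)"
proof -
  obtain g where g: "gaussian_mixture g" "fourier_pair (\<lambda>x. exp (- (\<bar>x\<bar> powr p))) g"
    using has_mixture_transform_exp_neg_powr[OF p] unfolding has_mixture_transform_def by blast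
  have "g t = gamma_p p t" for t
    using fourier_pair_cos[OF g(2), of t] fourier_pair_cos[OF fourier_pair_gamma_p, of p t] p by simp
  then have "g = gamma_p p" by (rule ext)
  with g(1) show ?thesis by simp
qed

lemma gamma_p_0: "0 < p \<Longrightarrow> gamma_p p 0 = alpha_p p"
  using fourier_pair_cos[OF fourier_pair_gamma_p, of p 0] integrable_exp_neg_abs_powr(2)[of p] by simp

lemma gaussian_mixture_dilate:
  assumes "gaussian_mixture g" "0 < a" shows "gaussian_mixture (\<lambda>t. g (a * t))"
  using assms(1)
proof (induction rule: gaussian_mixture.induct)
  case (gauss \<omega>)
  have "gaussian_mixture (\<lambda>t. exp (- (\<omega> * a\<^sup>2) * t\<^sup>2))"
    using gauss assms(2) by (intro gaussian_mixture.gauss) auto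
  then show ?case by (simp add: power_mult_distrib mult.assoc)
next
  case (limit G C g)
  show ?case by (rule gaussian_mixture.limit[OF limit.IH limit.hyps(2,3)])
qed (auto intro: gaussian_mixture.intros)

section \<open>Smoothness and integral of the transform\<close>

text \<open>The real part of \<open>e\<^sup>i\<^sup>y\<close> times the Taylor remainder of \<open>e\<^sup>i\<^sup>k\<close>.\<close>

lemma cos_second_order: "\<bar>cos (y + k) - cos y + k * sin y\<bar> \<le> k\<^sup>2 / (2::real)"
proof -
  have "cos (y + k) - cos y + k * sin y = Re (iexp y * (iexp k - (\<Sum>m\<le>1. (\<i> * complex_of_real k) ^ m / fact m)))"
    by (simp add: Re_exp Im_exp cos_add algebra_simps)
  also have "\<bar>\<dots>\<bar> \<le> cmod (iexp y * (iexp k - (\<Sum>m\<le>1. (\<i> * complex_of_real k) ^ m / fact m)))"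
    by (rule abs_Re_le_cmod)
  also have "\<dots> = cmod (iexp k - (\<Sum>m\<le>1. (\<i> * complex_of_real k) ^ m / fact m))"
    by (simp add: norm_mult)
  also have "\<dots> \<le> \<bar>k\<bar> ^ Suc 1 / fact (Suc 1)"
    by (rule iexp_approx1)
  also have "\<dots> = k\<^sup>2 / 2"
    by (simp add: power2_eq_square)
  finally show ?thesis .
qed

text \<open>Differentiation under the integral sign: a finite second moment of \<open>f\<close> controls the second-order remainder of the cosine.\<close>

lemma fourier_pair_quadratic_taylor:
  assumes fg: "fourier_pair f g" and f0: "\<And>s. 0 \<le> f s" and f2: "integrable lborel (\<lambda>s. s\<^sup>2 * f s)"
    and g: "\<And>t. 0 \<le> g t" and meas: "g \<in> borel_measurable borel"
  shows "\<exists>M. quadratic_taylor 0 M g"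
proof -
  have f: "integrable lborel f" using fg by (simp add: fourier_pair_def)
  then have [measurable]: "f \<in> borel_measurable borel" by auto
  note gc = fourier_pair_cos[OF fg]
  define M where "M = (\<integral>s. f s \<partial>lborel) + (\<integral>s. s\<^sup>2 * f s \<partial>lborel)"
  have sum: "integrable lborel (\<lambda>s. f s + s\<^sup>2 * f s)" using f f2 by simp
  have M: "M = (\<integral>s. f s + s\<^sup>2 * f s \<partial>lborel)" using f f2 by (simp add: M_def)
  have dom: "integrable lborel h \<and> \<bar>\<integral>s. h s \<partial>lborel\<bar> \<le> C * M"
    if [measurable]: "h \<in> borel_measurable borel" and h: "\<And>s. \<bar>h s\<bar> \<le> C * (f s + s\<^sup>2 * f s)" for h C
  proof
    show int: "integrable lborel h"
      by (rule Bochner_Integration.integrable_bound[OF integrable_mult_right[OF sum, of C]])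
         (use h in \<open>auto intro!: AE_I2 intro: order_trans[OF _ abs_ge_self]\<close>)
    have "\<bar>\<integral>s. h s \<partial>lborel\<bar> \<le> (\<integral>s. \<bar>h s\<bar> \<partial>lborel)" by (rule integral_abs_bound)
    also have "\<dots> \<le> (\<integral>s. C * (f s + s\<^sup>2 * f s) \<partial>lborel)"
      using int sum h by (intro integral_mono) auto
    finally show "\<bar>\<integral>s. h s \<partial>lborel\<bar> \<le> C * M" by (simp add: M)
  qed
  have abs_le: "\<bar>s\<bar> \<le> 1 + s\<^sup>2" for s :: real
    using zero_le_power2[of "\<bar>s\<bar> - 1"] by (simp add: power2_diff)
  define g' where "g' t = - (\<integral>s. s * f s * sin (t * s) \<partial>lborel)" for t
  have i1: "integrable lborel (\<lambda>s. f s * cos (t * s)) \<and> \<bar>\<integral>s. f s * cos (t * s) \<partial>lborel\<bar> \<le> 1 * M" for t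
  proof (rule dom)
    fix s
    have "\<bar>f s * cos (t * s)\<bar> \<le> f s" using f0[of s] by (simp add: abs_mult mult_left_le)
    then show "\<bar>f s * cos (t * s)\<bar> \<le> 1 * (f s + s\<^sup>2 * f s)" using f0[of s] by (simp add: add_increasing2)
  qed simp
  have i2: "integrable lborel (\<lambda>s. s * f s * sin (t * s)) \<and> \<bar>\<integral>s. s * f s * sin (t * s) \<partial>lborel\<bar> \<le> 1 * M" for t
  proof (rule dom)
    fix s
    have "\<bar>s * f s * sin (t * s)\<bar> \<le> \<bar>s\<bar> * f s"
      using f0[of s] by (simp add: abs_mult mult_left_le)
    also have "\<dots> \<le> (1 + s\<^sup>2) * f s" using f0[of s] abs_le by (intro mult_right_mono) auto
    finally show "\<bar>s * f s * sin (t * s)\<bar> \<le> 1 * (f s + s\<^sup>2 * f s)" by (simp add: algebra_simps)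
  qed simp
  have T: "\<bar>g (t + h) - g t - h * g' t\<bar> \<le> M * h\<^sup>2" for t h
  proof -
    have eq: "g (t + h) - g t - h * g' t = (\<integral>s. f s * (cos (t * s + h * s) - cos (t * s) + (h * s) * sin (t * s)) \<partial>lborel)"
    proof -
      have "g (t + h) - g t - h * g' t = (\<integral>s. f s * cos ((t + h) * s) - f s * cos (t * s) + h * (s * f s * sin (t * s)) \<partial>lborel)"
        using i1 i2 by (simp add: gc g'_def)
      then show ?thesis by (simp add: algebra_simps)
    qed
    have "\<bar>\<integral>s. f s * (cos (t * s + h * s) - cos (t * s) + (h * s) * sin (t * s)) \<partial>lborel\<bar> \<le> h\<^sup>2 * M"
    proof (rule conjunct2[OF dom])
      fix s
      have "\<bar>f s * (cos (t * s + h * s) - cos (t * s) + (h * s) * sin (t * s))\<bar> \<le> f s * ((h * s)\<^sup>2 / 2)"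
        unfolding abs_mult[of "f s"] using f0[of s] cos_second_order[of "t * s" "h * s"] by (intro mult_mono) auto
      also have "\<dots> \<le> f s * (h\<^sup>2 * (1 + s\<^sup>2))"
        using f0[of s] by (intro mult_left_mono) (auto simp: power_mult_distrib algebra_simps)
      finally show "\<bar>f s * (cos (t * s + h * s) - cos (t * s) + (h * s) * sin (t * s))\<bar> \<le> h\<^sup>2 * (f s + s\<^sup>2 * f s)"
        by (simp add: algebra_simps)
    qed simp
    then show ?thesis by (simp add: eq mult.commute)
  qed
  have "g' \<in> borel_measurable borel" unfolding g'_def by measurable
  moreover have "\<bar>g' t\<bar> \<le> M" for t using i2[of t] by (simp add: g'_def)
  moreover have "g t \<le> M" for t using i1[of t] by (simp add: gc abs_le_iff)
  ultimately show ?thesis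
    using T g meas unfolding quadratic_taylor_def by (intro exI[of _ M]) blast
qed

lemma quadratic_taylor_dilate:
  assumes f: "quadratic_taylor 0 M f" and r: "0 \<le> r"
  shows "\<exists>M'. quadratic_taylor 0 M' (\<lambda>t. r * f (a * t))"
proof -
  obtain f' where [measurable]: "f' \<in> borel_measurable borel"
    and f': "\<And>x. \<bar>f' x\<bar> \<le> M" "\<And>x h. \<bar>f (x + h) - f x - h * f' x\<bar> \<le> M * h\<^sup>2"
    using f by (auto simp: quadratic_taylor_def)
  note [measurable] = quadratic_taylor_measurable[OF f]
  have bd: "0 \<le> f x" "f x \<le> M" for x using quadratic_taylor_bounds[OF f] by auto
  have M: "0 \<le> M" using bd[of 0] by simp
  define M' where "M' = r * M * (1 + \<bar>a\<bar> + a\<^sup>2)"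
  have rM: "0 \<le> r * M" using r M by simp
  have 1: "r * f (a * t) \<le> M'" for t
  proof -
    have "r * f (a * t) \<le> r * M * 1" using bd r by (simp add: mult_left_mono)
    also have "\<dots> \<le> M'" unfolding M'_def using rM by (intro mult_left_mono) auto
    finally show ?thesis .
  qed
  have 2: "\<bar>r * (a * f' (a * t))\<bar> \<le> M'" for t
  proof -
    have "\<bar>r * (a * f' (a * t))\<bar> = r * \<bar>a\<bar> * \<bar>f' (a * t)\<bar>" using r by (simp add: abs_mult)
    also have "\<dots> \<le> r * \<bar>a\<bar> * M" using r f'(1) by (intro mult_left_mono) auto
    also have "\<dots> = r * M * \<bar>a\<bar>" by simp
    also have "\<dots> \<le> M'" unfolding M'_def using rM by (intro mult_left_mono) auto
    finally show ?thesis .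
  qed
  have 3: "\<bar>r * f (a * (t + h)) - r * f (a * t) - h * (r * (a * f' (a * t)))\<bar> \<le> M' * h\<^sup>2" for t h
  proof -
    have "r * f (a * (t + h)) - r * f (a * t) - h * (r * (a * f' (a * t))) =
      r * (f (a * t + a * h) - f (a * t) - (a * h) * f' (a * t))" by (simp add: algebra_simps)
    then have "\<bar>r * f (a * (t + h)) - r * f (a * t) - h * (r * (a * f' (a * t)))\<bar> = 
      r * \<bar>f (a * t + a * h) - f (a * t) - (a * h) * f' (a * t)\<bar>" using r by (simp add: abs_mult)
    also have "\<dots> \<le> r * (M * (a * h)\<^sup>2)" using r f'(2) by (intro mult_left_mono) auto
    also have "\<dots> = (r * M * a\<^sup>2) * h\<^sup>2" by (simp add: power_mult_distrib)
    also have "\<dots> \<le> M' * h\<^sup>2" unfolding M'_def using rM by (intro mult_right_mono mult_left_mono) auto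
    finally show ?thesis .
  qed
  show ?thesis
    unfolding quadratic_taylor_def using bd r 1 2 3
    by (intro exI[of _ M'] conjI bexI[of _ "\<lambda>t. r * (a * f' (a * t))"] allI) auto
qed

lemma quadratic_taylor_gamma_p:
  assumes p: "1 \<le> p" "p \<le> 2"
  shows "\<exists>M. quadratic_taylor 0 M (gamma_p p)"
proof (rule fourier_pair_quadratic_taylor)
  show "fourier_pair (\<lambda>x. exp (- (\<bar>x\<bar> powr p))) (gamma_p p)" using p by (intro fourier_pair_gamma_p) auto
  show "0 \<le> gamma_p p t" for t by (rule gaussian_mixture_nonneg[OF gaussian_mixture_gamma_p[OF p]])
  show "gamma_p p \<in> borel_measurable borel" by (rule gaussian_mixture_measurable[OF gaussian_mixture_gamma_p[OF p]])
  show "integrable lborel (\<lambda>s. s\<^sup>2 * exp (- (\<bar>s\<bar> powr p)))"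
  proof (rule Bochner_Integration.integrable_bound)
    show "integrable lborel (\<lambda>s::real. 8 * exp 1 * exp (- (1/2) * \<bar>s\<bar>))"
      by (intro integrable_mult_right integrable_exp_neg_abs) auto
    show "AE s in lborel. norm (s\<^sup>2 * exp (- (\<bar>s\<bar> powr p))) \<le> norm (8 * exp 1 * exp (- (1/2) * \<bar>s::real\<bar>))"
    proof (rule AE_I2)
      fix s :: real
      have "1 + \<bar>s\<bar> / 2 + (\<bar>s\<bar> / 2)\<^sup>2 / 2 \<le> exp (\<bar>s\<bar> / 2)"
        by (rule exp_lower_Taylor_quadratic) simp
      then have "s\<^sup>2 / 8 \<le> exp (\<bar>s\<bar> / 2)" by (simp add: power_divide)
      moreover have "exp (- (\<bar>s\<bar> powr p)) \<le> exp (1 - \<bar>s\<bar>)"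
        using abs_minus_one_le_powr[OF p(1), of s] by simp
      ultimately have "s\<^sup>2 / 8 * exp (- (\<bar>s\<bar> powr p)) \<le> exp (\<bar>s\<bar> / 2) * exp (1 - \<bar>s\<bar>)"
        by (intro mult_mono) auto
      also have "\<dots> = exp 1 * exp (- (1/2) * \<bar>s\<bar>)" by (simp add: exp_add[symmetric])
      finally show "norm (s\<^sup>2 * exp (- (\<bar>s\<bar> powr p))) \<le> norm (8 * exp 1 * exp (- (1/2) * \<bar>s\<bar>))" by simp
    qed
  qed simp
qed simp

text \<open>Fatou's lemma when the bounds converge as well.\<close>

lemma nn_integral_le_of_tendsto:
  assumes [measurable]: "\<And>n. u n \<in> borel_measurable M" and lim: "AE x in M. (\<lambda>n. u n x) \<longlonglongrightarrow> f x"
    and le: "\<And>n. (\<integral>\<^sup>+x. u n x \<partial>M) \<le> (C n::ennreal)" and C: "C \<longlonglongrightarrow> c"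
  shows "(\<integral>\<^sup>+x. f x \<partial>M) \<le> c"
proof -
  have "(\<integral>\<^sup>+x. f x \<partial>M) = (\<integral>\<^sup>+x. liminf (\<lambda>n. u n x) \<partial>M)"
    using lim by (intro nn_integral_cong_AE) (auto elim!: eventually_mono simp: lim_imp_Liminf)
  also have "\<dots> \<le> liminf (\<lambda>n. \<integral>\<^sup>+x. u n x \<partial>M)"
    by (rule nn_integral_liminf) simp
  also have "\<dots> \<le> liminf C"
    by (intro Liminf_mono always_eventually allI le)
  also have "\<dots> = c" using C by (simp add: lim_imp_Liminf)
  finally show ?thesis .
qed

lemma nn_integral_std_normal:
  assumes [measurable]: "g \<in> borel_measurable borel" and a: "0 < a"
  shows "(\<integral>\<^sup>+x. g (a * x) \<partial>std_normal_distribution) = 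
    ennreal (1 / (a * sqrt (2 * pi))) * (\<integral>\<^sup>+t. ennreal (exp (- t\<^sup>2 / (2 * a\<^sup>2))) * g t \<partial>lborel)"
proof -
  have "(\<integral>\<^sup>+x. g (a * x) \<partial>std_normal_distribution) = (\<integral>\<^sup>+x. ennreal (std_normal_density x) * g (a * x) \<partial>lborel)"
    by (rule nn_integral_density) simp_all
  also have "\<dots> = ennreal \<bar>1 / a\<bar> * (\<integral>\<^sup>+t. ennreal (std_normal_density (0 + (1 / a) * t)) * g (a * (0 + (1 / a) * t)) \<partial>lborel)"
    using a by (intro nn_integral_real_affine) auto
  also have "\<dots> = ennreal (1 / a) * (\<integral>\<^sup>+t. ennreal (1 / sqrt (2 * pi)) * (ennreal (exp (- t\<^sup>2 / (2 * a\<^sup>2))) * g t) \<partial>lborel)"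
  proof -
    have "ennreal (std_normal_density (0 + (1 / a) * t)) * g (a * (0 + (1 / a) * t)) = 
        ennreal (1 / sqrt (2 * pi)) * (ennreal (exp (- t\<^sup>2 / (2 * a\<^sup>2))) * g t)" for t
    proof -
      have "std_normal_density (0 + (1 / a) * t) = (1 / sqrt (2 * pi)) * exp (- t\<^sup>2 / (2 * a\<^sup>2))"
        by (simp add: std_normal_density_def power_divide mult.commute)
      then have "ennreal (std_normal_density (0 + (1 / a) * t)) = ennreal (1 / sqrt (2 * pi)) * ennreal (exp (- t\<^sup>2 / (2 * a\<^sup>2)))"
        using ennreal_mult[of "1 / sqrt (2 * pi)" "exp (- t\<^sup>2 / (2 * a\<^sup>2))"] by (simp only:) simp
      then show ?thesis using a by (simp add: mult.assoc)
    qed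
    then show ?thesis using a by simp
  qed
  also have "\<dots> = ennreal (1 / (a * sqrt (2 * pi))) * (\<integral>\<^sup>+t. ennreal (exp (- t\<^sup>2 / (2 * a\<^sup>2))) * g t \<partial>lborel)"
    using a by (subst nn_integral_cmult) (simp_all add: mult.assoc[symmetric] ennreal_mult[symmetric])
  finally show ?thesis .
qed

text \<open>By Fourier inversion at the origin the integral is \<open>2 pi\<close> times the value at 0 of \<open>exp (- |x|\<^sup>p)\<close>. For the
inequality it is enough to average \<open>\<gamma>\<^sub>p\<close> over wider and wider Gaussians, and each average is an integral of
\<open>exp (- |x|\<^sup>p) \<le> 1\<close> against a Gaussian.\<close>

lemma nn_integral_gamma_p_le:
  assumes p: "1 \<le> p" "p \<le> 2"
  shows "(\<integral>\<^sup>+t. ennreal (gamma_p p t) \<partial>lborel) \<le> ennreal (2 * pi)"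
proof -
  let ?g = "gamma_p p" let ?f = "\<lambda>x. exp (- (\<bar>x\<bar> powr p))"
  have p0: "0 < p" using p by simp
  have fp: "fourier_pair ?f ?g" by (rule fourier_pair_gamma_p[OF p0])
  note mix = gaussian_mixture_gamma_p[OF p]
  note [measurable] = gaussian_mixture_measurable[OF mix]
  have g0: "0 \<le> ?g t" for t by (rule gaussian_mixture_nonneg[OF mix])
  obtain C where C: "\<And>t. ?g t \<le> C" using gaussian_mixture_bounded[OF mix] by blast
  interpret product_sigma_finite "\<lambda>_::unit. lborel :: real measure" by (rule sigma_finite_lborel_family)
  have bound: "(\<integral>\<^sup>+t. ennreal (exp (- t\<^sup>2 / (2 * real (Suc n)))) * ennreal (?g t) \<partial>lborel) \<le> ennreal (2 * pi)" for n
  proof -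
    define a where "a = sqrt (real (Suc n))"
    have a: "0 < a" "a\<^sup>2 = real (Suc n)" by (auto simp: a_def)
    have "(\<integral>x. ?g (a * x) \<partial>std_normal_distribution) = (\<integral>\<zeta>. (\<Prod>j\<in>{()}. ?g (\<Sum>i\<in>{()}. a * \<zeta> i)) \<partial>std_normals {()})"
      using integral_linear_form[of "{()}" ?g "\<lambda>_. a"] a(1) by simp
    also have "\<dots> = (\<integral>S. (\<Prod>j\<in>{()}. ?f (S j)) * exp (- (\<Sum>i\<in>{()}. (\<Sum>j\<in>{()}. a * S j)\<^sup>2) / 2) \<partial>Pi\<^sub>M {()} (\<lambda>_. lborel))"
      using fp by (intro gaussian_average_of_fourier_product) (auto simp: fourier_pair_def)
    also have "\<dots> = (\<integral>S. ?f (S ()) * exp (- (a * S ())\<^sup>2 / 2) \<partial>Pi\<^sub>M {()} (\<lambda>_. lborel))" by simp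
    also have "\<dots> = (\<integral>s. ?f s * exp (- (a * s)\<^sup>2 / 2) \<partial>lborel)"
      by (rule product_integral_singleton[where f = "\<lambda>s. ?f s * exp (- (a * s)\<^sup>2 / 2)"]) simp
    finally have E: "(\<integral>x. ?g (a * x) \<partial>std_normal_distribution) = (\<integral>s. ?f s * exp (- (a * s)\<^sup>2 / 2) \<partial>lborel)" .
    have gauss: "fourier_pair (\<lambda>s. exp (- (a\<^sup>2 / 2) * s\<^sup>2)) (\<lambda>t. sqrt (pi / (a\<^sup>2 / 2)) * exp (- (1 / (4 * (a\<^sup>2 / 2))) * t\<^sup>2))"
      using a(1) by (intro fourier_pair_gauss) simp
    have gi: "integrable lborel (\<lambda>s. exp (- (a * s)\<^sup>2 / 2))"
      using gauss by (simp add: fourier_pair_def power_mult_distrib)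
    have gv: "(\<integral>s. exp (- (a * s)\<^sup>2 / 2) \<partial>lborel) = sqrt (2 * pi) / a"
      using fourier_pair_cos[OF gauss, of 0] a(1) by (simp add: power_mult_distrib real_sqrt_divide mult.commute)
    have "(\<integral>s. ?f s * exp (- (a * s)\<^sup>2 / 2) \<partial>lborel) \<le> (\<integral>s. exp (- (a * s)\<^sup>2 / 2) \<partial>lborel)"
    proof (rule integral_mono[OF _ gi])
      show "integrable lborel (\<lambda>s. ?f s * exp (- (a * s)\<^sup>2 / 2))"
        by (rule Bochner_Integration.integrable_bound[OF gi]) (auto intro!: mult_left_le_one_le)
    qed (auto intro!: mult_left_le_one_le)
    then have E_le: "(\<integral>x. ?g (a * x) \<partial>std_normal_distribution) \<le> sqrt (2 * pi) / a" by (simp only: E gv)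
    have int: "integrable std_normal_distribution (\<lambda>x. ?g (a * x))"
      by (rule finite_measure.integrable_const_bound[where B = C, OF prob_space.finite_measure[OF prob_space_std_normal]])
         (use g0 C in auto)
    have "ennreal (1 / (a * sqrt (2 * pi))) * (\<integral>\<^sup>+t. ennreal (exp (- t\<^sup>2 / (2 * a\<^sup>2))) * ennreal (?g t) \<partial>lborel) =
      (\<integral>\<^sup>+x. ennreal (?g (a * x)) \<partial>std_normal_distribution)"
      by (rule nn_integral_std_normal[symmetric, OF _ a(1)]) simp
    also have "\<dots> = ennreal (\<integral>x. ?g (a * x) \<partial>std_normal_distribution)"
      using int g0 by (intro nn_integral_eq_integral) auto
    also have "\<dots> \<le> ennreal (sqrt (2 * pi) / a)" using E_le by (rule ennreal_leI)
    finally have le: "ennreal (1 / (a * sqrt (2 * pi))) * (\<integral>\<^sup>+t. ennreal (exp (- t\<^sup>2 / (2 * a\<^sup>2))) * ennreal (?g t) \<partial>lborel)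
       \<le> ennreal (sqrt (2 * pi) / a)" .
    let ?X = "\<integral>\<^sup>+t. ennreal (exp (- t\<^sup>2 / (2 * a\<^sup>2))) * ennreal (?g t) \<partial>lborel"
    have "?X = ennreal (a * sqrt (2 * pi)) * (ennreal (1 / (a * sqrt (2 * pi))) * ?X)"
      using a(1) by (simp add: mult.assoc[symmetric] ennreal_mult[symmetric])
    also have "\<dots> \<le> ennreal (a * sqrt (2 * pi)) * ennreal (sqrt (2 * pi) / a)"
      by (rule mult_left_mono[OF le]) simp
    also have "\<dots> = ennreal (2 * pi)"
      using a(1) by (simp add: ennreal_mult[symmetric])
    finally show ?thesis by (simp only: a(2))
  qed
  show ?thesis
  proof (rule nn_integral_le_of_tendsto[OF _ _ bound tendsto_const])
    show "AE t in lborel. (\<lambda>n. ennreal (exp (- t\<^sup>2 / (2 * real (Suc n)))) * ennreal (?g t)) \<longlonglongrightarrow> ennreal (?g t)"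
    proof (rule AE_I2)
      fix t
      have "(\<lambda>n. exp (- t\<^sup>2 / (2 * real (Suc n))) * ?g t) \<longlonglongrightarrow> exp 0 * ?g t"
        by (intro tendsto_intros) real_asymp
      then have "(\<lambda>n. ennreal (exp (- t\<^sup>2 / (2 * real (Suc n))) * ?g t)) \<longlonglongrightarrow> ennreal (?g t)"
        by (intro tendsto_ennrealI) simp
      then show "(\<lambda>n. ennreal (exp (- t\<^sup>2 / (2 * real (Suc n)))) * ennreal (?g t)) \<longlonglongrightarrow> ennreal (?g t)"
        using g0 by (simp add: ennreal_mult)
    qed
  qed simp
qed

lemma gamma_p_power_le:
  assumes p: "1 \<le> p" "p \<le> 2" and c: "0 < c" "c \<le> 1"
  shows "gamma_p p (sqrt c * t) powr (1 / c) \<le> alpha_p p powr (1 / c - 1) * gamma_p p t"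
proof (cases "c = 1")
  case True
  then show ?thesis using gaussian_mixture_nonneg[OF gaussian_mixture_gamma_p[OF p]] alpha_p_pos[of p] p by simp
next
  case False
  then have c1: "c < 1" using c by simp
  note g0 = gaussian_mixture_nonneg[OF gaussian_mixture_gamma_p[OF p]]
  have "gamma_p p (sqrt c * t) powr (1 / c) \<le> (gamma_p p t powr c * gamma_p p 0 powr (1 - c)) powr (1 / c)"
    using gaussian_mixture_log_convex_in_square[OF gaussian_mixture_gamma_p[OF p] c(1) c1] g0 c by (intro powr_mono2) auto
  also have "\<dots> = gamma_p p t * alpha_p p powr (1 / c - 1)"
    using g0[of t] c p by (simp add: powr_mult powr_powr gamma_p_0 diff_divide_distrib left_diff_distrib)
  finally show ?thesis by (simp add: mult.commute)
qed

section \<open>A lower bound for Gaussian averages of mixtures\<close>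

text \<open>The substitution \<open>x \<mapsto> \<sigma> x\<close>, with the quotient of the two Gaussian densities as weight.\<close>

lemma nn_integral_std_normals_scale:
  assumes I: "finite I" and F: "F \<in> borel_measurable (std_normals I)" and \<sigma>: "0 < \<sigma>"
  shows "(\<integral>\<^sup>+x. F x \<partial>std_normals I) =
    (\<integral>\<^sup>+x. ennreal (\<sigma> ^ card I * exp ((1 - \<sigma>\<^sup>2) / 2 * (\<Sum>i\<in>I. (x i)\<^sup>2))) * F (\<lambda>i\<in>I. \<sigma> * x i) \<partial>std_normals I)"
proof -
  let ?w = "\<lambda>t. ennreal (\<sigma> * exp ((1 - \<sigma>\<^sup>2) / 2 * t\<^sup>2))"
  have one: "(\<integral>\<^sup>+t. g t \<partial>std_normal_distribution) = (\<integral>\<^sup>+t. ?w t * g (\<sigma> * t) \<partial>std_normal_distribution)"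
    if [measurable]: "g \<in> borel_measurable borel" for g
  proof -
    have "(\<integral>\<^sup>+t. g t \<partial>std_normal_distribution) = (\<integral>\<^sup>+t. ennreal (std_normal_density t) * g t \<partial>lborel)"
      by (rule nn_integral_density) simp_all
    also have "\<dots> = ennreal \<bar>\<sigma>\<bar> * (\<integral>\<^sup>+t. ennreal (std_normal_density (0 + \<sigma> * t)) * g (0 + \<sigma> * t) \<partial>lborel)"
      using \<sigma> by (intro nn_integral_real_affine) auto
    also have "\<dots> = (\<integral>\<^sup>+t. ennreal \<sigma> * (ennreal (std_normal_density (\<sigma> * t)) * g (\<sigma> * t)) \<partial>lborel)"
      using \<sigma> by (subst nn_integral_cmult) simp_all
    also have "\<dots> = (\<integral>\<^sup>+t. ennreal (std_normal_density t) * (?w t * g (\<sigma> * t)) \<partial>lborel)"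
    proof (rule nn_integral_cong)
      fix t
      have "- (\<sigma> * t)\<^sup>2 / 2 = (1 - \<sigma>\<^sup>2) / 2 * t\<^sup>2 + - t\<^sup>2 / 2" by (simp add: power_mult_distrib field_simps)
      then have "\<sigma> * std_normal_density (\<sigma> * t) = std_normal_density t * (\<sigma> * exp ((1 - \<sigma>\<^sup>2) / 2 * t\<^sup>2))"
        by (simp only: std_normal_density_def exp_add) simp
      then have "ennreal \<sigma> * ennreal (std_normal_density (\<sigma> * t)) = ennreal (std_normal_density t) * ?w t"
        using \<sigma> by (simp only: ennreal_mult[symmetric] less_imp_le normal_density_nonneg mult_nonneg_nonneg exp_ge_zero)
      then show "ennreal \<sigma> * (ennreal (std_normal_density (\<sigma> * t)) * g (\<sigma> * t)) = ennreal (std_normal_density t) * (?w t * g (\<sigma> * t))"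
        by (simp only: mult.assoc[symmetric])
    qed
    also have "\<dots> = (\<integral>\<^sup>+t. ?w t * g (\<sigma> * t) \<partial>std_normal_distribution)"
      by (rule nn_integral_density[symmetric]) simp_all
    finally show ?thesis .
  qed
  have "(\<integral>\<^sup>+x. F x \<partial>std_normals I) = (\<integral>\<^sup>+x. (\<Prod>i\<in>I. ?w (x i)) * F (\<lambda>i\<in>I. \<sigma> * x i) \<partial>std_normals I)"
    by (rule nn_integral_PiM_substitute[OF _ _ _ _ one I F]) (simp_all add: prob_space_imp_sigma_finite)
  also have "\<dots> = (\<integral>\<^sup>+x. ennreal (\<sigma> ^ card I * exp ((1 - \<sigma>\<^sup>2) / 2 * (\<Sum>i\<in>I. (x i)\<^sup>2))) * F (\<lambda>i\<in>I. \<sigma> * x i) \<partial>std_normals I)"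
    using \<sigma> I by (intro nn_integral_cong) (simp add: prod_ennreal prod.distrib exp_sum[symmetric] sum_distrib_left)
  finally show ?thesis .
qed

text \<open>Rescale by \<open>\<sigma>\<close> so that the average of \<open>exp (- q)\<close> becomes \<open>\<sigma>\<^sup>d\<close> times the average of \<open>exp (\<sigma>\<^sup>2 u)\<close> with
\<open>u = \<tau> |\<zeta>|\<^sup>2 - q\<close>, where \<open>q\<close> is the quadratic form with trace \<open>W\<close>. The choice \<open>\<tau> = W / d\<close> gives \<open>u\<close>
mean zero, and then \<open>exp (\<sigma>\<^sup>2 u) \<ge> 1 + \<sigma>\<^sup>2 u\<close> suffices. Equality holds when \<open>q\<close> is a multiple of \<open>|\<zeta>|\<^sup>2\<close>.\<close>

lemma gaussian_quadratic_exponential_lower: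
  fixes B :: "'j \<Rightarrow> 'i \<Rightarrow> real"
  assumes I: "finite I" "I \<noteq> {}" and \<omega>: "\<And>j. j \<in> J \<Longrightarrow> 0 < \<omega> j" and J: "finite J"
  defines "W \<equiv> (\<Sum>j\<in>J. \<omega> j * (\<Sum>i\<in>I. (B j i)\<^sup>2))"
  shows "(1 + 2 * W / card I) powr (- (real (card I) / 2)) \<le>
    (\<integral>\<zeta>. exp (- (\<Sum>j\<in>J. \<omega> j * (\<Sum>i\<in>I. B j i * \<zeta> i)\<^sup>2)) \<partial>std_normals I)"
proof -
  interpret prob_space "std_normals I" by simp
  define d where "d = real (card I)"
  have d: "0 < d" using I by (simp add: d_def card_gt_0_iff)
  have W: "0 \<le> W" unfolding W_def using \<omega> by (intro sum_nonneg mult_nonneg_nonneg) (auto intro: less_imp_le)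
  \<comment> \<open>The multiple of \<open>|\<zeta>|\<^sup>2\<close> that has the same mean \<open>W\<close> as the quadratic form.\<close>
  define \<tau> where "\<tau> = W / d"
  have \<tau>: "0 \<le> \<tau>" using W d by (simp add: \<tau>_def)
  define \<sigma> where "\<sigma> = 1 / sqrt (1 + 2 * \<tau>)"
  have \<sigma>: "0 < \<sigma>" "\<sigma>\<^sup>2 = 1 / (1 + 2 * \<tau>)" using \<tau> by (auto simp: \<sigma>_def power_divide)
  define q where "q \<zeta> = (\<Sum>j\<in>J. \<omega> j * (\<Sum>i\<in>I. B j i * \<zeta> i)\<^sup>2)" for \<zeta>
  have q0: "0 \<le> q \<zeta>" for \<zeta> unfolding q_def using \<omega> by (intro sum_nonneg mult_nonneg_nonneg) (auto intro: less_imp_le)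
  have qm [measurable]: "q \<in> borel_measurable (std_normals I)"
    unfolding q_def by measurable
  define u where "u \<zeta> = \<tau> * (\<Sum>i\<in>I. (\<zeta> i)\<^sup>2) - q \<zeta>" for \<zeta>
  have coord: "integrable (std_normals I) (\<lambda>\<zeta>. (\<zeta> i)\<^sup>2) \<and> (\<integral>\<zeta>. (\<zeta> i)\<^sup>2 \<partial>std_normals I) = 1" if "i \<in> I" for i
  proof -
    have eq: "(\<Sum>l\<in>I. (if l = i then 1 else 0) * \<zeta> l) = \<zeta> i" for \<zeta> :: "'i \<Rightarrow> real"
    proof -
      have "(\<Sum>l\<in>I. (if l = i then 1 else 0) * \<zeta> l) = (\<Sum>l\<in>I. if l = i then \<zeta> l else 0)"
        by (intro sum.cong) auto
      then show ?thesis using that I(1) by simp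
    qed
    have eq2: "(\<Sum>l\<in>I. (if l = i then 1 else 0::real)\<^sup>2) = 1"
    proof -
      have "(\<Sum>l\<in>I. (if l = i then 1 else 0::real)\<^sup>2) = (\<Sum>l\<in>I. if l = i then 1 else 0)"
        by (intro sum.cong) auto
      then show ?thesis using that I(1) by simp
    qed
    show ?thesis
      using linear_form_moment(1)[OF I(1), of "\<lambda>l. if l = i then 1 else 0" 2] 
        linear_form_moment(3)[OF I(1), of "\<lambda>l. if l = i then 1 else 0"]
      unfolding eq eq2 by simp
  qed
  have qi: "integrable (std_normals I) q"
    unfolding q_def by (intro Bochner_Integration.integrable_sum integrable_mult_right linear_form_moment(1) I)
  have qe: "(\<integral>\<zeta>. q \<zeta> \<partial>std_normals I) = W"
    unfolding q_def W_def using linear_form_moment(1)[OF I(1), where n = 2] linear_form_moment(3)[OF I(1)]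
    by (subst Bochner_Integration.integral_sum) auto
  have ui: "integrable (std_normals I) u"
    unfolding u_def using coord qi by auto
  have ue: "(\<integral>\<zeta>. u \<zeta> \<partial>std_normals I) = 0"
  proof -
    have "(\<integral>\<zeta>. u \<zeta> \<partial>std_normals I) = \<tau> * (\<integral>\<zeta>. (\<Sum>i\<in>I. (\<zeta> i)\<^sup>2) \<partial>std_normals I) - W"
      unfolding u_def using coord qi qe by (subst Bochner_Integration.integral_diff) auto
    also have "(\<integral>\<zeta>. (\<Sum>i\<in>I. (\<zeta> i)\<^sup>2) \<partial>std_normals I) = d"
      using coord by (subst Bochner_Integration.integral_sum) (auto simp: d_def)
    finally show ?thesis using d by (simp add: \<tau>_def)
  qed
  have int: "integrable (std_normals I) (\<lambda>\<zeta>. exp (- q \<zeta>))"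
    by (rule integrable_const_bound[where B = 1]) (use q0 in auto)
  have pw: "ennreal (\<sigma> ^ card I) * ennreal (1 + \<sigma>\<^sup>2 * u \<zeta>) \<le> 
     ennreal (\<sigma> ^ card I * exp ((1 - \<sigma>\<^sup>2) / 2 * (\<Sum>i\<in>I. (\<zeta> i)\<^sup>2))) * ennreal (exp (- q (\<lambda>i\<in>I. \<sigma> * \<zeta> i)))" for \<zeta>
  proof -
    have qs: "q (\<lambda>i\<in>I. \<sigma> * \<zeta> i) = \<sigma>\<^sup>2 * q \<zeta>"
    proof -
      have "(\<Sum>i\<in>I. B j i * (\<lambda>i\<in>I. \<sigma> * \<zeta> i) i)\<^sup>2 = \<sigma>\<^sup>2 * (\<Sum>i\<in>I. B j i * \<zeta> i)\<^sup>2" for j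
        by (simp add: power_mult_distrib[symmetric] sum_distrib_left mult_ac)
      then show ?thesis by (simp add: q_def sum_distrib_left mult_ac)
    qed
    have "(1 - \<sigma>\<^sup>2) / 2 = \<sigma>\<^sup>2 * \<tau>" using \<tau> by (simp add: \<sigma>(2) field_simps)
    then have ex: "(1 - \<sigma>\<^sup>2) / 2 * (\<Sum>i\<in>I. (\<zeta> i)\<^sup>2) + - q (\<lambda>i\<in>I. \<sigma> * \<zeta> i) = \<sigma>\<^sup>2 * u \<zeta>"
      by (simp only: qs u_def) (simp add: right_diff_distrib)
    have "1 + \<sigma>\<^sup>2 * u \<zeta> \<le> exp (\<sigma>\<^sup>2 * u \<zeta>)" by (rule exp_ge_add_one_self)
    also have "\<dots> = exp ((1 - \<sigma>\<^sup>2) / 2 * (\<Sum>i\<in>I. (\<zeta> i)\<^sup>2)) * exp (- q (\<lambda>i\<in>I. \<sigma> * \<zeta> i))"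
      unfolding ex[symmetric] by (rule exp_add)
    finally have "\<sigma> ^ card I * (1 + \<sigma>\<^sup>2 * u \<zeta>) \<le> \<sigma> ^ card I * exp ((1 - \<sigma>\<^sup>2) / 2 * (\<Sum>i\<in>I. (\<zeta> i)\<^sup>2)) * exp (- q (\<lambda>i\<in>I. \<sigma> * \<zeta> i))"
      using \<sigma>(1) by (simp add: mult.assoc)
    then show ?thesis
      using \<sigma>(1) by (simp add: ennreal_mult'[symmetric] ennreal_mult''[symmetric] ennreal_leI)
  qed
  have um [measurable]: "u \<in> borel_measurable (std_normals I)" using ui by auto
  have "ennreal (\<sigma> ^ card I) = ennreal (\<sigma> ^ card I) * ennreal (\<integral>\<zeta>. 1 + \<sigma>\<^sup>2 * u \<zeta> \<partial>std_normals I)"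
    using ui ue by (simp add: prob_space)
  also have "\<dots> \<le> ennreal (\<sigma> ^ card I) * (\<integral>\<^sup>+\<zeta>. ennreal (1 + \<sigma>\<^sup>2 * u \<zeta>) \<partial>std_normals I)"
  proof (rule mult_left_mono)
    have i1: "integrable (std_normals I) (\<lambda>\<zeta>. 1 + \<sigma>\<^sup>2 * u \<zeta>)" using ui by simp
    have "ennreal (\<integral>\<zeta>. 1 + \<sigma>\<^sup>2 * u \<zeta> \<partial>std_normals I) \<le> ennreal (\<integral>\<zeta>. max 0 (1 + \<sigma>\<^sup>2 * u \<zeta>) \<partial>std_normals I)"
      using i1 by (intro ennreal_leI integral_mono) auto
    also have "\<dots> = (\<integral>\<^sup>+\<zeta>. ennreal (max 0 (1 + \<sigma>\<^sup>2 * u \<zeta>)) \<partial>std_normals I)"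
      using i1 by (intro nn_integral_eq_integral[symmetric]) auto
    also have "\<dots> = (\<integral>\<^sup>+\<zeta>. ennreal (1 + \<sigma>\<^sup>2 * u \<zeta>) \<partial>std_normals I)"
      by (intro nn_integral_cong) (auto simp: max_def ennreal_neg)
    finally show "ennreal (\<integral>\<zeta>. 1 + \<sigma>\<^sup>2 * u \<zeta> \<partial>std_normals I) \<le> \<dots>" .
  qed simp
  also have "\<dots> = (\<integral>\<^sup>+\<zeta>. ennreal (\<sigma> ^ card I) * ennreal (1 + \<sigma>\<^sup>2 * u \<zeta>) \<partial>std_normals I)"
    by (rule nn_integral_cmult[symmetric]) measurable
  also have "\<dots> \<le> (\<integral>\<^sup>+\<zeta>. ennreal (\<sigma> ^ card I * exp ((1 - \<sigma>\<^sup>2) / 2 * (\<Sum>i\<in>I. (\<zeta> i)\<^sup>2))) * ennreal (exp (- q (\<lambda>i\<in>I. \<sigma> * \<zeta> i))) \<partial>std_normals I)"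
    by (intro nn_integral_mono pw)
  also have "\<dots> = (\<integral>\<^sup>+\<zeta>. ennreal (exp (- q \<zeta>)) \<partial>std_normals I)"
    by (rule nn_integral_std_normals_scale[OF I(1) _ \<sigma>(1), symmetric]) measurable
  also have "\<dots> = ennreal (\<integral>\<zeta>. exp (- q \<zeta>) \<partial>std_normals I)"
    by (rule nn_integral_eq_integral[OF int]) simp
  finally have "\<sigma> ^ card I \<le> (\<integral>\<zeta>. exp (- q \<zeta>) \<partial>std_normals I)"
    by (subst (asm) ennreal_le_iff) (auto intro: Bochner_Integration.integral_nonneg)
  moreover have "\<sigma> ^ card I = (1 + 2 * W / card I) powr (- (real (card I) / 2))"
  proof -
    have "\<sigma> = (1 + 2 * \<tau>) powr (- (1/2))"
      using \<tau> by (simp add: \<sigma>_def powr_minus_divide powr_half_sqrt)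
    then have "\<sigma> ^ card I = ((1 + 2 * \<tau>) powr (- (1/2))) powr real (card I)"
      using \<sigma>(1) by (simp add: powr_realpow)
    also have "\<dots> = (1 + 2 * \<tau>) powr (- (real (card I) / 2))" by (simp add: powr_powr)
    finally show ?thesis by (simp add: \<tau>_def d_def)
  qed
  ultimately show ?thesis by (simp add: q_def)
qed

lemma gamma_laplace:
  fixes b \<kappa> :: real
  assumes b: "0 < b" and \<kappa>: "0 < \<kappa>"
  shows "(\<integral>\<^sup>+u. ennreal (indicator {0<..} u * u powr (b - 1) * exp (- \<kappa> * u)) \<partial>lborel) = ennreal (Gamma b / \<kappa> powr b)"
proof -
  have "ennreal (Gamma b) = (\<integral>\<^sup>+u. ennreal (indicator {0..} u * u powr (b - 1) / exp u) \<partial>lborel)"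
    by (rule Gamma_conv_nn_integral_real[OF b])
  also have "\<dots> = (\<integral>\<^sup>+u. ennreal (indicator {0<..} u * u powr (b - 1) * exp (- u)) \<partial>lborel)"
    by (intro nn_integral_cong) (auto simp: indicator_def exp_minus divide_inverse)
  also have "\<dots> = ennreal \<bar>\<kappa>\<bar> * (\<integral>\<^sup>+u. ennreal (indicator {0<..} (0 + \<kappa> * u) * (0 + \<kappa> * u) powr (b - 1) * exp (- (0 + \<kappa> * u))) \<partial>lborel)"
    using \<kappa> by (intro nn_integral_real_affine) auto
  also have "\<dots> = ennreal \<kappa> * (\<integral>\<^sup>+u. ennreal (\<kappa> powr (b - 1)) * ennreal (indicator {0<..} u * u powr (b - 1) * exp (- \<kappa> * u)) \<partial>lborel)"
  proof -
    have "ennreal (indicator {0<..} (0 + \<kappa> * u) * (0 + \<kappa> * u) powr (b - 1) * exp (- (0 + \<kappa> * u))) =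
      ennreal (\<kappa> powr (b - 1)) * ennreal (indicator {0<..} u * u powr (b - 1) * exp (- \<kappa> * u))" for u
      using \<kappa> by (auto simp: indicator_def zero_less_mult_iff powr_mult ennreal_mult[symmetric] mult_ac)
    then show ?thesis using \<kappa> by simp
  qed
  also have "\<dots> = ennreal \<kappa> * (ennreal (\<kappa> powr (b - 1)) * (\<integral>\<^sup>+u. ennreal (indicator {0<..} u * u powr (b - 1) * exp (- \<kappa> * u)) \<partial>lborel))"
    by (subst nn_integral_cmult) simp_all
  also have "\<dots> = ennreal (\<kappa> powr b) * (\<integral>\<^sup>+u. ennreal (indicator {0<..} u * u powr (b - 1) * exp (- \<kappa> * u)) \<partial>lborel)"
  proof -
    have "\<kappa> * \<kappa> powr (b - 1) = \<kappa> powr b"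
      using \<kappa> powr_add[of \<kappa> 1 "b - 1"] by simp
    then show ?thesis using \<kappa> by (simp add: mult.assoc[symmetric] ennreal_mult[symmetric])
  qed
  finally have eq: "ennreal (Gamma b) = ennreal (\<kappa> powr b) * (\<integral>\<^sup>+u. ennreal (indicator {0<..} u * u powr (b - 1) * exp (- \<kappa> * u)) \<partial>lborel)" .
  let ?X = "\<integral>\<^sup>+u. ennreal (indicator {0<..} u * u powr (b - 1) * exp (- \<kappa> * u)) \<partial>lborel"
  have "?X = ennreal (1 / \<kappa> powr b) * (ennreal (\<kappa> powr b) * ?X)"
    using \<kappa> by (simp add: mult.assoc[symmetric] ennreal_mult[symmetric])
  also have "\<dots> = ennreal (Gamma b / \<kappa> powr b)"
    unfolding eq[symmetric] using b \<kappa> by (simp add: ennreal_mult[symmetric] Gamma_real_pos less_imp_le)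
  finally show ?thesis .
qed

text \<open>For Gaussian \<open>g\<^sub>j\<close> the left-hand side is the Laplace transform of a Gamma distribution with shape \<open>d/2\<close> and rate
\<open>\<kappa>\<close>, evaluated at \<open>W\<close>, that is \<open>(1 + W / \<kappa>)\<^sup>-\<^sup>d\<^sup>/\<^sup>2\<close>: exactly what \<open>gaussian_quadratic_exponential_lower\<close> gives for the
forms \<open>sqrt T z\<^sub>j\<close>. Mixtures follow by multilinearity.\<close>

lemma gamma_mixture_lower:
  fixes B :: "'j \<Rightarrow> 'i \<Rightarrow> real" and T :: real
  assumes I: "finite I" "I \<noteq> {}" and J: "finite J" and g: "\<And>j. j \<in> J \<Longrightarrow> gaussian_mixture (g j)" and T: "0 < T"
  defines "b \<equiv> real (card I) / 2" and "\<kappa> \<equiv> real (card I) / (2 * T)"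
  shows "ennreal (\<kappa> powr b / Gamma b) * (\<integral>\<^sup>+u. ennreal (indicator {0<..} u * u powr (b - 1) * exp (- \<kappa> * u) *
            (\<Prod>j\<in>J. g j (sqrt (u * (\<Sum>i\<in>I. (B j i)\<^sup>2))))) \<partial>lborel)
    \<le> ennreal (\<integral>\<zeta>. (\<Prod>j\<in>J. g j (sqrt T * (\<Sum>i\<in>I. B j i * \<zeta> i))) \<partial>std_normals I)"
proof -
  have d: "0 < real (card I)" using I by (simp add: card_gt_0_iff)
  have b: "0 < b" and \<kappa>: "0 < \<kappa>" using d T by (auto simp: b_def \<kappa>_def)
  have G: "0 < Gamma b" using b by (rule Gamma_real_pos)
  define c where "c j = (\<Sum>i\<in>I. (B j i)\<^sup>2)" for j
  have c0: "0 \<le> c j" for j by (simp add: c_def sum_nonneg)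
  define \<rho> where "\<rho> u = \<kappa> powr b / Gamma b * (indicator {0<..} u * u powr (b - 1) * exp (- \<kappa> * u))" for u :: real
  have \<rho>0: "0 \<le> \<rho> u" for u using G by (auto simp: \<rho>_def)
  have \<rho>m [measurable]: "\<rho> \<in> borel_measurable borel" unfolding \<rho>_def by measurable
  define N where "N = density lborel (\<lambda>u. ennreal (\<rho> u))"
  have [measurable_cong]: "sets N = sets borel" by (simp add: N_def)
  have laplace: "(\<integral>\<^sup>+u. ennreal (exp (- w * u)) \<partial>N) = ennreal ((1 + w / \<kappa>) powr (- b))" if w: "0 \<le> w" for w
  proof -
    have "(\<integral>\<^sup>+u. ennreal (exp (- w * u)) \<partial>N) = (\<integral>\<^sup>+u. ennreal (\<rho> u) * ennreal (exp (- w * u)) \<partial>lborel)"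
      unfolding N_def by (rule nn_integral_density) simp_all
    also have "\<dots> = (\<integral>\<^sup>+u. ennreal (\<kappa> powr b / Gamma b) * ennreal (indicator {0<..} u * u powr (b - 1) * exp (- (\<kappa> + w) * u)) \<partial>lborel)"
    proof (rule nn_integral_cong)
      fix u
      have "\<rho> u * exp (- w * u) = \<kappa> powr b / Gamma b * (indicator {0<..} u * u powr (b - 1) * exp (- (\<kappa> + w) * u))"
        by (simp add: \<rho>_def algebra_simps exp_add exp_diff exp_minus divide_inverse)
      then show "ennreal (\<rho> u) * ennreal (exp (- w * u)) = ennreal (\<kappa> powr b / Gamma b) * ennreal (indicator {0<..} u * u powr (b - 1) * exp (- (\<kappa> + w) * u))"
        using G \<rho>0 by (subst (1 2) ennreal_mult[symmetric]) auto
    qed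
    also have "\<dots> = ennreal (\<kappa> powr b / Gamma b) * ennreal (Gamma b / (\<kappa> + w) powr b)"
      using b \<kappa> w by (subst nn_integral_cmult) (simp, subst gamma_laplace, simp_all)
    also have "\<dots> = ennreal ((1 + w / \<kappa>) powr (- b))"
    proof -
      have "\<kappa> powr b / Gamma b * (Gamma b / (\<kappa> + w) powr b) = (\<kappa> / (\<kappa> + w)) powr b"
        using G \<kappa> w by (simp add: powr_divide)
      also have "\<kappa> / (\<kappa> + w) = inverse (1 + w / \<kappa>)" using \<kappa> w by (simp add: field_simps)
      also have "inverse (1 + w / \<kappa>) powr b = (1 + w / \<kappa>) powr (- b)"
        by (metis powr_minus inverse_powr)
      finally show ?thesis using G by (simp add: ennreal_mult[symmetric])
    qed
    finally show ?thesis .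
  qed
  have N1: "emeasure N (space N) = 1"
    using laplace[of 0] by simp
  then have fin: "finite_measure N" by (intro finite_measureI) simp
  interpret N: finite_measure N by fact
  have AEpos: "AE u in N. 0 < u"
    unfolding N_def by (subst AE_density) (auto intro!: AE_I2 simp: \<rho>_def indicator_def)
  define Y where "Y u j = sqrt (u * c j)" for u j
  have Ym [measurable]: "(\<lambda>u. Y u j) \<in> borel_measurable N" for j unfolding Y_def N_def by measurable
  have comp: "(\<integral>u. (\<Prod>j\<in>J. g j (Y u j)) \<partial>N) \<le> (\<integral>\<zeta>. (\<Prod>j\<in>J. g j (sqrt T * (\<Sum>i\<in>I. B j i * \<zeta> i))) \<partial>std_normals I)"
  proof (rule gaussian_mixture_multilinear_comparison[OF J _ fin _ Ym _ g])
    show "finite_measure (std_normals I)" by (simp add: prob_space.finite_measure)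
    show "(\<lambda>x. sqrt T * (\<Sum>i\<in>I. B j i * x i)) \<in> borel_measurable (std_normals I)" for j by measurable
    fix \<omega> :: "'j \<Rightarrow> real" assume \<omega>: "\<And>j. j \<in> J \<Longrightarrow> 0 < \<omega> j"
    define w where "w = (\<Sum>j\<in>J. \<omega> j * c j)"
    have w: "0 \<le> w" unfolding w_def using \<omega> c0 by (intro sum_nonneg mult_nonneg_nonneg) (auto intro: less_imp_le)
    have i: "integrable N (\<lambda>u. exp (- w * u))"
    proof (rule integrableI_bounded)
      show "(\<integral>\<^sup>+u. ennreal (norm (exp (- w * u))) \<partial>N) < \<infinity>" using laplace[OF w] by simp
    qed (simp add: N_def)
    have "(\<integral>u. exp (- (\<Sum>j\<in>J. \<omega> j * (Y u j)\<^sup>2)) \<partial>N) = (\<integral>u. exp (- w * u) \<partial>N)"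
    proof (rule integral_cong_AE)
      show "AE u in N. exp (- (\<Sum>j\<in>J. \<omega> j * (Y u j)\<^sup>2)) = exp (- w * u)"
        using AEpos
      proof eventually_elim
        fix u :: real assume "0 < u"
        then show "exp (- (\<Sum>j\<in>J. \<omega> j * (Y u j)\<^sup>2)) = exp (- w * u)"
          using c0 by (simp add: Y_def w_def sum_distrib_left mult_ac)
      qed
    qed measurable
    also have "\<dots> = (1 + w / \<kappa>) powr (- b)"
    proof -
      have "ennreal (\<integral>u. exp (- w * u) \<partial>N) = ennreal ((1 + w / \<kappa>) powr (- b))"
        using nn_integral_eq_integral[OF i] laplace[OF w] by simp
      then show ?thesis by (simp add: ennreal_inj)
    qed
    also have "\<dots> = (1 + 2 * (\<Sum>j\<in>J. \<omega> j * (\<Sum>i\<in>I. (sqrt T * B j i)\<^sup>2)) / card I) powr (- (real (card I) / 2))"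
    proof -
      have "(\<Sum>j\<in>J. \<omega> j * (\<Sum>i\<in>I. (sqrt T * B j i)\<^sup>2)) = T * w"
        using T by (simp add: power_mult_distrib w_def c_def sum_distrib_left mult_ac)
      then show ?thesis using T by (simp add: b_def \<kappa>_def mult_ac)
    qed
    also have "\<dots> \<le> (\<integral>\<zeta>. exp (- (\<Sum>j\<in>J. \<omega> j * (\<Sum>i\<in>I. (sqrt T * B j i) * \<zeta> i)\<^sup>2)) \<partial>std_normals I)"
      by (rule gaussian_quadratic_exponential_lower[OF I \<omega> J])
    finally show "(\<integral>u. exp (- (\<Sum>j\<in>J. \<omega> j * (Y u j)\<^sup>2)) \<partial>N) \<le> (\<integral>\<zeta>. exp (- (\<Sum>j\<in>J. \<omega> j * (sqrt T * (\<Sum>i\<in>I. B j i * \<zeta> i))\<^sup>2)) \<partial>std_normals I)"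
      by (simp add: sum_distrib_left mult.assoc)
  qed
  have g0: "0 \<le> g j t" if "j \<in> J" for j t using gaussian_mixture_nonneg[OF g[OF that]] .
  have [measurable]: "g j \<in> borel_measurable borel" if "j \<in> J" for j using gaussian_mixture_measurable[OF g[OF that]] .
  have "\<forall>j\<in>J. \<exists>C\<ge>0. \<forall>t. g j t \<le> C" using g gaussian_mixture_bounded by blast
  then obtain D where D: "\<And>j t. j \<in> J \<Longrightarrow> g j t \<le> D j" by metis
  have int: "integrable N (\<lambda>u. \<Prod>j\<in>J. g j (Y u j))"
  proof (rule N.integrable_const_bound[where B = "\<Prod>j\<in>J. D j"], rule AE_I2)
    fix u
    have "(\<Prod>j\<in>J. g j (Y u j)) \<le> (\<Prod>j\<in>J. D j)" using g0 D by (intro prod_mono) auto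
    then show "norm (\<Prod>j\<in>J. g j (Y u j)) \<le> (\<Prod>j\<in>J. D j)" using g0 by (simp add: prod_nonneg)
  qed measurable
  have "ennreal (\<integral>u. (\<Prod>j\<in>J. g j (Y u j)) \<partial>N) = (\<integral>\<^sup>+u. ennreal (\<Prod>j\<in>J. g j (Y u j)) \<partial>N)"
    using int g0 by (intro nn_integral_eq_integral[symmetric]) (auto intro!: prod_nonneg)
  also have "\<dots> = (\<integral>\<^sup>+u. ennreal (\<rho> u) * ennreal (\<Prod>j\<in>J. g j (Y u j)) \<partial>lborel)"
    unfolding N_def by (rule nn_integral_density) (simp_all add: Y_def)
  also have "\<dots> = (\<integral>\<^sup>+u. ennreal (\<kappa> powr b / Gamma b) * ennreal (indicator {0<..} u * u powr (b - 1) * exp (- \<kappa> * u) * (\<Prod>j\<in>J. g j (Y u j))) \<partial>lborel)"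
    using G g0 by (intro nn_integral_cong) (simp add: \<rho>_def ennreal_mult[symmetric] prod_nonneg mult.assoc)
  also have "\<dots> = ennreal (\<kappa> powr b / Gamma b) * (\<integral>\<^sup>+u. ennreal (indicator {0<..} u * u powr (b - 1) * exp (- \<kappa> * u) * (\<Prod>j\<in>J. g j (Y u j))) \<partial>lborel)"
    by (rule nn_integral_cmult) (simp add: Y_def)
  finally show ?thesis
    using ennreal_leI[OF comp] by (simp only: Y_def c_def)
qed

section \<open>The integral over a section and its limit representation\<close>

lemma nn_integral_mult_normal_density:
  assumes [measurable]: "f \<in> borel_measurable borel" and f: "\<And>s. 0 \<le> f s" and \<sigma>: "0 < \<sigma>"
  shows "(\<integral>\<^sup>+s. ennreal (f s * normal_density y \<sigma> s) \<partial>lborel) = (\<integral>\<^sup>+x. ennreal (f (y + \<sigma> * x)) \<partial>std_normal_distribution)"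
proof -
  have "(\<integral>\<^sup>+s. ennreal (f s * normal_density y \<sigma> s) \<partial>lborel) = 
     ennreal \<bar>\<sigma>\<bar> * (\<integral>\<^sup>+x. ennreal (f (y + \<sigma> * x) * normal_density y \<sigma> (y + \<sigma> * x)) \<partial>lborel)"
    using \<sigma> by (intro nn_integral_real_affine) auto
  also have "\<dots> = (\<integral>\<^sup>+x. ennreal \<sigma> * ennreal (f (y + \<sigma> * x) * normal_density y \<sigma> (y + \<sigma> * x)) \<partial>lborel)"
    using \<sigma> by (subst nn_integral_cmult) simp_all
  also have "\<dots> = (\<integral>\<^sup>+x. ennreal (std_normal_density x) * ennreal (f (y + \<sigma> * x)) \<partial>lborel)"
  proof (rule nn_integral_cong)
    fix x
    have "\<sigma> * normal_density y \<sigma> (y + \<sigma> * x) = std_normal_density x"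
      using \<sigma> by (simp add: normal_density_def power_mult_distrib real_sqrt_mult)
    then have "\<sigma> * (f (y + \<sigma> * x) * normal_density y \<sigma> (y + \<sigma> * x)) = std_normal_density x * f (y + \<sigma> * x)"
      by (metis mult.commute mult.left_commute)
    then show "ennreal \<sigma> * ennreal (f (y + \<sigma> * x) * normal_density y \<sigma> (y + \<sigma> * x)) = ennreal (std_normal_density x) * ennreal (f (y + \<sigma> * x))"
      using \<sigma> f by (simp add: ennreal_mult[symmetric])
  qed
  also have "\<dots> = (\<integral>\<^sup>+x. ennreal (f (y + \<sigma> * x)) \<partial>std_normal_distribution)"
    by (rule nn_integral_density[symmetric]) simp_all
  finally show ?thesis .
qed

lemma nn_integral_exp_abs_std_normal_finite:
  "(\<integral>\<^sup>+x. ennreal (exp (c * \<bar>x\<bar>)) \<partial>std_normal_distribution) < \<infinity>"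
proof -
  have int: "integrable lborel (\<lambda>x::real. exp (c\<^sup>2) * exp (- (1/4) * x\<^sup>2))"
    using fourier_pair_gauss[of "1/4"] by (intro integrable_mult_right) (simp add: fourier_pair_def)
  have "(\<integral>\<^sup>+x. ennreal (exp (c * \<bar>x\<bar>)) \<partial>std_normal_distribution) = 
     (\<integral>\<^sup>+x. ennreal (std_normal_density x) * ennreal (exp (c * \<bar>x\<bar>)) \<partial>lborel)"
    by (rule nn_integral_density) simp_all
  also have "\<dots> \<le> (\<integral>\<^sup>+x. ennreal (exp (c\<^sup>2) * exp (- (1/4) * x\<^sup>2)) \<partial>lborel)"
  proof (rule nn_integral_mono)
    fix x :: real
    have "std_normal_density x \<le> exp (- x\<^sup>2 / 2)"
      using pi_gt3 by (simp add: std_normal_density_def divide_le_eq)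
    then have "std_normal_density x * exp (c * \<bar>x\<bar>) \<le> exp (- x\<^sup>2 / 2) * exp (c * \<bar>x\<bar>)"
      by (intro mult_right_mono) auto
    also have "\<dots> \<le> exp (c\<^sup>2) * exp (- (1/4) * x\<^sup>2)"
      using zero_le_power2[of "c - \<bar>x\<bar> / 2"]
      by (simp add: exp_add[symmetric] power2_diff power_divide)
    finally show "ennreal (std_normal_density x) * ennreal (exp (c * \<bar>x\<bar>)) \<le> ennreal (exp (c\<^sup>2) * exp (- (1/4) * x\<^sup>2))"
      by (simp add: ennreal_mult[symmetric] ennreal_leI)
  qed
  also have "\<dots> < \<infinity>"
    using integrableD(2)[OF int] by (simp add: less_top)
  finally show ?thesis .
qed

text \<open>Convolution with a narrowing Gaussian converges to the function itself, and, since \<open>|s|\<^sup>p \<ge> |s| - 1\<close>, it keeps an exponential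
bound that is uniform in the width.\<close>

lemma smoothed_exp_neg_powr:
  fixes A p :: real
  assumes A: "0 < A" and p: "1 \<le> p"
  defines "f \<equiv> \<lambda>s. exp (- (\<bar>s / A\<bar> powr p))"
  defines "F \<equiv> \<lambda>n y. \<integral>\<^sup>+s. ennreal (f s * normal_density y (1 / sqrt (real (Suc n))) s) \<partial>lborel"
  shows "(\<lambda>n. F n y) \<longlonglongrightarrow> ennreal (f y)"
    and "\<exists>D\<ge>0. \<forall>n y. F n y \<le> ennreal (D * exp (- \<bar>y\<bar> / A))"
proof -
  have fm [measurable]: "f \<in> borel_measurable borel" unfolding f_def by measurable
  have F: "F n y = (\<integral>\<^sup>+x. ennreal (f (y + 1 / sqrt (real (Suc n)) * x)) \<partial>std_normal_distribution)" for n y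
    unfolding F_def by (rule nn_integral_mult_normal_density) (auto simp: f_def)
  have f1: "f s \<le> 1" for s by (simp add: f_def)
  have fc: "isCont f s" for s
    unfolding f_def using p A by (intro continuous_intros) auto
  show "(\<lambda>n. F n y) \<longlonglongrightarrow> ennreal (f y)"
  proof -
    have "(\<lambda>n. \<integral>\<^sup>+x. ennreal (f (y + 1 / sqrt (real (Suc n)) * x)) \<partial>std_normal_distribution) 
       \<longlonglongrightarrow> (\<integral>\<^sup>+x. ennreal (f y) \<partial>std_normal_distribution)"
    proof (rule nn_integral_dominated_convergence[where w = "\<lambda>_. 1"])
      show "(\<integral>\<^sup>+x. 1 \<partial>std_normal_distribution) < \<infinity>"
        using prob_space.emeasure_space_1[OF prob_space_std_normal] by simp
      show "AE x in std_normal_distribution. (\<lambda>n. ennreal (f (y + 1 / sqrt (real (Suc n)) * x))) \<longlonglongrightarrow> ennreal (f y)"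
      proof (intro AE_I2 tendsto_ennrealI isCont_tendsto_compose[OF fc])
        fix x :: real
        have "(\<lambda>n. 1 / sqrt (real (Suc n))) \<longlonglongrightarrow> 0" by real_asymp
        then have "(\<lambda>n. y + 1 / sqrt (real (Suc n)) * x) \<longlonglongrightarrow> y + 0 * x"
          by (intro tendsto_intros)
        then show "(\<lambda>n. y + 1 / sqrt (real (Suc n)) * x) \<longlonglongrightarrow> y" by simp
      qed
    qed (use f1 in auto)
    then show ?thesis
      using prob_space.emeasure_space_1[OF prob_space_std_normal] by (simp add: F)
  qed
  obtain E where E: "0 \<le> E" "(\<integral>\<^sup>+x. ennreal (exp ((1 / A) * \<bar>x\<bar>)) \<partial>std_normal_distribution) = ennreal E"
    using nn_integral_exp_abs_std_normal_finite[of "1 / A"] by (auto elim!: less_top_ennreal[THEN iffD1, elim_format])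
  have "F n y \<le> ennreal (exp 1 * E * exp (- \<bar>y\<bar> / A))" for n y
  proof -
    have "F n y \<le> (\<integral>\<^sup>+x. ennreal (exp 1 * exp (- \<bar>y\<bar> / A)) * ennreal (exp ((1 / A) * \<bar>x\<bar>)) \<partial>std_normal_distribution)"
      unfolding F
    proof (rule nn_integral_mono)
      fix x :: real
      define \<sigma> where "\<sigma> = 1 / sqrt (real (Suc n))"
      have \<sigma>: "0 < \<sigma>" "\<sigma> \<le> 1" by (auto simp: \<sigma>_def)
      have "\<bar>y\<bar> - \<bar>x\<bar> \<le> \<bar>y\<bar> - \<sigma> * \<bar>x\<bar>" using \<sigma> by (simp add: mult_left_le_one_le)
      also have "\<dots> \<le> \<bar>y + \<sigma> * x\<bar>" 
        using abs_triangle_ineq4[of "y + \<sigma> * x" "\<sigma> * x"] \<sigma> by (simp add: abs_mult)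
      finally have "(\<bar>y\<bar> - \<bar>x\<bar>) / A \<le> \<bar>(y + \<sigma> * x) / A\<bar>" using A by (simp add: divide_right_mono)
      then have "(\<bar>y\<bar> - \<bar>x\<bar>) / A - 1 \<le> \<bar>(y + \<sigma> * x) / A\<bar> powr p"
        using abs_minus_one_le_powr[OF p, of "(y + \<sigma> * x) / A"] by linarith
      then have "f (y + \<sigma> * x) \<le> exp (1 - (\<bar>y\<bar> - \<bar>x\<bar>) / A)" by (simp add: f_def)
      also have "1 - (\<bar>y\<bar> - \<bar>x\<bar>) / A = 1 + - \<bar>y\<bar> / A + (1 / A) * \<bar>x\<bar>" by (simp add: diff_divide_distrib)
      also have "exp \<dots> = exp 1 * exp (- \<bar>y\<bar> / A) * exp ((1 / A) * \<bar>x\<bar>)" by (simp only: exp_add)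
      finally show "ennreal (f (y + 1 / sqrt (real (Suc n)) * x)) \<le> ennreal (exp 1 * exp (- \<bar>y\<bar> / A)) * ennreal (exp ((1 / A) * \<bar>x\<bar>))"
        by (simp add: \<sigma>_def ennreal_mult[symmetric] ennreal_leI)
    qed
    also have "\<dots> = ennreal (exp 1 * exp (- \<bar>y\<bar> / A)) * ennreal E"
      unfolding E(2)[symmetric] by (rule nn_integral_cmult) simp
    also have "\<dots> = ennreal (exp 1 * E * exp (- \<bar>y\<bar> / A))"
      using E(1) by (simp add: ennreal_mult[symmetric] mult_ac)
    finally show ?thesis .
  qed
  then show "\<exists>D\<ge>0. \<forall>n y. F n y \<le> ennreal (D * exp (- \<bar>y\<bar> / A))"
    using E(1) by (intro exI[of _ "exp 1 * E"]) auto
qed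

text \<open>If \<open>f\<close> is not integrable, the left-hand side is 0 by convention.\<close>

lemma ennreal_integral_le_nn_integral:
  assumes "f \<in> borel_measurable M" "\<And>x. 0 \<le> f x"
  shows "ennreal (\<integral>x. f x \<partial>M) \<le> (\<integral>\<^sup>+x. ennreal (f x) \<partial>M)"
  using assms by (cases "integrable M f") (simp_all add: nn_integral_eq_integral not_integrable_integral_eq)

text \<open>The columns of \<open>a\<close> form an orthonormal basis of a subspace of \<open>\<real>\<^sup>J\<close>, parametrised by \<open>\<real>\<^sup>K\<close>; the rows of
\<open>B\<close> are the projections of the unit vectors to its orthogonal complement, in coordinates indexed by \<open>I\<close>.\<close>

locale section_data =
  fixes J :: "'j set" and K :: "'b set" and I :: "'i set" and a :: "'j \<Rightarrow> 'b \<Rightarrow> real" and B :: "'j \<Rightarrow> 'i \<Rightarrow> real"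
    and A :: "'j \<Rightarrow> real" and p :: real
  assumes fin: "finite J" "finite K" "finite I" and card: "card J = card K + card I"
    and orth: "\<And>b b'. b \<in> K \<Longrightarrow> b' \<in> K \<Longrightarrow> (\<Sum>j\<in>J. a j b * a j b') = (if b = b' then 1 else 0)"
    and compl: "\<And>j j'. j \<in> J \<Longrightarrow> j' \<in> J \<Longrightarrow> (\<Sum>i\<in>I. B j i * B j' i) = (if j = j' then 1 else 0) - (\<Sum>b\<in>K. a j b * a j' b)"
    and A: "\<And>j. j \<in> J \<Longrightarrow> 0 < A j"
    and p: "1 \<le> p" "p \<le> 2"
begin

definition form :: "('b \<Rightarrow> real) \<Rightarrow> 'j \<Rightarrow> real" where
  "form x j = (\<Sum>b\<in>K. a j b * x b)"

definition section_integral :: ennreal where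
  "section_integral = (\<integral>\<^sup>+x. ennreal (\<Prod>j\<in>J. exp (- (\<bar>form x j / A j\<bar> powr p))) \<partial>Pi\<^sub>M K (\<lambda>_. lborel))"

text \<open>The squared length of the projection of the \<open>j\<close>-th unit vector to the complement; it is \<open>1 - ct\<^sub>j\<close> in the application.\<close>

definition complement_weight :: "'j \<Rightarrow> real" where
  "complement_weight j = (\<Sum>i\<in>I. (B j i)\<^sup>2)"

definition gauss_average :: "real \<Rightarrow> real" where
  "gauss_average T = (\<integral>\<zeta>. (\<Prod>j\<in>J. A j * gamma_p p (A j * (sqrt T * (\<Sum>i\<in>I. B j i * \<zeta> i)))) \<partial>std_normals I)"

lemma p0: "0 < p" using p by simp

lemma form_measurable [measurable]: "(\<lambda>x. form x j) \<in> borel_measurable (Pi\<^sub>M K (\<lambda>_. lborel))"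
  unfolding form_def by measurable

lemma complement_weight_eq: "j \<in> J \<Longrightarrow> complement_weight j = 1 - (\<Sum>b\<in>K. (a j b)\<^sup>2)"
  using compl[of j j] by (simp add: complement_weight_def power2_eq_square)

lemma complement_weight_range: "0 \<le> complement_weight j" "j \<in> J \<Longrightarrow> complement_weight j \<le> 1"
proof -
  show "0 \<le> complement_weight j" by (simp add: complement_weight_def sum_nonneg)
  show "complement_weight j \<le> 1" if "j \<in> J" using complement_weight_eq[OF that] by (simp add: sum_nonneg)
qed

lemma sum_complement_weight: "(\<Sum>j\<in>J. complement_weight j) = real (card I)"
proof -
  have "(\<Sum>j\<in>J. complement_weight j) = (\<Sum>j\<in>J. 1 - (\<Sum>b\<in>K. (a j b)\<^sup>2))" by (simp add: complement_weight_eq)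
  also have "\<dots> = real (card J) - (\<Sum>b\<in>K. \<Sum>j\<in>J. (a j b)\<^sup>2)"
    by (simp add: sum_subtractf) (rule sum.swap)
  also have "(\<Sum>b\<in>K. \<Sum>j\<in>J. (a j b)\<^sup>2) = (\<Sum>b\<in>K. 1)"
    using orth by (intro sum.cong) (auto simp: power2_eq_square)
  finally show ?thesis by (simp add: card)
qed

lemma B_contraction:
  assumes S: "S \<subseteq> J"
  shows "(\<Sum>i\<in>I. (\<Sum>j\<in>S. \<mu> j * B j i)\<^sup>2) \<le> (\<Sum>j\<in>S. (\<mu> j)\<^sup>2)"
proof -
  have finS: "finite S" using S fin finite_subset by blast
  have "(\<Sum>i\<in>I. (\<Sum>j\<in>S. \<mu> j * B j i)\<^sup>2) = (\<Sum>i\<in>I. \<Sum>j\<in>S. \<Sum>j'\<in>S. (\<mu> j * B j i) * (\<mu> j' * B j' i))"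
    by (simp add: power2_eq_square sum_product)
  also have "\<dots> = (\<Sum>j\<in>S. \<Sum>j'\<in>S. \<Sum>i\<in>I. (\<mu> j * B j i) * (\<mu> j' * B j' i))"
    by (subst sum.swap, intro sum.cong refl, subst sum.swap, rule refl)
  also have "\<dots> = (\<Sum>j\<in>S. \<Sum>j'\<in>S. (\<mu> j * \<mu> j') * (\<Sum>i\<in>I. B j i * B j' i))"
    by (simp add: sum_distrib_left mult_ac)
  also have "\<dots> = (\<Sum>j\<in>S. \<Sum>j'\<in>S. (if j = j' then \<mu> j * \<mu> j' else 0) - (\<Sum>b\<in>K. (\<mu> j * a j b) * (\<mu> j' * a j' b)))"
  proof (intro sum.cong refl)
    fix j j' assume "j \<in> S" "j' \<in> S"
    then have "j \<in> J" "j' \<in> J" using S by auto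
    then show "(\<mu> j * \<mu> j') * (\<Sum>i\<in>I. B j i * B j' i) = (if j = j' then \<mu> j * \<mu> j' else 0) - (\<Sum>b\<in>K. (\<mu> j * a j b) * (\<mu> j' * a j' b))"
      by (auto simp: compl algebra_simps sum_distrib_left)
  qed
  also have "\<dots> = (\<Sum>j\<in>S. (\<mu> j)\<^sup>2) - (\<Sum>j\<in>S. \<Sum>j'\<in>S. \<Sum>b\<in>K. (\<mu> j * a j b) * (\<mu> j' * a j' b))"
    using finS by (simp add: sum_subtractf power2_eq_square)
  also have "(\<Sum>j\<in>S. \<Sum>j'\<in>S. \<Sum>b\<in>K. (\<mu> j * a j b) * (\<mu> j' * a j' b)) = (\<Sum>b\<in>K. \<Sum>j\<in>S. \<Sum>j'\<in>S. (\<mu> j * a j b) * (\<mu> j' * a j' b))"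
    by (subst (2) sum.swap, subst sum.swap, rule refl)
  also have "\<dots> = (\<Sum>b\<in>K. (\<Sum>j\<in>S. \<mu> j * a j b)\<^sup>2)"
    by (simp add: power2_eq_square sum_product)
  finally show ?thesis by (simp add: sum_nonneg)
qed

text \<open>The coordinates \<open>x\<^sub>b\<close> are recovered from the forms by the transpose of \<open>a\<close>, whose entries are at most 1 in
absolute value. Hence decay in the forms implies decay in \<open>x\<close>.\<close>

lemma coordinate_bound: "(\<Sum>b\<in>K. \<bar>x b\<bar>) \<le> real (card K) * (\<Sum>j\<in>J. \<bar>form x j\<bar>)"
proof (rule sum_bounded_above)
  fix b assume b: "b \<in> K"
  have "(\<Sum>j\<in>J. a j b * form x j) = (\<Sum>b'\<in>K. x b' * (\<Sum>j\<in>J. a j b * a j b'))"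
    unfolding form_def sum_distrib_left by (subst sum.swap) (simp add: mult_ac)
  also have "\<dots> = (\<Sum>b'\<in>K. if b = b' then x b' else 0)"
    using orth[OF b] by (intro sum.cong) auto
  also have "\<dots> = x b" using b fin by simp
  finally have "\<bar>x b\<bar> = \<bar>\<Sum>j\<in>J. a j b * form x j\<bar>" by simp
  also have "\<dots> \<le> (\<Sum>j\<in>J. \<bar>a j b * form x j\<bar>)" by (rule sum_abs)
  also have "\<dots> \<le> (\<Sum>j\<in>J. \<bar>form x j\<bar>)"
  proof (rule sum_mono)
    fix j assume j: "j \<in> J"
    have "(a j b)\<^sup>2 \<le> (\<Sum>j\<in>J. (a j b)\<^sup>2)" using j fin by (intro member_le_sum) auto
    also have "\<dots> = 1" using orth[OF b b] by (simp add: power2_eq_square)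
    finally have "\<bar>a j b\<bar> \<le> 1" by (simp add: abs_square_le_1)
    then show "\<bar>a j b * form x j\<bar> \<le> \<bar>form x j\<bar>" by (simp add: abs_mult mult_left_le_one_le)
  qed
  finally show "\<bar>x b\<bar> \<le> (\<Sum>j\<in>J. \<bar>form x j\<bar>)" .
qed

lemma nn_integral_exp_forms_finite:
  assumes D: "\<And>j. j \<in> J \<Longrightarrow> 0 \<le> D j"
  shows "(\<integral>\<^sup>+x. (\<Prod>j\<in>J. ennreal (D j * exp (- \<bar>form x j\<bar> / A j))) \<partial>Pi\<^sub>M K (\<lambda>_. lborel)) < \<infinity>"
proof -
  interpret product_sigma_finite "\<lambda>_::'b. lborel :: real measure" by (rule sigma_finite_lborel_family)
  \<comment> \<open>The element 1 keeps the minimum defined, and positive, when \<open>J\<close> is empty; likewise the summand 1 in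
    the denominator of \<open>c\<close> for empty \<open>K\<close>.\<close>
  define r where "r = Min (insert 1 ((\<lambda>j. 1 / A j) ` J))"
  have r: "0 < r" "\<And>j. j \<in> J \<Longrightarrow> r \<le> 1 / A j" using fin A by (auto simp: r_def)
  define c where "c = r / (real (card K) + 1)"
  have c: "0 < c" using r by (auto simp: c_def intro!: divide_pos_pos add_nonneg_pos)
  have bound: "(\<Prod>j\<in>J. ennreal (D j * exp (- \<bar>form x j\<bar> / A j))) \<le> ennreal (\<Prod>j\<in>J. D j) * (\<Prod>b\<in>K. ennreal (exp (- c * \<bar>x b\<bar>)))" for x
  proof -
    have "c * (\<Sum>b\<in>K. \<bar>x b\<bar>) \<le> c * (real (card K) * (\<Sum>j\<in>J. \<bar>form x j\<bar>))"
      using c coordinate_bound by (intro mult_left_mono) auto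
    also have "\<dots> = (c * real (card K)) * (\<Sum>j\<in>J. \<bar>form x j\<bar>)" by simp
    also have "\<dots> \<le> r * (\<Sum>j\<in>J. \<bar>form x j\<bar>)"
      using r(1) by (intro mult_right_mono sum_nonneg) (auto simp: c_def field_simps)
    also have "\<dots> = (\<Sum>j\<in>J. r * \<bar>form x j\<bar>)" by (rule sum_distrib_left)
    also have "\<dots> \<le> (\<Sum>j\<in>J. \<bar>form x j\<bar> / A j)"
    proof (rule sum_mono)
      fix j assume "j \<in> J"
      then have "r * \<bar>form x j\<bar> \<le> (1 / A j) * \<bar>form x j\<bar>" using r(2) by (intro mult_right_mono) auto
      then show "r * \<bar>form x j\<bar> \<le> \<bar>form x j\<bar> / A j" by simp
    qed
    finally have "exp (\<Sum>j\<in>J. - \<bar>form x j\<bar> / A j) \<le> exp (\<Sum>b\<in>K. - c * \<bar>x b\<bar>)"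
      by (simp add: sum_negf sum_distrib_left)
    then have "(\<Prod>j\<in>J. exp (- \<bar>form x j\<bar> / A j)) \<le> (\<Prod>b\<in>K. exp (- c * \<bar>x b\<bar>))"
      using fin by (simp only: exp_sum)
    then have "(\<Prod>j\<in>J. D j) * (\<Prod>j\<in>J. exp (- \<bar>form x j\<bar> / A j)) \<le> (\<Prod>j\<in>J. D j) * (\<Prod>b\<in>K. exp (- c * \<bar>x b\<bar>))"
      using D by (intro mult_left_mono prod_nonneg) auto
    then have "ennreal ((\<Prod>j\<in>J. D j) * (\<Prod>j\<in>J. exp (- \<bar>form x j\<bar> / A j))) \<le> ennreal ((\<Prod>j\<in>J. D j) * (\<Prod>b\<in>K. exp (- c * \<bar>x b\<bar>)))"
      by (rule ennreal_leI)
    then show ?thesis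
      using D by (simp add: prod_ennreal prod.distrib prod_nonneg ennreal_mult)
  qed
  have "(\<integral>\<^sup>+x. (\<Prod>j\<in>J. ennreal (D j * exp (- \<bar>form x j\<bar> / A j))) \<partial>Pi\<^sub>M K (\<lambda>_. lborel)) \<le> 
     (\<integral>\<^sup>+x. ennreal (\<Prod>j\<in>J. D j) * (\<Prod>b\<in>K. ennreal (exp (- c * \<bar>x b\<bar>))) \<partial>Pi\<^sub>M K (\<lambda>_. lborel))"
    by (intro nn_integral_mono bound)
  also have "\<dots> = ennreal (\<Prod>j\<in>J. D j) * (\<integral>\<^sup>+x. (\<Prod>b\<in>K. ennreal (exp (- c * \<bar>x b\<bar>))) \<partial>Pi\<^sub>M K (\<lambda>_. lborel))"
    by (rule nn_integral_cmult) simp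
  also have "(\<integral>\<^sup>+x. (\<Prod>b\<in>K. ennreal (exp (- c * \<bar>x b\<bar>))) \<partial>Pi\<^sub>M K (\<lambda>_. lborel)) = (\<Prod>b\<in>K. \<integral>\<^sup>+x. ennreal (exp (- c * \<bar>x\<bar>)) \<partial>lborel)"
    by (rule product_nn_integral_prod[OF fin(2)]) simp
  also have "ennreal (\<Prod>j\<in>J. D j) * \<dots> < \<infinity>"
    using integrable_exp_neg_abs[OF c]
    by (simp add: ennreal_mult_less_top ennreal_prod_eq_top power_less_top_ennreal nn_integral_eq_integral)
  finally show ?thesis .
qed

lemma gauss_average_eq:
  assumes T: "0 < T"
  shows "ennreal (sqrt (T / (2 * pi)) ^ card I * gauss_average T) =
    (\<integral>\<^sup>+x. (\<Prod>j\<in>J. \<integral>\<^sup>+s. ennreal (exp (- (\<bar>s / A j\<bar> powr p)) * normal_density (form x j) (1 / sqrt T) s) \<partial>lborel) \<partial>Pi\<^sub>M K (\<lambda>_. lborel))"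
  unfolding gauss_average_def form_def
proof (rule gaussian_duality[OF fin card orth compl _ _ _ T])
  fix j assume j: "j \<in> J"
  have fp: "fourier_pair (\<lambda>s. exp (- (\<bar>s / A j\<bar> powr p))) (\<lambda>t. A j * gamma_p p (A j * t))"
    using fourier_pair_dilate[OF fourier_pair_gamma_p[OF p0] A[OF j]] .
  show "integrable lborel (\<lambda>s. exp (- (\<bar>s / A j\<bar> powr p)))" using fp by (simp add: fourier_pair_def)
  show "complex_of_real (A j * gamma_p p (A j * t)) = (CLINT s|lborel. complex_of_real (exp (- (\<bar>s / A j\<bar> powr p))) * iexp (t * s))" for t
    using fp by (simp only: fourier_pair_def)
qed auto

lemma gauss_average_tendsto:
  "(\<lambda>n. ennreal (sqrt (real (Suc n) / (2 * pi)) ^ card I * gauss_average (real (Suc n)))) \<longlonglongrightarrow> section_integral"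
proof -
  define F where "F j n y = (\<integral>\<^sup>+s. ennreal (exp (- (\<bar>s / A j\<bar> powr p)) * normal_density y (1 / sqrt (real (Suc n))) s) \<partial>lborel)" for j n y
  have Flim: "(\<lambda>n. F j n y) \<longlonglongrightarrow> ennreal (exp (- (\<bar>y / A j\<bar> powr p)))" if "j \<in> J" for j y
    unfolding F_def by (rule smoothed_exp_neg_powr(1)[OF A[OF that] p(1)])
  have "\<exists>D\<ge>0. \<forall>n y. F j n y \<le> ennreal (D * exp (- \<bar>y\<bar> / A j))" if "j \<in> J" for j
    unfolding F_def by (rule smoothed_exp_neg_powr(2)[OF A[OF that] p(1)])
  then obtain D where D: "\<And>j. j \<in> J \<Longrightarrow> 0 \<le> D j" "\<And>j n y. j \<in> J \<Longrightarrow> F j n y \<le> ennreal (D j * exp (- \<bar>y\<bar> / A j))"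
    by metis
  have Fm [measurable]: "F j n \<in> borel_measurable borel" for j n
    unfolding F_def normal_density_def by measurable
  have "(\<lambda>n. \<integral>\<^sup>+x. (\<Prod>j\<in>J. F j n (form x j)) \<partial>Pi\<^sub>M K (\<lambda>_. lborel)) \<longlonglongrightarrow>
     (\<integral>\<^sup>+x. (\<Prod>j\<in>J. ennreal (exp (- (\<bar>form x j / A j\<bar> powr p)))) \<partial>Pi\<^sub>M K (\<lambda>_. lborel))"
  proof (rule nn_integral_dominated_convergence[OF _ _ _ _ nn_integral_exp_forms_finite[OF D(1)]])
    show "AE x in Pi\<^sub>M K (\<lambda>_. lborel). (\<Prod>j\<in>J. F j n (form x j)) \<le> (\<Prod>j\<in>J. ennreal (D j * exp (- \<bar>form x j\<bar> / A j)))" for n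
      using D(2) by (intro AE_I2 prod_mono_ennreal) auto
    show "AE x in Pi\<^sub>M K (\<lambda>_. lborel). (\<lambda>n. \<Prod>j\<in>J. F j n (form x j)) \<longlonglongrightarrow> (\<Prod>j\<in>J. ennreal (exp (- (\<bar>form x j / A j\<bar> powr p))))"
    proof (rule AE_I2)
      fix x
      have "(\<lambda>n. \<Prod>j\<in>S. F j n (form x j)) \<longlonglongrightarrow> (\<Prod>j\<in>S. ennreal (exp (- (\<bar>form x j / A j\<bar> powr p))))" if "S \<subseteq> J" for S
        using finite_subset[OF that fin(1)] that
      proof (induction S rule: finite_induct)
        case (insert j S)
        have 1: "(\<lambda>n. F j n (form x j)) \<longlonglongrightarrow> ennreal (exp (- (\<bar>form x j / A j\<bar> powr p)))"
          using insert.prems by (intro Flim) auto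
        have 2: "(\<lambda>n. \<Prod>j\<in>S. F j n (form x j)) \<longlonglongrightarrow> (\<Prod>j\<in>S. ennreal (exp (- (\<bar>form x j / A j\<bar> powr p))))"
          using insert by auto
        have 3: "(\<Prod>j\<in>S. ennreal (exp (- (\<bar>form x j / A j\<bar> powr p)))) \<noteq> \<top>"
          by (simp add: prod_ennreal)
        show ?case
          unfolding prod.insert[OF insert.hyps] by (rule tendsto_mult_ennreal[OF 1 2]) (use 3 in auto)
      qed simp
      then show "(\<lambda>n. \<Prod>j\<in>J. F j n (form x j)) \<longlonglongrightarrow> (\<Prod>j\<in>J. ennreal (exp (- (\<bar>form x j / A j\<bar> powr p))))" by simp
    qed
  qed measurable
  then show ?thesis
    by (simp add: gauss_average_eq section_integral_def F_def prod_ennreal del: of_nat_Suc)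
qed

section \<open>Bounds for the integral over a section\<close>

text \<open>The remaining indices are those whose unit vector lies in the subspace. Their coordinate vanishes on the complement,
so they enter the averages as constant factors, and the exponent \<open>1 / w\<^sub>j\<close> would make no sense for them.\<close>

definition positive_weights :: "'j set" where
  "positive_weights = {j \<in> J. complement_weight j \<noteq> 0}"

lemma mixture_factor: "j \<in> J \<Longrightarrow> gaussian_mixture (\<lambda>t. A j * gamma_p p (A j * t))"
  by (intro gaussian_mixture.scale gaussian_mixture_dilate gaussian_mixture_gamma_p p) (auto simp: A less_imp_le)

lemma gamma_p_nonneg: "0 \<le> gamma_p p t"
  by (rule gaussian_mixture_nonneg[OF gaussian_mixture_gamma_p[OF p]])

lemma gamma_p_measurable [measurable]: "gamma_p p \<in> borel_measurable borel"
  by (rule gaussian_mixture_measurable[OF gaussian_mixture_gamma_p[OF p]])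

lemma prod_split_weights:
  "(\<Prod>j\<in>J. h j) = (\<Prod>j\<in>positive_weights. h j) * (\<Prod>j\<in>J - positive_weights. (h j :: real))"
proof -
  have "positive_weights \<subseteq> J" by (auto simp: positive_weights_def)
  from prod.subset_diff[OF this fin(1), of h] show ?thesis by (simp add: mult.commute)
qed

lemma zero_weight: "j \<in> J - positive_weights \<Longrightarrow> i \<in> I \<Longrightarrow> B j i = 0"
  using fin by (auto simp: positive_weights_def complement_weight_def sum_nonneg_eq_0_iff)

text \<open>Apply the lower bound for mixtures to the Gaussian average of variance \<open>T\<close>. The powers of \<open>T\<close> cancel, and as
\<open>T\<close> tends to infinity the rate \<open>\<kappa> = d / (2 T)\<close> of the Gamma weight tends to 0, leaving the bare power of \<open>t\<close>.
The factors \<open>\<gamma>\<^sub>p 0 = \<alpha>\<^sub>p\<close> that belong to indices of weight zero are at least 1 and are dropped.\<close>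

theorem section_integral_lower:
  "ennreal (sqrt (pi * real (card I)) ^ card I / (2 * pi) ^ card I * (\<Prod>j\<in>J. A j) *
     gamma_mean (real (card I) / 2) (\<lambda>t. \<Prod>j\<in>positive_weights. gamma_p p (sqrt (t * (A j)\<^sup>2 * complement_weight j)))) \<le> section_integral"
proof -
  let ?\<alpha> = "alpha_p p"
  have \<alpha>: "1 \<le> ?\<alpha>" by (rule alpha_p_ge_1[OF p(1)])
  have Apos: "0 \<le> (\<Prod>j\<in>J. A j)" using A by (intro prod_nonneg) (auto intro: less_imp_le)
  show ?thesis
  proof (cases "I = {}")
    case True
    \<comment> \<open>The complement is trivial, and \<open>gamma_mean\<close> is the value at 0.\<close>
    then have cw0: "complement_weight j = 0" for j unfolding complement_weight_def by simp
    have "gauss_average T = (\<Prod>j\<in>J. A j * ?\<alpha>)" for T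
      unfolding gauss_average_def using True prob_space.prob_space[OF prob_space_std_normals[of I]]
      by (simp add: gamma_p_0[OF p0])
    moreover have card0: "card I = 0" using True by simp
    ultimately have "(\<lambda>n::nat. ennreal (\<Prod>j\<in>J. A j * ?\<alpha>)) \<longlonglongrightarrow> section_integral"
      using gauss_average_tendsto by simp
    then have eq: "section_integral = ennreal (\<Prod>j\<in>J. A j * ?\<alpha>)"
      by (metis LIMSEQ_unique tendsto_const)
    have "(\<Prod>j\<in>J. A j) \<le> (\<Prod>j\<in>J. A j * ?\<alpha>)"
    proof (rule prod_mono)
      fix j assume "j \<in> J"
      then have "0 < A j" by (rule A)
      then show "0 \<le> A j \<and> A j \<le> A j * ?\<alpha>" using \<alpha> by simp
    qed
    then show ?thesis
      by (simp add: eq gamma_mean_def positive_weights_def cw0 card0 ennreal_leI)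
  next
    case False
    define d where "d = real (card I)"
    have d: "0 < d" using False fin by (simp add: d_def card_gt_0_iff)
    define b where "b = d / 2"
    have b: "0 < b" using d by (simp add: b_def)
    have G: "0 < Gamma b" by (rule Gamma_real_pos[OF b])
    define P where "P u = (\<Prod>j\<in>J. A j * gamma_p p (A j * sqrt (u * complement_weight j)))" for u
    have P0: "0 \<le> P u" for u unfolding P_def using A gamma_p_nonneg by (intro prod_nonneg mult_nonneg_nonneg) (auto intro: less_imp_le)
    have Pm [measurable]: "P \<in> borel_measurable borel" unfolding P_def by measurable
    define C where "C = sqrt (pi * d) ^ card I / (2 * pi) ^ card I / Gamma b"
    have C: "0 \<le> C"
      unfolding C_def using G d by (intro divide_nonneg_nonneg zero_le_power real_sqrt_ge_zero) auto
    define h where "h \<kappa> u = indicator {0<..} u * u powr (b - 1) * exp (- \<kappa> * u) * P u" for \<kappa> u :: real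
    have h0: "0 \<le> h \<kappa> u" for \<kappa> u using P0 by (auto simp: h_def)
    have hm [measurable]: "h \<kappa> \<in> borel_measurable borel" for \<kappa> unfolding h_def by measurable
    define \<kappa> where "\<kappa> n = d / (2 * real (Suc n))" for n
    have le: "(\<integral>\<^sup>+u. ennreal (C * h (\<kappa> n) u) \<partial>lborel) \<le> ennreal (sqrt (real (Suc n) / (2 * pi)) ^ card I * gauss_average (real (Suc n)))" for n
    proof -
      let ?T = "real (Suc n)"
      have T: "0 < ?T" by simp
      have lower: "ennreal (\<kappa> n powr b / Gamma b) * (\<integral>\<^sup>+u. ennreal (h (\<kappa> n) u) \<partial>lborel) \<le> ennreal (gauss_average ?T)"
        using gamma_mixture_lower[where g = "\<lambda>j t. A j * gamma_p p (A j * t)" and B = B, OF fin(3) False fin(1) mixture_factor T]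
        unfolding h_def P_def gauss_average_def \<kappa>_def b_def d_def complement_weight_def by simp
      have const: "C = sqrt (?T / (2 * pi)) ^ card I * (\<kappa> n powr b / Gamma b)"
      proof -
        have "\<kappa> n powr b = (\<kappa> n powr (1/2)) powr d" by (simp add: powr_powr b_def)
        also have "\<dots> = sqrt (\<kappa> n) ^ card I"
          using d by (simp add: powr_half_sqrt \<kappa>_def d_def powr_realpow del: of_nat_Suc)
        finally have "sqrt (?T / (2 * pi)) ^ card I * \<kappa> n powr b = sqrt (?T / (2 * pi) * \<kappa> n) ^ card I"
          by (simp only: real_sqrt_mult power_mult_distrib)
        also have "?T / (2 * pi) * \<kappa> n = (pi * d) / (2 * pi)\<^sup>2"
          by (simp add: \<kappa>_def power2_eq_square del: of_nat_Suc)
        also have "sqrt ((pi * d) / (2 * pi)\<^sup>2) = sqrt (pi * d) / (2 * pi)"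
          by (simp only: real_sqrt_divide real_sqrt_abs) simp
        also have "(sqrt (pi * d) / (2 * pi)) ^ card I = sqrt (pi * d) ^ card I / (2 * pi) ^ card I"
          by (rule power_divide)
        finally show ?thesis by (simp add: C_def)
      qed
      have "(\<integral>\<^sup>+u. ennreal (C * h (\<kappa> n) u) \<partial>lborel) = ennreal C * (\<integral>\<^sup>+u. ennreal (h (\<kappa> n) u) \<partial>lborel)"
        using C h0 by (subst nn_integral_cmult[symmetric]) (simp_all add: ennreal_mult)
      also have "\<dots> = ennreal (sqrt (?T / (2 * pi)) ^ card I) * (ennreal (\<kappa> n powr b / Gamma b) * (\<integral>\<^sup>+u. ennreal (h (\<kappa> n) u) \<partial>lborel))"
        unfolding const using G by (subst ennreal_mult) (simp_all add: mult.assoc)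
      also have "\<dots> \<le> ennreal (sqrt (?T / (2 * pi)) ^ card I) * ennreal (gauss_average ?T)"
        by (rule mult_left_mono[OF lower]) simp
      also have "\<dots> = ennreal (sqrt (?T / (2 * pi)) ^ card I * gauss_average ?T)"
        by (rule ennreal_mult'[symmetric]) simp
      finally show ?thesis .
    qed
    have lim: "(\<integral>\<^sup>+u. ennreal (C * h 0 u) \<partial>lborel) \<le> section_integral"
    proof (rule nn_integral_le_of_tendsto[OF _ _ le gauss_average_tendsto])
      show "AE u in lborel. (\<lambda>n. ennreal (C * h (\<kappa> n) u)) \<longlonglongrightarrow> ennreal (C * h 0 u)"
      proof (intro AE_I2 tendsto_ennrealI tendsto_mult tendsto_const)
        fix u
        have "\<kappa> \<longlonglongrightarrow> 0" unfolding \<kappa>_def by real_asymp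
        then show "(\<lambda>n. h (\<kappa> n) u) \<longlonglongrightarrow> h 0 u"
          unfolding h_def by (intro tendsto_intros)
      qed
    qed simp
    have nonneg_cw: "P u = (\<Prod>j\<in>J. A j) * ?\<alpha> ^ card (J - positive_weights) * (\<Prod>j\<in>positive_weights. gamma_p p (sqrt (u * (A j)\<^sup>2 * complement_weight j)))" for u
    proof -
      have "P u = (\<Prod>j\<in>J. A j) * (\<Prod>j\<in>J. gamma_p p (A j * sqrt (u * complement_weight j)))" by (simp add: P_def prod.distrib)
      also have "(\<Prod>j\<in>J. gamma_p p (A j * sqrt (u * complement_weight j))) = (\<Prod>j\<in>J. gamma_p p (sqrt (u * (A j)\<^sup>2 * complement_weight j)))"
        using A by (intro prod.cong refl) (simp add: real_sqrt_mult mult_ac less_imp_le)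
      also have "\<dots> = (\<Prod>j\<in>positive_weights. gamma_p p (sqrt (u * (A j)\<^sup>2 * complement_weight j))) * (\<Prod>j\<in>J - positive_weights. ?\<alpha>)"
        unfolding prod_split_weights
        by (intro arg_cong2[where f = "(*)"] refl prod.cong) (auto simp: positive_weights_def gamma_p_0[OF p0])
      finally show ?thesis by simp
    qed
    let ?Q = "\<lambda>t. \<Prod>j\<in>positive_weights. gamma_p p (sqrt (t * (A j)\<^sup>2 * complement_weight j))"
    have Q0: "0 \<le> ?Q t" for t using gamma_p_nonneg by (intro prod_nonneg) auto
    let ?q = "\<lambda>u. indicator {0<..} u * (u powr (b - 1) * ?Q u)"
    have "sqrt (pi * real (card I)) ^ card I / (2 * pi) ^ card I * (\<Prod>j\<in>J. A j) * gamma_mean (real (card I) / 2) ?Q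
       = C * (\<Prod>j\<in>J. A j) * (\<integral>u. ?q u \<partial>lborel)"
      using d by (simp add: gamma_mean_def C_def d_def b_def set_lebesgue_integral_def)
    also have "\<dots> = (\<integral>u. C * (\<Prod>j\<in>J. A j) * ?q u \<partial>lborel)" by simp
    finally have "ennreal (sqrt (pi * real (card I)) ^ card I / (2 * pi) ^ card I * (\<Prod>j\<in>J. A j) * gamma_mean (real (card I) / 2) ?Q)
       = ennreal (\<integral>u. C * (\<Prod>j\<in>J. A j) * ?q u \<partial>lborel)" by simp
    also have "\<dots> \<le> (\<integral>\<^sup>+u. ennreal (C * (\<Prod>j\<in>J. A j) * ?q u) \<partial>lborel)"
      using C Apos Q0 by (intro ennreal_integral_le_nn_integral mult_nonneg_nonneg) auto
    also have "\<dots> \<le> (\<integral>\<^sup>+u. ennreal (C * h 0 u) \<partial>lborel)"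
    proof (intro nn_integral_mono ennreal_leI)
      fix u
      have "(\<Prod>j\<in>J. A j) * ?q u * 1 \<le> (\<Prod>j\<in>J. A j) * ?q u * ?\<alpha> ^ card (J - positive_weights)"
        using Apos Q0 \<alpha> by (intro mult_left_mono one_le_power mult_nonneg_nonneg) auto
      also have "\<dots> = h 0 u" by (simp add: h_def nonneg_cw mult_ac)
      finally have "C * ((\<Prod>j\<in>J. A j) * ?q u) \<le> C * h 0 u" using C by (intro mult_left_mono) auto
      then show "C * (\<Prod>j\<in>J. A j) * ?q u \<le> C * h 0 u" by (simp only: mult.assoc)
    qed
    also have "\<dots> \<le> section_integral" by (rule lim)
    finally show ?thesis .
  qed
qed

definition bl_factor :: "'j \<Rightarrow> real" where
  "bl_factor j = (\<integral>t. gamma_p p (sqrt (complement_weight j) * t) powr (1 / complement_weight j) \<partial>lborel)"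

lemma gamma_p_integrable: "integrable lborel (gamma_p p)" and integral_gamma_p_le: "(\<integral>t. gamma_p p t \<partial>lborel) \<le> 2 * pi"
proof -
  show 1: "integrable lborel (gamma_p p)"
    by (rule integrableI_bounded)
       (use nn_integral_gamma_p_le[OF p] gamma_p_nonneg in \<open>auto intro: le_less_trans\<close>)
  show "(\<integral>t. gamma_p p t \<partial>lborel) \<le> 2 * pi"
    using nn_integral_gamma_p_le[OF p] nn_integral_eq_integral[OF 1] gamma_p_nonneg by (simp add: ennreal_le_iff)
qed

text \<open>Log-convexity dominates the integrand by \<open>\<gamma>\<^sub>p\<close> itself, which is integrable with integral at most \<open>2 pi\<close>.\<close>

lemma bl_factor_facts:
  assumes j: "j \<in> positive_weights"
  shows "integrable lborel (\<lambda>t. gamma_p p (sqrt (complement_weight j) * t) powr (1 / complement_weight j))"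
    and "0 \<le> bl_factor j"
    and "bl_factor j powr complement_weight j \<le> (2 * pi) powr complement_weight j * alpha_p p powr (1 - complement_weight j)"
proof -
  have c: "0 < complement_weight j" "complement_weight j \<le> 1" using j complement_weight_range by (auto simp: positive_weights_def less_le)
  have int: "integrable lborel (\<lambda>t. alpha_p p powr (1 / complement_weight j - 1) * gamma_p p t)"
    using gamma_p_integrable by simp
  show 1: "integrable lborel (\<lambda>t. gamma_p p (sqrt (complement_weight j) * t) powr (1 / complement_weight j))"
    by (rule Bochner_Integration.integrable_bound[OF int])
       (use gamma_p_power_le[OF p c] gamma_p_nonneg in \<open>auto simp: abs_mult\<close>)
  show 2: "0 \<le> bl_factor j" unfolding bl_factor_def by (intro Bochner_Integration.integral_nonneg) auto
  have "bl_factor j \<le> (\<integral>t. alpha_p p powr (1 / complement_weight j - 1) * gamma_p p t \<partial>lborel)"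
    unfolding bl_factor_def by (rule integral_mono[OF 1 int gamma_p_power_le[OF p c]])
  also have "\<dots> \<le> alpha_p p powr (1 / complement_weight j - 1) * (2 * pi)"
    using integral_gamma_p_le by (simp add: mult_left_mono)
  finally have "bl_factor j powr complement_weight j \<le> (alpha_p p powr (1 / complement_weight j - 1) * (2 * pi)) powr complement_weight j"
    using 2 c by (intro powr_mono2) auto
  also have "\<dots> = (2 * pi) powr complement_weight j * alpha_p p powr (1 - complement_weight j)"
    using c by (simp add: powr_mult powr_powr algebra_simps)
  finally show "bl_factor j powr complement_weight j \<le> (2 * pi) powr complement_weight j * alpha_p p powr (1 - complement_weight j)" .
qed

lemma sum_positive_complement_weight: "(\<Sum>j\<in>positive_weights. complement_weight j) = real (card I)"
  unfolding sum_complement_weight[symmetric] using fin by (intro sum.mono_neutral_left) (auto simp: positive_weights_def)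

text \<open>The exponents add up: the weights sum to \<open>d\<close>, and their complements \<open>1 - w\<^sub>j\<close>, over all of \<open>J\<close>, to \<open>k\<close>.\<close>

lemma prod_bl_factor_le:
  "alpha_p p ^ card (J - positive_weights) * (\<Prod>j\<in>positive_weights. bl_factor j powr complement_weight j) \<le> alpha_p p ^ card K * (2 * pi) ^ card I"
proof -
  let ?\<alpha> = "alpha_p p"
  have \<alpha>: "0 < ?\<alpha>" by (rule alpha_p_pos[OF p0])
  have sub: "positive_weights \<subseteq> J" by (auto simp: positive_weights_def)
  have finp: "finite positive_weights" using sub fin finite_subset by blast
  have "(\<Prod>j\<in>positive_weights. bl_factor j powr complement_weight j) \<le> (\<Prod>j\<in>positive_weights. (2 * pi) powr complement_weight j * ?\<alpha> powr (1 - complement_weight j))"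
    using bl_factor_facts by (intro prod_mono) auto
  also have "\<dots> = (2 * pi) powr (\<Sum>j\<in>positive_weights. complement_weight j) * ?\<alpha> powr (\<Sum>j\<in>positive_weights. 1 - complement_weight j)"
    using \<alpha> finp by (simp add: prod.distrib powr_sum)
  also have "(\<Sum>j\<in>positive_weights. 1 - complement_weight j) = real (card positive_weights) - real (card I)"
    by (simp add: sum_subtractf sum_positive_complement_weight)
  finally have "?\<alpha> ^ card (J - positive_weights) * (\<Prod>j\<in>positive_weights. bl_factor j powr complement_weight j) \<le> 
     ?\<alpha> ^ card (J - positive_weights) * ((2 * pi) powr real (card I) * ?\<alpha> powr (real (card positive_weights) - real (card I)))"
    using \<alpha> by (simp add: sum_positive_complement_weight)
  also have "\<dots> = (2 * pi) powr real (card I) * ?\<alpha> powr (real (card (J - positive_weights)) + (real (card positive_weights) - real (card I)))"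
    using \<alpha> by (simp only: powr_add powr_realpow) simp
  also have "real (card (J - positive_weights)) + (real (card positive_weights) - real (card I)) = real (card K)"
  proof -
    have "card J = card (J - positive_weights) + card positive_weights"
      using sub fin finp by (simp add: card_Diff_subset card_mono)
    then show ?thesis using card by simp
  qed
  finally show ?thesis using \<alpha> by (simp add: powr_realpow mult.commute)
qed

text \<open>The Brascamp-Lieb inequality for the indices of positive weight; those of weight zero contribute the constants
\<open>A\<^sub>j \<alpha>\<^sub>p\<close>. In each factor a Gaussian density of standard deviation \<open>A\<^sub>j sqrt T\<close> is bounded by its maximum, and since the
weights add up to \<open>d\<close> the powers of \<open>T\<close> cancel.\<close>

theorem section_integral_upper:
  "section_integral \<le> ennreal ((\<Prod>j\<in>J. A j powr (1 - complement_weight j)) / (2 * pi) ^ card I *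
     (alpha_p p ^ card (J - positive_weights) * (\<Prod>j\<in>positive_weights. bl_factor j powr complement_weight j)))"
proof -
  let ?\<alpha> = "alpha_p p"
  have \<alpha>: "0 < ?\<alpha>" by (rule alpha_p_pos[OF p0])
  have sub: "positive_weights \<subseteq> J" by (auto simp: positive_weights_def)
  have finp: "finite positive_weights" using sub fin finite_subset by blast
  have cwp: "0 < complement_weight j" "complement_weight j \<le> 1" if "j \<in> positive_weights" for j
    using that complement_weight_range by (auto simp: positive_weights_def less_le)
  obtain M0 where M0: "quadratic_taylor 0 M0 (gamma_p p)" using quadratic_taylor_gamma_p[OF p] by blast
  have bound: "sqrt (T / (2 * pi)) ^ card I * gauss_average T \<le> (\<Prod>j\<in>J. A j powr (1 - complement_weight j)) / (2 * pi) ^ card I *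
     (?\<alpha> ^ card (J - positive_weights) * (\<Prod>j\<in>positive_weights. bl_factor j powr complement_weight j))" if T: "0 < T" for T
  proof -
    define h where "h j t = A j * gamma_p p (A j * sqrt T * t)" for j t
    have "\<exists>M. quadratic_taylor 0 M (h j)" if "j \<in> positive_weights" for j
      unfolding h_def using that sub A by (intro quadratic_taylor_dilate[OF M0]) (auto intro: less_imp_le)
    then obtain m where m: "\<And>j. j \<in> positive_weights \<Longrightarrow> quadratic_taylor 0 (m j) (h j)" by metis
    define M where "M = Max (insert 0 (m ` positive_weights))"
    have hM: "quadratic_taylor 0 M (h j)" if j: "j \<in> positive_weights" for j
    proof -
      have le: "m j \<le> M" using finp j by (simp add: M_def)
      then have "m j * k\<^sup>2 \<le> M * k\<^sup>2" for k by (intro mult_right_mono) auto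
      then show ?thesis using m[OF j] le unfolding quadratic_taylor_def by (meson order_trans)
    qed
    define z where "z j \<zeta> = (\<Sum>i\<in>I. B j i * \<zeta> i)" for j and \<zeta> :: "'i \<Rightarrow> real"
    have z0: "z j \<zeta> = 0" if "j \<in> J - positive_weights" for j \<zeta>
      unfolding z_def using zero_weight[OF that] by simp
    have "gauss_average T = (\<integral>\<zeta>. (\<Prod>j\<in>J. h j (z j \<zeta>)) \<partial>std_normals I)"
      by (simp add: gauss_average_def h_def z_def mult.assoc)
    also have "\<dots> = (\<integral>\<zeta>. (\<Prod>j\<in>positive_weights. h j (z j \<zeta>)) * (\<Prod>j\<in>J - positive_weights. A j * ?\<alpha>) \<partial>std_normals I)"
      unfolding prod_split_weights
      by (intro Bochner_Integration.integral_cong refl arg_cong2[where f = "(*)"] prod.cong) (simp add: z0 h_def gamma_p_0[OF p0])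
    also have "\<dots> = (\<integral>\<zeta>. (\<Prod>j\<in>positive_weights. h j (z j \<zeta>)) \<partial>std_normals I) * (\<Prod>j\<in>J - positive_weights. A j * ?\<alpha>)"
      by simp
    also have "\<dots> \<le> (\<Prod>j\<in>positive_weights. (\<integral>\<zeta>. h j (z j \<zeta>) powr (1 / complement_weight j) \<partial>std_normals I) powr complement_weight j) * (\<Prod>j\<in>J - positive_weights. A j * ?\<alpha>)"
    proof (rule mult_right_mono)
      show "(\<integral>\<zeta>. (\<Prod>j\<in>positive_weights. h j (z j \<zeta>)) \<partial>std_normals I) \<le> 
         (\<Prod>j\<in>positive_weights. (\<integral>\<zeta>. h j (z j \<zeta>) powr (1 / complement_weight j) \<partial>std_normals I) powr complement_weight j)"
        unfolding z_def
        by (rule gaussian_brascamp_lieb[where M = M, OF fin(3) finp B_contraction[OF sub] _ cwp hM]) (auto simp: complement_weight_def)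
      show "0 \<le> (\<Prod>j\<in>J - positive_weights. A j * ?\<alpha>)" using A \<alpha> by (intro prod_nonneg) (auto intro: less_imp_le)
    qed
    also have "\<dots> \<le> (\<Prod>j\<in>positive_weights. A j * ((A j * sqrt (2 * pi * T)) powr (- complement_weight j) * bl_factor j powr complement_weight j)) * (\<Prod>j\<in>J - positive_weights. A j * ?\<alpha>)"
    proof (intro mult_right_mono prod_mono conjI)
      fix j assume j: "j \<in> positive_weights"
      then have Aj: "0 < A j" using A sub by auto
      note c = cwp[OF j]
      define s where "s = A j * sqrt T"
      have s: "0 < s" using Aj T by (simp add: s_def)
      define f where "f t = gamma_p p (sqrt (complement_weight j) * t) powr (1 / complement_weight j)" for t
      have fm [measurable]: "f \<in> borel_measurable borel" unfolding f_def by measurable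
      have f0: "0 \<le> f t" for t by (simp add: f_def)
      have fi: "integrable lborel f" unfolding f_def by (rule bl_factor_facts(1)[OF j])
      have hm: "(\<lambda>t. h j t powr (1 / complement_weight j)) \<in> borel_measurable borel" unfolding h_def by measurable
      have "(\<integral>\<zeta>. h j (z j \<zeta>) powr (1 / complement_weight j) \<partial>std_normals I) = (\<integral>x. h j (sqrt (complement_weight j) * x) powr (1 / complement_weight j) \<partial>std_normal_distribution)"
        unfolding z_def using integral_linear_form[OF fin(3) hm, of "B j"] by (simp add: complement_weight_def)
      also have "\<dots> = (\<integral>x. A j powr (1 / complement_weight j) * f (s * x) \<partial>std_normal_distribution)"
        using Aj gamma_p_nonneg by (intro Bochner_Integration.integral_cong refl) (simp add: h_def f_def s_def powr_mult mult_ac)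
      also have "\<dots> = A j powr (1 / complement_weight j) * (\<integral>x. f (s * x) \<partial>std_normal_distribution)" by simp
      also have "\<dots> \<le> A j powr (1 / complement_weight j) * (1 / (s * sqrt (2 * pi)) * bl_factor j)"
      proof (rule mult_left_mono)
        have "ennreal (\<integral>x. f (s * x) \<partial>std_normal_distribution) \<le> (\<integral>\<^sup>+x. ennreal (f (s * x)) \<partial>std_normal_distribution)"
          using f0 by (intro ennreal_integral_le_nn_integral) auto
        also have "\<dots> = ennreal (1 / (s * sqrt (2 * pi))) * (\<integral>\<^sup>+t. ennreal (exp (- t\<^sup>2 / (2 * s\<^sup>2))) * ennreal (f t) \<partial>lborel)"
          by (rule nn_integral_std_normal[OF _ s]) simp
        also have "\<dots> \<le> ennreal (1 / (s * sqrt (2 * pi))) * (\<integral>\<^sup>+t. ennreal (f t) \<partial>lborel)"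
        proof (intro mult_left_mono nn_integral_mono)
          fix t
          have "ennreal (exp (- t\<^sup>2 / (2 * s\<^sup>2))) * ennreal (f t) \<le> 1 * ennreal (f t)"
            by (intro mult_right_mono) auto
          then show "ennreal (exp (- t\<^sup>2 / (2 * s\<^sup>2))) * ennreal (f t) \<le> ennreal (f t)" by simp
        qed simp
        also have "(\<integral>\<^sup>+t. ennreal (f t) \<partial>lborel) = ennreal (bl_factor j)"
          unfolding bl_factor_def f_def[symmetric] using fi f0 by (intro nn_integral_eq_integral) auto
        also have "ennreal (1 / (s * sqrt (2 * pi))) * ennreal (bl_factor j) = ennreal (1 / (s * sqrt (2 * pi)) * bl_factor j)"
          using s bl_factor_facts(2)[OF j] by (intro ennreal_mult[symmetric]) auto
        finally show "(\<integral>x. f (s * x) \<partial>std_normal_distribution) \<le> 1 / (s * sqrt (2 * pi)) * bl_factor j"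
          using s bl_factor_facts(2)[OF j] by (subst (asm) ennreal_le_iff) auto
      qed simp
      finally have "(\<integral>\<zeta>. h j (z j \<zeta>) powr (1 / complement_weight j) \<partial>std_normals I) powr complement_weight j \<le> (A j powr (1 / complement_weight j) * (1 / (s * sqrt (2 * pi)) * bl_factor j)) powr complement_weight j"
        using c by (intro powr_mono2 Bochner_Integration.integral_nonneg) auto
      also have "\<dots> = A j * ((A j * sqrt (2 * pi * T)) powr (- complement_weight j) * bl_factor j powr complement_weight j)"
      proof -
        have "s * sqrt (2 * pi) = A j * sqrt (2 * pi * T)" by (simp add: s_def real_sqrt_mult)
        then have "1 / (s * sqrt (2 * pi)) = inverse (A j * sqrt (2 * pi * T))" by (simp add: divide_inverse)
        moreover have "(A j powr (1 / complement_weight j)) powr complement_weight j = A j" using c Aj by (simp add: powr_powr)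
        moreover have "inverse (A j * sqrt (2 * pi * T)) powr complement_weight j = (A j * sqrt (2 * pi * T)) powr (- complement_weight j)"
          by (metis inverse_powr powr_minus)
        ultimately show ?thesis
          using Aj T bl_factor_facts(2)[OF j] by (simp add: powr_mult)
      qed
      finally show "(\<integral>\<zeta>. h j (z j \<zeta>) powr (1 / complement_weight j) \<partial>std_normals I) powr complement_weight j \<le> \<dots>" .
    qed (use A \<alpha> in \<open>auto intro!: prod_nonneg simp: less_imp_le\<close>)
    also have "\<dots> = sqrt (2 * pi * T) powr (- real (card I)) * (\<Prod>j\<in>J. A j powr (1 - complement_weight j)) *
       (?\<alpha> ^ card (J - positive_weights) * (\<Prod>j\<in>positive_weights. bl_factor j powr complement_weight j))"
    proof -
      have 1: "(\<Prod>j\<in>positive_weights. A j * ((A j * sqrt (2 * pi * T)) powr (- complement_weight j) * bl_factor j powr complement_weight j)) =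
        (\<Prod>j\<in>positive_weights. A j powr (1 - complement_weight j)) * (\<Prod>j\<in>positive_weights. sqrt (2 * pi * T) powr (- complement_weight j)) * (\<Prod>j\<in>positive_weights. bl_factor j powr complement_weight j)"
        unfolding prod.distrib[symmetric]
      proof (rule prod.cong[OF refl])
        fix j assume "j \<in> positive_weights"
        then have Aj: "0 < A j" using A sub by auto
        have "A j * A j powr (- complement_weight j) = A j powr (1 - complement_weight j)"
          using Aj powr_add[of "A j" 1 "- complement_weight j"] by simp
        then show "A j * ((A j * sqrt (2 * pi * T)) powr (- complement_weight j) * bl_factor j powr complement_weight j) =
          A j powr (1 - complement_weight j) * sqrt (2 * pi * T) powr (- complement_weight j) * bl_factor j powr complement_weight j"
          using Aj T by (simp add: powr_mult)
      qed
      have 2: "(\<Prod>j\<in>positive_weights. sqrt (2 * pi * T) powr (- complement_weight j)) = sqrt (2 * pi * T) powr (- real (card I))"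
        using T finp by (simp add: sum_negf sum_positive_complement_weight flip: powr_sum)
      have 3: "(\<Prod>j\<in>J - positive_weights. A j * ?\<alpha>) = (\<Prod>j\<in>J - positive_weights. A j powr (1 - complement_weight j)) * ?\<alpha> ^ card (J - positive_weights)"
        unfolding prod.distrib prod_constant
        using A by (intro arg_cong2[where f = "(*)"] refl prod.cong) (auto simp: positive_weights_def less_imp_le)
      have 4: "(\<Prod>j\<in>J. A j powr (1 - complement_weight j)) = (\<Prod>j\<in>positive_weights. A j powr (1 - complement_weight j)) * (\<Prod>j\<in>J - positive_weights. A j powr (1 - complement_weight j))"
        by (rule prod_split_weights)
      show ?thesis unfolding 1 2 3 4 by (simp only: mult_ac)
    qed
    finally have main: "gauss_average T \<le> \<dots>" .
    have const: "sqrt (T / (2 * pi)) ^ card I * sqrt (2 * pi * T) powr (- real (card I)) = 1 / (2 * pi) ^ card I"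
    proof -
      have "sqrt (2 * pi * T) powr (- real (card I)) = 1 / sqrt (2 * pi * T) ^ card I"
        using T by (simp add: powr_minus_divide powr_realpow)
      then have "sqrt (T / (2 * pi)) ^ card I * sqrt (2 * pi * T) powr (- real (card I)) = (sqrt (T / (2 * pi)) / sqrt (2 * pi * T)) ^ card I"
        by (simp add: power_divide)
      also have "sqrt (T / (2 * pi)) / sqrt (2 * pi * T) = sqrt (T / (2 * pi) / (2 * pi * T))" by (simp only: real_sqrt_divide)
      also have "T / (2 * pi) / (2 * pi * T) = (1 / (2 * pi))\<^sup>2" using T by (simp add: power2_eq_square)
      also have "sqrt ((1 / (2 * pi))\<^sup>2) = 1 / (2 * pi)" by (rule real_sqrt_unique) auto
      finally show ?thesis by (simp only: power_divide power_one)
    qed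
    have "sqrt (T / (2 * pi)) ^ card I * gauss_average T \<le> sqrt (T / (2 * pi)) ^ card I * (sqrt (2 * pi * T) powr (- real (card I)) * (\<Prod>j\<in>J. A j powr (1 - complement_weight j)) *
       (?\<alpha> ^ card (J - positive_weights) * (\<Prod>j\<in>positive_weights. bl_factor j powr complement_weight j)))"
      using main T by (intro mult_left_mono) auto
    also have "\<dots> = (sqrt (T / (2 * pi)) ^ card I * sqrt (2 * pi * T) powr (- real (card I))) * (\<Prod>j\<in>J. A j powr (1 - complement_weight j)) *
       (?\<alpha> ^ card (J - positive_weights) * (\<Prod>j\<in>positive_weights. bl_factor j powr complement_weight j))"
      by (simp only: mult.assoc)
    finally show ?thesis unfolding const by simp
  qed
  show ?thesis
    by (rule LIMSEQ_le_const2[OF gauss_average_tendsto]) (use bound in \<open>auto intro!: ennreal_leI simp del: of_nat_Suc\<close>)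
qed

end

section \<open>Sections of the body in coordinates\<close>

text \<open>Split off one unit vector \<open>b\<close> of the range at a time: a nonzero column of \<open>P\<close>, normalised, satisfies
\<open>P b = b\<close>, and \<open>P - b b\<^sup>T\<close> is again a symmetric idempotent, of trace one less. If the diagonal vanishes, so does
\<open>P\<close>, as \<open>P\<^sub>j\<^sub>j\<close> is the sum of the squares of the entries in row \<open>j\<close>.\<close>

lemma symmetric_idempotent_factorization:
  fixes P :: "'j \<Rightarrow> 'j \<Rightarrow> real"
  assumes J: "finite J" and sym: "\<And>j k. j \<in> J \<Longrightarrow> k \<in> J \<Longrightarrow> P j k = P k j"
    and idem: "\<And>j k. j \<in> J \<Longrightarrow> k \<in> J \<Longrightarrow> (\<Sum>l\<in>J. P j l * P l k) = P j k"
    and trace: "(\<Sum>j\<in>J. P j j) \<le> real n"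
  shows "\<exists>d (B :: 'j \<Rightarrow> nat \<Rightarrow> real). real d = (\<Sum>j\<in>J. P j j) \<and> (\<forall>j\<in>J. \<forall>k\<in>J. (\<Sum>i<d. B j i * B k i) = P j k)"
  using sym idem trace
proof (induction n arbitrary: P)
  case (0 P)
  have diag: "P j j = (\<Sum>l\<in>J. (P j l)\<^sup>2)" if "j \<in> J" for j
  proof -
    have "P j j = (\<Sum>l\<in>J. P j l * P l j)" using 0(2)[OF that that] by simp
    also have "\<dots> = (\<Sum>l\<in>J. (P j l)\<^sup>2)"
      using 0(1)[OF _ that] by (intro sum.cong refl) (simp add: power2_eq_square)
    finally show ?thesis .
  qed
  have nn: "0 \<le> P j j" if "j \<in> J" for j using diag[OF that] by (simp add: sum_nonneg)
  have tr: "(\<Sum>j\<in>J. P j j) = 0" using 0(3) nn by (intro antisym sum_nonneg) auto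
  then have "P j j = 0" if "j \<in> J" for j using nn J that by (simp add: sum_nonneg_eq_0_iff)
  then have "P j k = 0" if "j \<in> J" "k \<in> J" for j k
    using diag[OF that(1)] that J by (simp add: sum_nonneg_eq_0_iff)
  then show ?case using tr by (intro exI[of _ 0] exI[of _ "\<lambda>_ _. 0"]) simp
next
  case (Suc n P)
  have diag: "P j j = (\<Sum>l\<in>J. (P j l)\<^sup>2)" if "j \<in> J" for j
  proof -
    have "P j j = (\<Sum>l\<in>J. P j l * P l j)" using Suc.prems(2)[OF that that] by simp
    also have "\<dots> = (\<Sum>l\<in>J. (P j l)\<^sup>2)"
      using Suc.prems(1)[OF _ that] by (intro sum.cong refl) (simp add: power2_eq_square)
    finally show ?thesis .
  qed
  have nn: "0 \<le> P j j" if "j \<in> J" for j using diag[OF that] by (simp add: sum_nonneg)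
  show ?case
  proof (cases "\<forall>j\<in>J. P j j = 0")
    case True
    then have "P j k = 0" if "j \<in> J" "k \<in> J" for j k
      using diag[OF that(1)] that J by (simp add: sum_nonneg_eq_0_iff)
    then show ?thesis using True by (intro exI[of _ 0] exI[of _ "\<lambda>_ _. 0"]) simp
  next
    case False
    then obtain r where r: "r \<in> J" "0 < P r r" using nn by (metis less_le)
    \<comment> \<open>The \<open>r\<close>-th column has squared length \<open>P\<^sub>r\<^sub>r\<close>.\<close>
    define b where "b k = P k r / sqrt (P r r)" for k
    have bb: "b j * b k = P j r * P k r / P r r" for j k using r by (simp add: b_def)
    have Pb: "(\<Sum>l\<in>J. P j l * b l) = b j" if "j \<in> J" for j
      using Suc.prems(2)[OF that r(1)] by (simp add: b_def sum_divide_distrib[symmetric])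
    have b1: "(\<Sum>l\<in>J. b l * b l) = 1"
    proof -
      have "(\<Sum>l\<in>J. b l * b l) = (\<Sum>l\<in>J. (P r l)\<^sup>2 / P r r)"
        using Suc.prems(1)[OF _ r(1)] by (intro sum.cong refl) (simp add: bb power2_eq_square)
      also have "\<dots> = 1" using diag[OF r(1)] r(2) by (simp add: sum_divide_distrib[symmetric])
      finally show ?thesis .
    qed
    define P' where "P' j k = P j k - b j * b k" for j k
    have "\<exists>d (B :: 'j \<Rightarrow> nat \<Rightarrow> real). real d = (\<Sum>j\<in>J. P' j j) \<and> (\<forall>j\<in>J. \<forall>k\<in>J. (\<Sum>i<d. B j i * B k i) = P' j k)"
    proof (rule Suc.IH)
      show "P' j k = P' k j" if "j \<in> J" "k \<in> J" for j k using Suc.prems(1)[OF that] by (simp add: P'_def)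
      show "(\<Sum>l\<in>J. P' j l * P' l k) = P' j k" if jk: "j \<in> J" "k \<in> J" for j k
      proof -
        have "(\<Sum>l\<in>J. P' j l * P' l k) = (\<Sum>l\<in>J. P j l * P l k) - (\<Sum>l\<in>J. P j l * b l) * b k - b j * (\<Sum>l\<in>J. P l k * b l) + b j * (\<Sum>l\<in>J. b l * b l) * b k"
          by (simp add: P'_def algebra_simps sum.distrib sum_subtractf sum_distrib_left)
        also have "(\<Sum>l\<in>J. P l k * b l) = b k"
          using Pb[OF jk(2)] Suc.prems(1)[OF jk(2)] by simp
        finally show ?thesis using Suc.prems(2)[OF jk] Pb[OF jk(1)] b1 by (simp add: P'_def)
      qed
      show "(\<Sum>j\<in>J. P' j j) \<le> real n"
        using Suc.prems(3) b1 by (simp add: P'_def sum_subtractf)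
    qed
    then obtain d B where dB: "real d = (\<Sum>j\<in>J. P' j j)" "\<And>j k. j \<in> J \<Longrightarrow> k \<in> J \<Longrightarrow> (\<Sum>i<d. B j i * B k i) = P' j k" by blast
    define B' where "B' j i = (if i < d then B j i else b j)" for j i
    have "real (Suc d) = (\<Sum>j\<in>J. P j j)" using dB(1) b1 by (simp add: P'_def sum_subtractf)
    moreover have "(\<Sum>i<Suc d. B' j i * B' k i) = P j k" if "j \<in> J" "k \<in> J" for j k
    proof -
      have "(\<Sum>i<Suc d. B' j i * B' k i) = (\<Sum>i<d. B j i * B k i) + b j * b k" by (simp add: B'_def)
      then show ?thesis using dB(2)[OF that] by (simp add: P'_def)
    qed
    ultimately show ?thesis by blast
  qed
qed

text \<open>The matrix \<open>1 - a a\<^sup>T\<close> is the orthogonal projection to the complement of the column space of \<open>a\<close>.\<close>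

lemma orthogonal_complement_frame:
  fixes a :: "'j \<Rightarrow> 'b \<Rightarrow> real"
  assumes J: "finite J" and K: "finite K"
    and orth: "\<And>b b'. b \<in> K \<Longrightarrow> b' \<in> K \<Longrightarrow> (\<Sum>j\<in>J. a j b * a j b') = (if b = b' then 1 else 0)"
  obtains d and B :: "'j \<Rightarrow> nat \<Rightarrow> real" where "card J = card K + d"
    "\<And>j k. j \<in> J \<Longrightarrow> k \<in> J \<Longrightarrow> (\<Sum>i<d. B j i * B k i) = (if j = k then 1 else 0) - (\<Sum>b\<in>K. a j b * a k b)"
proof -
  define Q where "Q j k = (\<Sum>b\<in>K. a j b * a k b)" for j k
  define P where "P j k = (if j = k then 1 else 0) - Q j k" for j k
  have QQ: "(\<Sum>l\<in>J. Q j l * Q l k) = Q j k" for j k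
  proof -
    have "(\<Sum>l\<in>J. Q j l * Q l k) = (\<Sum>l\<in>J. \<Sum>b\<in>K. \<Sum>b'\<in>K. (a j b * a l b) * (a l b' * a k b'))"
      by (simp add: Q_def sum_product)
    also have "\<dots> = (\<Sum>b\<in>K. \<Sum>b'\<in>K. \<Sum>l\<in>J. (a j b * a l b) * (a l b' * a k b'))"
      by (subst sum.swap, intro sum.cong refl, subst sum.swap, rule refl)
    also have "\<dots> = (\<Sum>b\<in>K. \<Sum>b'\<in>K. (a j b * a k b') * (\<Sum>l\<in>J. a l b * a l b'))"
      by (simp add: sum_distrib_left mult_ac)
    also have "\<dots> = (\<Sum>b\<in>K. \<Sum>b'\<in>K. if b = b' then a j b * a k b' else 0)"
      by (intro sum.cong refl) (auto simp: orth)
    also have "\<dots> = Q j k" using K by (simp add: Q_def)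
    finally show ?thesis .
  qed
  have trQ: "(\<Sum>j\<in>J. Q j j) = real (card K)"
  proof -
    have "(\<Sum>j\<in>J. Q j j) = (\<Sum>b\<in>K. \<Sum>j\<in>J. a j b * a j b)" unfolding Q_def by (rule sum.swap)
    also have "\<dots> = (\<Sum>b\<in>K. 1)" by (intro sum.cong refl) (simp add: orth)
    finally show ?thesis by simp
  qed
  have tr: "(\<Sum>j\<in>J. P j j) = real (card J) - real (card K)"
    by (simp add: P_def sum_subtractf trQ)
  have "\<exists>d (B :: 'j \<Rightarrow> nat \<Rightarrow> real). real d = (\<Sum>j\<in>J. P j j) \<and> (\<forall>j\<in>J. \<forall>k\<in>J. (\<Sum>i<d. B j i * B k i) = P j k)"
  proof (rule symmetric_idempotent_factorization[OF J])
    show "P j k = P k j" for j k by (simp add: P_def Q_def mult.commute)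
    show "(\<Sum>l\<in>J. P j l * P l k) = P j k" if jk: "j \<in> J" "k \<in> J" for j k
    proof -
      have "(\<Sum>l\<in>J. P j l * P l k) = (\<Sum>l\<in>J. (if j = l then (if l = k then 1 else 0) else 0) - (if l = j then Q l k else 0) - (if l = k then Q j l else 0) + Q j l * Q l k)"
        by (intro sum.cong refl) (auto simp: P_def algebra_simps)
      also have "\<dots> = (if j = k then 1 else 0) - Q j k - Q j k + Q j k"
        using J jk by (simp add: sum.distrib sum_subtractf QQ)
      finally show ?thesis by (simp add: P_def)
    qed
    show "(\<Sum>j\<in>J. P j j) \<le> real (card J)" by (simp add: tr)
  qed
  then obtain d B where dB: "real d = (\<Sum>j\<in>J. P j j)" "\<And>j k. j \<in> J \<Longrightarrow> k \<in> J \<Longrightarrow> (\<Sum>i<d. B j i * B k i) = P j k" by blast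
  have dim: "card J = card K + d" using dB(1) tr by linarith
  show ?thesis by (rule that[OF dim dB(2)[unfolded P_def Q_def]])
qed

lemma orthonormal_basis_facts:
  fixes H :: "'a::euclidean_space set"
  assumes H: "subspace H" and Bs: "orthonormal_basis_of H Bs"
  shows "finite Bs" "card Bs = dim H" "Bs \<subseteq> H"
    and "\<And>b b'. b \<in> Bs \<Longrightarrow> b' \<in> Bs \<Longrightarrow> b \<bullet> b' = (if b = b' then 1 else 0)"
    and "\<And>x. (\<Sum>b\<in>Bs. f b *\<^sub>R b) \<in> H"
    and "\<And>x. (\<Sum>b\<in>Bs. (b \<bullet> x)\<^sup>2) = (norm (orth_proj H x))\<^sup>2"
proof -
  have po: "pairwise orthogonal Bs" and n1: "\<And>b. b \<in> Bs \<Longrightarrow> norm b = 1" and sp: "span Bs = H"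
    using Bs by (auto simp: orthonormal_basis_of_def)
  have ind: "independent Bs"
    using po n1 by (intro pairwise_orthogonal_independent) (metis norm_zero zero_neq_one)+
  show fin: "finite Bs" using ind by (rule independent_imp_finite)
  show "card Bs = dim H" using ind sp by (metis dim_span dim_eq_card_independent)
  show sub: "Bs \<subseteq> H" using sp span_superset by blast
  show on: "b \<bullet> b' = (if b = b' then 1 else 0)" if "b \<in> Bs" "b' \<in> Bs" for b b'
    using po n1 that by (auto simp: pairwise_def orthogonal_def norm_eq_1)
  show "(\<Sum>b\<in>Bs. f b *\<^sub>R b) \<in> H"
    using sub H by (intro subspace_sum subspace_scale) auto
  show "(\<Sum>b\<in>Bs. (b \<bullet> x)\<^sup>2) = (norm (orth_proj H x))\<^sup>2" for x
  proof -
    let ?y = "orth_proj H x"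
    have yH: "?y \<in> H" by (rule orth_proj(1)[OF H])
    have eq: "b \<bullet> x = b \<bullet> ?y" if "b \<in> Bs" for b
    proof -
      have "orthogonal (x - ?y) b" using sub that by (intro orth_proj(2)[OF H]) auto
      then show ?thesis by (simp add: orthogonal_def inner_diff_left inner_diff_right inner_commute)
    qed
    have "?y \<in> span Bs" using yH sp by simp
    then obtain u where u: "?y = (\<Sum>b\<in>Bs. u b *\<^sub>R b)" using span_finite[OF fin] by auto
    have ub: "b \<bullet> ?y = u b" if b: "b \<in> Bs" for b
    proof -
      have "b \<bullet> ?y = (\<Sum>b'\<in>Bs. u b' * (b \<bullet> b'))" unfolding u by (simp add: inner_sum_right)
      also have "\<dots> = (\<Sum>b'\<in>Bs. if b = b' then u b' else 0)" using b by (intro sum.cong refl) (simp add: on)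
      finally show ?thesis using b fin by simp
    qed
    have "(norm ?y)\<^sup>2 = ?y \<bullet> ?y" by (simp add: power2_norm_eq_inner)
    also have "\<dots> = (\<Sum>b\<in>Bs. u b * (b \<bullet> ?y))" by (subst (1) u) (simp add: inner_sum_left)
    also have "\<dots> = (\<Sum>b\<in>Bs. (b \<bullet> x)\<^sup>2)" by (intro sum.cong refl) (simp add: ub eq power2_eq_square)
    finally show ?thesis ..
  qed
qed

lemma decomposition_of_identity_inner:
  fixes v :: "nat \<Rightarrow> 'a::real_inner"
  assumes "decomposition_of_identity m c v"
  shows "(\<Sum>j=1..m. c j * (x \<bullet> v j) * (y \<bullet> v j)) = x \<bullet> y"
proof -
  have "x = (\<Sum>j=1..m. c j *\<^sub>R tensor (v j) (v j) x)"
    using assms unfolding decomposition_of_identity_def by (metis id_apply)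
  then have "x \<bullet> y = (\<Sum>j=1..m. c j *\<^sub>R tensor (v j) (v j) x) \<bullet> y" by simp
  also have "\<dots> = (\<Sum>j=1..m. c j * (x \<bullet> v j) * (y \<bullet> v j))"
    by (simp add: inner_sum_left inner_sum_right tensor_def inner_commute mult_ac)
  finally show ?thesis ..
qed

lemma norm_Kp_homogeneous:
  assumes p: "0 < p" and r: "0 < r" and \<alpha>: "\<And>j. j \<in> {1..m} \<Longrightarrow> 0 \<le> \<alpha> j"
  shows "norm_Kp p m \<alpha> v (r *\<^sub>R x) = r * norm_Kp p m \<alpha> v x"
proof -
  have "norm_Kp p m \<alpha> v (r *\<^sub>R x) = (r powr p * (\<Sum>j=1..m. \<alpha> j * \<bar>x \<bullet> v j\<bar> powr p)) powr (1 / p)"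
    using r by (simp add: norm_Kp_def abs_mult powr_mult sum_distrib_left mult_ac)
  also have "\<dots> = r * norm_Kp p m \<alpha> v x"
    using p r \<alpha> by (simp add: norm_Kp_def powr_mult powr_powr sum_nonneg)
  finally show ?thesis .
qed

lemma norm_Kp_powr:
  assumes "0 < p" and \<alpha>: "\<And>j. j \<in> {1..m} \<Longrightarrow> 0 \<le> \<alpha> j"
  shows "norm_Kp p m \<alpha> v x powr p = (\<Sum>j=1..m. \<alpha> j * \<bar>x \<bullet> v j\<bar> powr p)"
proof -
  have "0 \<le> (\<Sum>j=1..m. \<alpha> j * \<bar>x \<bullet> v j\<bar> powr p)"
    by (intro sum_nonneg mult_nonneg_nonneg \<alpha>) auto
  then show ?thesis using assms(1) by (simp add: norm_Kp_def powr_powr)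
qed

text \<open>The layer-cake formula for the norm of \<open>K\<^sub>p\<close> restricted to \<open>H\<close>, divided by the same formula for the \<open>l\<^sub>p\<close> ball.\<close>

lemma vol_on_section_Kp:
  fixes v :: "nat \<Rightarrow> 'a::euclidean_space"
  assumes H: "subspace H" and p: "0 < p" and \<alpha>: "\<And>j. j \<in> {1..m} \<Longrightarrow> 0 \<le> \<alpha> j"
    and Bs: "Bs = (SOME B. orthonormal_basis_of H B)"
  defines "X \<equiv> (\<integral>\<^sup>+f. ennreal (exp (- (\<Sum>j=1..m. \<alpha> j * \<bar>(\<Sum>b\<in>Bs. f b *\<^sub>R b) \<bullet> v j\<bar> powr p))) \<partial>Pi\<^sub>M Bs (\<lambda>_. lborel))"
  assumes X: "X < \<infinity>"
  shows "ennreal (vol_on H (Kp p m \<alpha> v \<inter> H)) = ennreal (vol_ball_lp p (dim H) / alpha_p p ^ dim H) * X"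
proof -
  let ?L = "Pi\<^sub>M Bs (\<lambda>_. lborel :: real measure)"
  let ?\<phi> = "\<lambda>f. \<Sum>b\<in>Bs. f b *\<^sub>R b"
  have ob: "orthonormal_basis_of H Bs" unfolding Bs using orthonormal_basis_of_ex[OF H] by (rule someI_ex)
  note B = orthonormal_basis_facts[OF H ob]
  have \<phi>m [measurable]: "?\<phi> \<in> ?L \<rightarrow>\<^sub>M borel" by measurable
  define N where "N f = norm_Kp p m \<alpha> v (?\<phi> f)" for f
  have nm [measurable]: "norm_Kp p m \<alpha> v \<in> borel_measurable borel"
    unfolding norm_Kp_def by measurable
  have Nm [measurable]: "N \<in> borel_measurable ?L" unfolding N_def by measurable
  have Np: "N f powr p = (\<Sum>j=1..m. \<alpha> j * \<bar>?\<phi> f \<bullet> v j\<bar> powr p)" for f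
    unfolding N_def by (rule norm_Kp_powr[OF p \<alpha>])
  have Nhom: "N (\<lambda>b\<in>Bs. r * f b) = r * N f" if r: "0 < r" for r f
  proof -
    have "?\<phi> (\<lambda>b\<in>Bs. r * f b) = r *\<^sub>R ?\<phi> f" by (simp add: scaleR_sum_right)
    then show ?thesis unfolding N_def using norm_Kp_homogeneous[OF p r, of m \<alpha> v "?\<phi> f"] \<alpha> by simp
  qed
  have "X = (\<integral>\<^sup>+f. ennreal (exp (- (N f powr p))) \<partial>?L)" by (simp add: X_def Np)
  also have "\<dots> = ennreal (Gamma (1 + real (card Bs) / p)) * emeasure ?L {f \<in> space ?L. N f \<le> 1}"
    by (rule nn_integral_exp_neg_gauge_powr[OF B(1) Nm Nhom _ p]) (simp_all add: N_def norm_Kp_def)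
  finally have eq: "X = ennreal (Gamma (1 + real (dim H) / p)) * emeasure ?L {f \<in> space ?L. N f \<le> 1}"
    unfolding B(2) .
  have G: "0 < Gamma (1 + real (dim H) / p)" using p by (intro Gamma_real_pos) (auto intro: add_pos_nonneg)
  have \<alpha>p: "0 < alpha_p p" by (rule alpha_p_pos[OF p])
  have set: "{f \<in> space ?L. N f \<le> 1} = ?\<phi> -` (Kp p m \<alpha> v \<inter> H) \<inter> space ?L"
    using B(5) by (auto simp: N_def Kp_def)
  have "Kp p m \<alpha> v \<in> sets borel" unfolding Kp_def by measurable
  then have meas: "Kp p m \<alpha> v \<inter> H \<in> sets borel"
    using closed_subspace[OF H] by (intro sets.Int) auto
  have "vol_on H (Kp p m \<alpha> v \<inter> H) = measure ?L (?\<phi> -` (Kp p m \<alpha> v \<inter> H) \<inter> space ?L)"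
    using meas unfolding vol_on_def subspace_lborel_def Let_def Bs[symmetric] by (intro measure_distr) auto
  then have vol: "vol_on H (Kp p m \<alpha> v \<inter> H) = measure ?L {f \<in> space ?L. N f \<le> 1}" unfolding set .
  have "emeasure ?L {f \<in> space ?L. N f \<le> 1} \<noteq> \<infinity>"
  proof
    assume "emeasure ?L {f \<in> space ?L. N f \<le> 1} = \<infinity>"
    then show False using eq G X by (simp add: ennreal_mult_top)
  qed
  then have fin: "emeasure ?L {f \<in> space ?L. N f \<le> 1} = ennreal (vol_on H (Kp p m \<alpha> v \<inter> H))"
    unfolding vol by (simp add: emeasure_eq_ennreal_measure)
  have "vol_ball_lp p (dim H) / alpha_p p ^ dim H = 1 / Gamma (1 + real (dim H) / p)"
    using vol_ball_lp_eq[OF p, of "dim H"] G \<alpha>p by (simp add: field_simps)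
  then have "ennreal (vol_ball_lp p (dim H) / alpha_p p ^ dim H) * X = 
    (ennreal (1 / Gamma (1 + real (dim H) / p)) * ennreal (Gamma (1 + real (dim H) / p))) * ennreal (vol_on H (Kp p m \<alpha> v \<inter> H))"
    unfolding eq fin by (simp add: mult.assoc)
  also have "ennreal (1 / Gamma (1 + real (dim H) / p)) * ennreal (Gamma (1 + real (dim H) / p)) = 1"
    using G by (simp add: ennreal_mult[symmetric])
  finally show ?thesis by simp
qed

theorem theorem35:
  fixes p :: real and m k m0 :: nat
    and c \<alpha> ct :: "nat \<Rightarrow> real"
    and v :: "nat \<Rightarrow> real ^ 'n"
    and H :: "(real ^ 'n) set"
    and J Jt :: "nat set"
  assumes "1 \<le> p" and "p \<le> 2"
    and "\<And>j. j \<in> {1..m} \<Longrightarrow> 0 < c j \<and> c j \<le> 1"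
    and "\<And>j. j \<in> {1..m} \<Longrightarrow> v j \<in> sphere 0 1"
    and "decomposition_of_identity m c v"
    and "\<And>j. j \<in> {1..m} \<Longrightarrow> 0 < \<alpha> j"
    and "subspace H" and "dim H = k"
    and "J = {j \<in> {1..m}. orth_proj H (v j) \<noteq> 0}"
    and "m0 = card J"
    and "\<And>j. j \<in> J \<Longrightarrow> ct j = c j * (norm (orth_proj H (v j)))\<^sup>2"
    and "Jt = {j \<in> J. ct j \<noteq> 1}"
  shows "vol_on H (Kp p m \<alpha> v \<inter> H) \<ge>
           vol_ball_lp p k * sqrt (pi * real (m0 - k)) ^ (m0 - k)
             / (alpha_p p ^ k * (2 * pi) ^ (m0 - k))
           * (\<Prod>j\<in>J. sqrt (c j) / \<alpha> j powr (1 / p))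
           * gamma_mean (real (m0 - k) / 2)
               (\<lambda>t. \<Prod>j\<in>Jt. gamma_p p (sqrt (t * (c j / \<alpha> j powr (2 / p)) * (1 - ct j))))
       \<and> (let D = vol_ball_lp p k
                 * (\<Prod>j\<in>J. (c j powr (p / 2) / \<alpha> j)
                      powr (c j * (norm (orth_proj H (v j)))\<^sup>2 / p));
              U = D / (alpha_p p ^ k * (2 * pi) ^ (m0 - k))
                 * alpha_p p ^ card (J - Jt)
                 * (\<Prod>j\<in>Jt. (LINT t|lborel.
                      gamma_p p (sqrt (1 - ct j) * t) powr (1 / (1 - ct j))) powr (1 - ct j))
          in vol_on H (Kp p m \<alpha> v \<inter> H) \<le> U \<and> U \<le> D)"
proof -
  note H = assms(7)
  have p0: "0 < p" using assms(1) by simp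
  define Bs where "Bs = (SOME B. orthonormal_basis_of H B)"
  have ob: "orthonormal_basis_of H Bs" unfolding Bs_def using orthonormal_basis_of_ex[OF H] by (rule someI_ex)
  note basis = orthonormal_basis_facts[OF H ob]
  have cpos: "0 < c j" and \<alpha>pos: "0 < \<alpha> j" and J1: "j \<in> {1..m}" if "j \<in> J" for j
    using that assms(3,6,9) by auto
  have finJ: "finite J" unfolding assms(9) by simp
  have vanish: "b \<bullet> v j = 0" if b: "b \<in> H" and j: "j \<in> {1..m} - J" for b j
  proof -
    have "orth_proj H (v j) = 0" using j unfolding assms(9) by auto
    then have "orthogonal (v j) b" using orth_proj(2)[OF H b, of "v j"] by simp
    then show ?thesis by (simp add: orthogonal_def inner_commute)
  qed
  have JJ: "J \<subseteq> {1..m}" using assms(9) by auto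
  define a where "a j b = sqrt (c j) * (b \<bullet> v j)" for j and b :: "real ^ 'n"
  have orth: "(\<Sum>j\<in>J. a j b * a j b') = (if b = b' then 1 else 0)" if b: "b \<in> Bs" "b' \<in> Bs" for b b'
  proof -
    have "(\<Sum>j\<in>J. a j b * a j b') = (\<Sum>j\<in>J. c j * (b \<bullet> v j) * (b' \<bullet> v j))"
    proof (rule sum.cong[OF refl])
      fix j assume "j \<in> J"
      then have "sqrt (c j) * sqrt (c j) = c j" using cpos[of j] by simp
      then show "a j b * a j b' = c j * (b \<bullet> v j) * (b' \<bullet> v j)"
        by (simp add: a_def mult_ac)
    qed
    also have "\<dots> = (\<Sum>j=1..m. c j * (b \<bullet> v j) * (b' \<bullet> v j))"
      using JJ basis(3) b vanish by (intro sum.mono_neutral_left) auto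
    also have "\<dots> = b \<bullet> b'" by (rule decomposition_of_identity_inner[OF assms(5)])
    finally show ?thesis using basis(4)[OF b] by simp
  qed
  obtain d B where card: "card J = card Bs + d" and
    compl: "\<And>j l. j \<in> J \<Longrightarrow> l \<in> J \<Longrightarrow> (\<Sum>i<d. B j i * B l i) = (if j = l then 1 else 0) - (\<Sum>b\<in>Bs. a j b * a l b)"
    using orthogonal_complement_frame[OF finJ basis(1) orth] by metis
  have d: "m0 - k = d" using card assms(8,10) basis(2) by simp
  define A where "A j = sqrt (c j) / \<alpha> j powr (1 / p)" for j
  have Apos: "0 < A j" if "j \<in> J" for j using cpos[OF that] \<alpha>pos[OF that] by (simp add: A_def)
  interpret S: section_data J Bs "{..<d}" a B A p
    by unfold_locales (use finJ basis(1) card orth compl Apos assms(1,2) in auto)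
  have cw: "S.complement_weight j = 1 - ct j" if j: "j \<in> J" for j
  proof -
    have "(\<Sum>b\<in>Bs. (a j b)\<^sup>2) = c j * (\<Sum>b\<in>Bs. (b \<bullet> v j)\<^sup>2)"
      using cpos[OF j] by (simp add: a_def power_mult_distrib sum_distrib_left)
    also have "\<dots> = ct j" by (simp add: basis(6) assms(11)[OF j])
    finally show ?thesis using S.complement_weight_eq[OF j] by simp
  qed
  have Jt: "Jt = S.positive_weights"
    unfolding assms(12) S.positive_weights_def using cw by auto
  have A2: "(A j)\<^sup>2 = c j / \<alpha> j powr (2 / p)" if "j \<in> J" for j
  proof -
    have "(\<alpha> j powr (1 / p))\<^sup>2 = \<alpha> j powr (2 / p)"
      using \<alpha>pos[OF that] by (simp add: power2_eq_square powr_add[symmetric])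
    then show ?thesis using cpos[OF that] by (simp add: A_def power_divide)
  qed
  have Apow: "A j powr x = (c j powr (p / 2) / \<alpha> j) powr (x / p)" if "j \<in> J" for j x
  proof -
    have "(c j powr (p / 2) / \<alpha> j) powr (1 / p) = A j"
      using cpos[OF that] \<alpha>pos[OF that] p0 by (simp add: A_def powr_divide powr_powr powr_half_sqrt)
    then have "A j powr x = ((c j powr (p / 2) / \<alpha> j) powr (1 / p)) powr x" by simp
    then show ?thesis by (simp add: powr_powr)
  qed
  \<comment> \<open>Indices outside \<open>J\<close> drop out since \<open>v\<^sub>j\<close> is orthogonal to \<open>H\<close>; for the others \<open>\<alpha>\<^sub>j = c\<^sub>j\<^sup>p\<^sup>/\<^sup>2 / A\<^sub>j\<^sup>p\<close>.\<close>
  have integrand: "(\<Sum>j=1..m. \<alpha> j * \<bar>(\<Sum>b\<in>Bs. f b *\<^sub>R b) \<bullet> v j\<bar> powr p) = (\<Sum>j\<in>J. \<bar>S.form f j / A j\<bar> powr p)" for f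
  proof -
    let ?x = "\<Sum>b\<in>Bs. f b *\<^sub>R b"
    have "(\<Sum>j=1..m. \<alpha> j * \<bar>?x \<bullet> v j\<bar> powr p) = (\<Sum>j\<in>J. \<alpha> j * \<bar>?x \<bullet> v j\<bar> powr p)"
      using JJ vanish[OF basis(5)[of f]] by (intro sum.mono_neutral_right) auto
    also have "\<dots> = (\<Sum>j\<in>J. \<bar>S.form f j / A j\<bar> powr p)"
    proof (rule sum.cong[OF refl])
      fix j assume j: "j \<in> J"
      have "S.form f j = sqrt (c j) * (?x \<bullet> v j)"
        by (simp add: S.form_def a_def inner_sum_left sum_distrib_left mult_ac)
      then have "\<bar>S.form f j / A j\<bar> = \<alpha> j powr (1 / p) * \<bar>?x \<bullet> v j\<bar>"
        using cpos[OF j] \<alpha>pos[OF j] by (simp add: A_def abs_mult)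
      then show "\<alpha> j * \<bar>?x \<bullet> v j\<bar> powr p = \<bar>S.form f j / A j\<bar> powr p"
        using \<alpha>pos[OF j] p0 by (simp add: powr_mult powr_powr)
    qed
    finally show ?thesis .
  qed
  let ?vol = "vol_on H (Kp p m \<alpha> v \<inter> H)"
  let ?r = "vol_ball_lp p k / alpha_p p ^ k"
  have \<alpha>p: "0 < alpha_p p" by (rule alpha_p_pos[OF p0])
  have r: "0 \<le> ?r" using \<alpha>p by (simp add: vol_ball_lp_def)
  define V where "V = (\<Prod>j\<in>J. A j powr (1 - S.complement_weight j)) / (2 * pi) ^ d *
     (alpha_p p ^ card (J - Jt) * (\<Prod>j\<in>Jt. S.bl_factor j powr S.complement_weight j))"
  have upper: "S.section_integral \<le> ennreal V"
    using S.section_integral_upper by (simp add: V_def Jt)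
  have V0: "0 \<le> V" unfolding V_def using \<alpha>p by (intro mult_nonneg_nonneg divide_nonneg_nonneg prod_nonneg) auto
  have X: "S.section_integral = (\<integral>\<^sup>+f. ennreal (exp (- (\<Sum>j=1..m. \<alpha> j * \<bar>(\<Sum>b\<in>Bs. f b *\<^sub>R b) \<bullet> v j\<bar> powr p))) \<partial>Pi\<^sub>M Bs (\<lambda>_. lborel))"
    unfolding S.section_integral_def integrand using finJ by (simp add: exp_sum flip: sum_negf)
  have vol: "ennreal ?vol = ennreal ?r * S.section_integral"
    unfolding X assms(8)[symmetric]
  proof (rule vol_on_section_Kp[OF H p0 _ Bs_def])
    show "0 \<le> \<alpha> j" if "j \<in> {1..m}" for j using assms(6)[OF that] by simp
    show "(\<integral>\<^sup>+f. ennreal (exp (- (\<Sum>j=1..m. \<alpha> j * \<bar>(\<Sum>b\<in>Bs. f b *\<^sub>R b) \<bullet> v j\<bar> powr p))) \<partial>Pi\<^sub>M Bs (\<lambda>_. lborel)) < \<infinity>"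
      unfolding X[symmetric] using upper by (auto intro: le_less_trans)
  qed
  have vol0: "0 \<le> ?vol" by (simp add: vol_on_def)
  define L where "L = sqrt (pi * real d) ^ d / (2 * pi) ^ d * (\<Prod>j\<in>J. A j) *
     gamma_mean (real d / 2) (\<lambda>t. \<Prod>j\<in>Jt. gamma_p p (sqrt (t * (A j)\<^sup>2 * S.complement_weight j)))"
  have lower: "ennreal L \<le> S.section_integral"
    using S.section_integral_lower by (simp add: L_def Jt)
  have "ennreal (?r * L) = ennreal ?r * ennreal L" by (rule ennreal_mult'[OF r])
  also have "\<dots> \<le> ennreal ?vol" unfolding vol by (rule mult_left_mono[OF lower]) simp
  finally have volL: "?r * L \<le> ?vol" using vol0 by (auto simp: ennreal_le_iff2)
  have "ennreal ?vol \<le> ennreal ?r * ennreal V" unfolding vol by (rule mult_left_mono[OF upper]) simp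
  also have "\<dots> = ennreal (?r * V)" by (rule ennreal_mult'[OF r, symmetric])
  finally have volU: "?vol \<le> ?r * V" using mult_nonneg_nonneg[OF r V0] by (simp only: ennreal_le_iff)
  have JtJ: "Jt \<subseteq> J" using assms(12) by auto
  have L_eq: "?r * L = vol_ball_lp p k * sqrt (pi * real (m0 - k)) ^ (m0 - k)
             / (alpha_p p ^ k * (2 * pi) ^ (m0 - k))
           * (\<Prod>j\<in>J. sqrt (c j) / \<alpha> j powr (1 / p))
           * gamma_mean (real (m0 - k) / 2)
               (\<lambda>t. \<Prod>j\<in>Jt. gamma_p p (sqrt (t * (c j / \<alpha> j powr (2 / p)) * (1 - ct j))))"
  proof -
    have "(\<lambda>t. \<Prod>j\<in>Jt. gamma_p p (sqrt (t * (A j)\<^sup>2 * S.complement_weight j))) = 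
       (\<lambda>t. \<Prod>j\<in>Jt. gamma_p p (sqrt (t * (c j / \<alpha> j powr (2 / p)) * (1 - ct j))))"
      using JtJ by (intro ext prod.cong refl) (auto simp: cw A2)
    then have "L = sqrt (pi * real d) ^ d / (2 * pi) ^ d * (\<Prod>j\<in>J. A j) * 
       gamma_mean (real d / 2) (\<lambda>t. \<Prod>j\<in>Jt. gamma_p p (sqrt (t * (c j / \<alpha> j powr (2 / p)) * (1 - ct j))))"
      by (simp only: L_def)
    then show ?thesis unfolding d A_def by simp
  qed
  define D where "D = vol_ball_lp p k * (\<Prod>j\<in>J. (c j powr (p / 2) / \<alpha> j) powr (c j * (norm (orth_proj H (v j)))\<^sup>2 / p))"
  define W where "W = alpha_p p ^ card (J - Jt) * (\<Prod>j\<in>Jt. S.bl_factor j powr S.complement_weight j)"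
  have D0: "0 \<le> D" unfolding D_def by (intro mult_nonneg_nonneg prod_nonneg) (auto simp: vol_ball_lp_def)
  have D_eq: "D = vol_ball_lp p k * (\<Prod>j\<in>J. A j powr (1 - S.complement_weight j))"
    unfolding D_def by (intro arg_cong2[where f = "(*)"] refl prod.cong) (simp add: Apow cw assms(11))
  have rV: "?r * V = D / (alpha_p p ^ k * (2 * pi) ^ d) * W"
    by (simp add: V_def D_eq W_def)
  have W_eq: "W = alpha_p p ^ card (J - Jt) * (\<Prod>j\<in>Jt. (LINT t|lborel.
                      gamma_p p (sqrt (1 - ct j) * t) powr (1 / (1 - ct j))) powr (1 - ct j))"
    unfolding W_def S.bl_factor_def using JtJ by (intro arg_cong2[where f = "(*)"] refl prod.cong) (auto simp: cw)
  have W_le: "W \<le> alpha_p p ^ k * (2 * pi) ^ d"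
    using S.prod_bl_factor_le basis(2) assms(8) by (simp add: W_def Jt)
  have "D / (alpha_p p ^ k * (2 * pi) ^ d) * W \<le> D / (alpha_p p ^ k * (2 * pi) ^ d) * (alpha_p p ^ k * (2 * pi) ^ d)"
    using D0 \<alpha>p by (intro mult_left_mono[OF W_le] divide_nonneg_nonneg) auto
  also have "\<dots> = D" using \<alpha>p by simp
  finally have UD: "D / (alpha_p p ^ k * (2 * pi) ^ d) * W \<le> D" .
  show ?thesis
    unfolding Let_def D_def[symmetric] mult.assoc[of "D / _"] d W_eq[symmetric]
    using volL volU UD unfolding L_eq rV d by (auto simp only: mult.assoc)
qed

end
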